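(* Let $j\in\{1,\ldots,d\}$ be fixed and let $\alpha=(\alpha_1,\ldots,\alpha_d)$ satisfy $\alpha_j>-3/2$ and $\alpha_i>-1$ for $i\ne j$. If $\alpha_j\ge-1/2$, then $\{\widetilde T_t^{\alpha,\ell,j}\}_{t\ge0}$ is a submarkovian (but not Markovian) symmetric diffusion semigroup on $(\mathbb{R}_+^d,\mu_\alpha)$ satisfying, for $1\le p\le\infty$, $$\|\widetilde T_t^{\alpha,\ell,j}\|_{p\to p}\le e^{-2t}(\cosh 2t)^{-(|\alpha|+d)},\qquad t>0.$$ If $\alpha_j\in(-3/2,-1/2)$, then $\{\widetilde T_t^{\alpha,\ell,j}\}_{t\ge0}$ is not an $L^p$-contractive semigroup, but there exists a constant $c=c(\alpha)>1$ such that, for $1\le p\le\infty$, $$\|\widetilde T_t^{\alpha,\ell,j}\|_{p\to p}\le c\,e^{-2t}(\cosh 2t)^{-(|\alpha|+d)},\qquad t>0.$$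
   Context: Notation: $d\ge 1$, $\mathbb{R}_+=(0,\infty)$, $d\mu_\alpha(x)=\big(\prod_{i=1}^d x_i^{2\alpha_i+1}\big)dx$ on $\mathbb{R}_+^d$, $L^p=L^p(\mathbb{R}_+^d,\mu_\alpha)$, $\|\cdot\|_{p\to p}$ is the operator norm on $L^p$, $\|x\|$ is the Euclidean norm, $\mathbf 1$ is the constant function $1$, $|\alpha|=\alpha_1+\ldots+\alpha_d$ (possibly negative), $e_j$ is the $j$th coordinate vector, and $I_\nu$ is the modified Bessel function of the first kind of order $\nu$. The semigroup. For $\gamma\in(-1,\infty)^d$, $t>0$ and $x,y\in\mathbb{R}_+^d$, the heat kernel associated with Laguerre functions of convolution type is $$G_t^{\gamma,\ell}(x,y)=(\sinh 2t)^{-d}\exp\Big(-\tfrac12\coth(2t)\big(\|x\|^2+\|y\|^2\big)\Big)\prod_{i=1}^d(x_iy_i)^{-\gamma_i}I_{\gamma_i}\Big(\frac{x_iy_i}{\sinh 2t}\Big).$$ The modified semigroup is given on all $L^p(\mathbb{R}_+^d,\mu_\alpha)$, $1\le p\le\infty$, by $$\widetilde T_t^{\alpha,\ell,j}f(x)=e^{-2t}\int_{\mathbb{R}_+^d}x_jy_j\,G_t^{\alpha+e_j,\ell}(x,y)f(y)\,d\mu_\alpha(y),\quad x\in\mathbb{R}_+^d,\ t>0,$$ and $\widetilde T_0^{\alpha,\ell,j}=\mathrm{Id}$. On $L^2$ it is the semigroup generated by a suitable self-adjoint extension of $L_\alpha^\ell+\frac{2\alpha_j+1}{x_j^2}+2$,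 where $L_\alpha^\ell=-\Delta+\|x\|^2-\sum_{i=1}^d\frac{2\alpha_i+1}{x_i}\partial_{x_i}$. Definitions. On a $\sigma$-finite measure space $(X,\mu)$, a symmetric diffusion semigroup is a family of linear operators $\{T_t\}_{t\ge0}$, $T_0=\mathrm{Id}$, mapping a linear subspace of the measurable functions that contains all $L^p(X,\mu)$, $1\le p\le\infty$ (e.g. $L^1+L^\infty$) into measurable functions, such that: (i) for each $1\le p\le\infty$ every $T_t$ is a contraction on $L^p$ and $\{T_t\}_{t\ge0}$ is a semigroup there; (ii) each $T_t$ is self-adjoint on $L^2$; (iii) $\lim_{t\to0^+}T_tf=f$ in $L^2$ for each $f\in L^2$. It is Markovian if in addition (iv) $T_tf\ge0$ whenever $f\ge0$, for all $t$, and (v) $T_t\mathbf 1=\mathbf 1$ for all $t$. It is submarkovian if (i)-(iv) hold and (v') $T_t\mathbf 1\le\mathbf 1$ for all $t$. A semigroup $\{T_t\}_{t\ge 0}=\{\exp(-tL)\}_{t\ge0}$ generated by a positive self-adjoint operator $L$ on $L^2(X,\mu)$ is called $L^p$-contractive if $\|T_tf\|_p\le\|f\|_p$ for all $1\le p\le\infty$, all $t\ge0$ and all $f\in L^2\cap L^p(X,\mu)$. *)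

theory Defs
  imports "HOL-Analysis.Analysis" "HOL-Probability.Essential_Supremum"
begin

section \<open>Lebesgue spaces and operator norms\<close>

text \<open>
  Functions are real valued; elements of \<open>L\<^sup>p\<close> are represented by measurable functions, and equality
  in \<open>L\<^sup>p\<close> is equality almost everywhere. The exponent \<open>p\<close> is an extended nonnegative real, always
  used with \<open>1 \<le> p\<close>. The norm of a function that is not measurable is set to \<open>\<infinity>\<close>, so that a finite norm
  entails measurability.
\<close>

definition Lp_norm :: "'a measure \<Rightarrow> ennreal \<Rightarrow> ('a \<Rightarrow> real) \<Rightarrow> ennreal" where
  "Lp_norm M p f =
    (if f \<notin> borel_measurable M then \<infinity>
     else if p = \<infinity> then esssup M (\<lambda>x. ennreal \<bar>f x\<bar>)
     else (let r = enn2real p; I = (\<integral>\<^sup>+x. ennreal (\<bar>f x\<bar> powr r) \<partial>M)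
           in if I = \<infinity> then \<infinity> else ennreal (enn2real I powr (1 / r))))"

definition Lp_space :: "'a measure \<Rightarrow> ennreal \<Rightarrow> ('a \<Rightarrow> real) set" where
  "Lp_space M p = {f \<in> borel_measurable M. Lp_norm M p f < \<infinity>}"

definition Lp_opnorm :: "'a measure \<Rightarrow> ennreal \<Rightarrow> (('a \<Rightarrow> real) \<Rightarrow> ('a \<Rightarrow> real)) \<Rightarrow> ennreal" where
  "Lp_opnorm M p T = (SUP f\<in>{f \<in> Lp_space M p. Lp_norm M p f \<le> 1}. Lp_norm M p (T f))"


section \<open>Diffusion semigroups\<close>

text \<open>
  The set \<open>D\<close> is the common domain of the operators: a linear subspace of the measurable functions
  that contains every \<open>L\<^sup>p\<close>. Linearity is understood modulo equality almost everywhere, and the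
  operators have to respect that equality. Since the operators in condition (ii) are bounded and
  everywhere defined on \<open>L\<^sup>2\<close>, symmetry of the bilinear form is self-adjointness.
\<close>

definition operator_family_on ::
    "'a measure \<Rightarrow> ('a \<Rightarrow> real) set \<Rightarrow> (real \<Rightarrow> ('a \<Rightarrow> real) \<Rightarrow> ('a \<Rightarrow> real)) \<Rightarrow> bool" where
  "operator_family_on M D T \<longleftrightarrow>
     D \<subseteq> borel_measurable M \<and>
     (\<forall>p\<ge>1. Lp_space M p \<subseteq> D) \<and>
     (\<forall>f\<in>D. \<forall>g\<in>D. \<forall>a b. (\<lambda>x. a * f x + b * g x) \<in> D) \<and>
     (\<forall>t\<ge>0. \<forall>f\<in>D. T t f \<in> borel_measurable M) \<and>
     (\<forall>t\<ge>0. \<forall>f\<in>D. \<forall>g\<in>D. (AE x in M. f x = g x) \<longrightarrow> (AE x in M. T t f x = T t g x)) \<and>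
     (\<forall>t\<ge>0. \<forall>f\<in>D. \<forall>g\<in>D. \<forall>a b.
        AE x in M. T t (\<lambda>y. a * f y + b * g y) x = a * T t f x + b * T t g x) \<and>
     (\<forall>f\<in>D. AE x in M. T 0 f x = f x)"

definition symmetric_diffusion_semigroup_on ::
    "'a measure \<Rightarrow> ('a \<Rightarrow> real) set \<Rightarrow> (real \<Rightarrow> ('a \<Rightarrow> real) \<Rightarrow> ('a \<Rightarrow> real)) \<Rightarrow> bool" where
  "symmetric_diffusion_semigroup_on M D T \<longleftrightarrow>
     sigma_finite_measure M \<and>
     operator_family_on M D T \<and>
     \<comment> \<open>(i)\<close>
     (\<forall>p\<ge>1. \<forall>f\<in>Lp_space M p.
        (\<forall>t\<ge>0. Lp_norm M p (T t f) \<le> Lp_norm M p f) \<and>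
        (\<forall>s\<ge>0. \<forall>t\<ge>0. AE x in M. T (s + t) f x = T s (T t f) x)) \<and>
     \<comment> \<open>(ii)\<close>
     (\<forall>t\<ge>0. \<forall>f\<in>Lp_space M 2. \<forall>g\<in>Lp_space M 2.
        (\<integral>x. T t f x * g x \<partial>M) = (\<integral>x. f x * T t g x \<partial>M)) \<and>
     \<comment> \<open>(iii)\<close>
     (\<forall>f\<in>Lp_space M 2. ((\<lambda>t. Lp_norm M 2 (\<lambda>x. T t f x - f x)) \<longlongrightarrow> 0) (at_right 0))"

definition positivity_preserving_on ::
    "'a measure \<Rightarrow> ('a \<Rightarrow> real) set \<Rightarrow> (real \<Rightarrow> ('a \<Rightarrow> real) \<Rightarrow> ('a \<Rightarrow> real)) \<Rightarrow> bool" where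
  "positivity_preserving_on M D T \<longleftrightarrow>
     (\<forall>t\<ge>0. \<forall>f\<in>D. (AE x in M. 0 \<le> f x) \<longrightarrow> (AE x in M. 0 \<le> T t f x))"

definition markovian_semigroup ::
    "'a measure \<Rightarrow> (real \<Rightarrow> ('a \<Rightarrow> real) \<Rightarrow> ('a \<Rightarrow> real)) \<Rightarrow> bool" where
  "markovian_semigroup M T \<longleftrightarrow>
     (\<exists>D. symmetric_diffusion_semigroup_on M D T \<and> positivity_preserving_on M D T \<and>
          (\<forall>t\<ge>0. AE x in M. T t (\<lambda>_. 1) x = 1))"

definition submarkovian_semigroup ::
    "'a measure \<Rightarrow> (real \<Rightarrow> ('a \<Rightarrow> real) \<Rightarrow> ('a \<Rightarrow> real)) \<Rightarrow> bool" where
  "submarkovian_semigroup M T \<longleftrightarrow>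
     (\<exists>D. symmetric_diffusion_semigroup_on M D T \<and> positivity_preserving_on M D T \<and>
          (\<forall>t\<ge>0. AE x in M. T t (\<lambda>_. 1) x \<le> 1))"

text \<open>
  The contractivity property of a semigroup generated by a positive self-adjoint operator on \<open>L\<^sup>2\<close>.
  That the semigroup is of this kind is not part of the predicate, so its negation says
  that contractivity itself fails.
\<close>

definition Lp_contractive ::
    "'a measure \<Rightarrow> (real \<Rightarrow> ('a \<Rightarrow> real) \<Rightarrow> ('a \<Rightarrow> real)) \<Rightarrow> bool" where
  "Lp_contractive M T \<longleftrightarrow>
     (\<forall>p\<ge>1. \<forall>t\<ge>0. \<forall>f \<in> Lp_space M 2 \<inter> Lp_space M p. Lp_norm M p (T t f) \<le> Lp_norm M p f)"


section \<open>The modified Laguerre semigroup\<close>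

text \<open>
  Modified Bessel function of the first kind for positive argument. The reciprocal Gamma function
  makes the terms at the poles of Gamma vanish.
\<close>

definition bessel_I :: "real \<Rightarrow> real \<Rightarrow> real" where
  "bessel_I \<nu> z = (\<Sum>k. rGamma (real k + \<nu> + 1) / fact k * (z / 2) powr (2 * real k + \<nu>))"

definition orthant :: "(real ^ 'n) set" where
  "orthant = {x. \<forall>i. 0 < x $ i}"

definition laguerre_measure :: "real ^ 'n \<Rightarrow> (real ^ 'n) measure" where
  "laguerre_measure \<alpha> =
     density (restrict_space lborel orthant) (\<lambda>x. ennreal (\<Prod>i\<in>UNIV. (x $ i) powr (2 * \<alpha> $ i + 1)))"

definition laguerre_kernel :: "real ^ 'n \<Rightarrow> real \<Rightarrow> real ^ 'n \<Rightarrow> real ^ 'n \<Rightarrow> real" where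
  "laguerre_kernel \<gamma> t x y =
     1 / sinh (2 * t) ^ CARD('n)
       * exp (- (1 / 2) * (cosh (2 * t) / sinh (2 * t)) * ((norm x)\<^sup>2 + (norm y)\<^sup>2))
       * (\<Prod>i\<in>UNIV. (x $ i * y $ i) powr (- \<gamma> $ i) * bessel_I (\<gamma> $ i) (x $ i * y $ i / sinh (2 * t)))"

definition modified_laguerre_semigroup ::
    "real ^ 'n \<Rightarrow> 'n \<Rightarrow> real \<Rightarrow> (real ^ 'n \<Rightarrow> real) \<Rightarrow> (real ^ 'n \<Rightarrow> real)" where
  "modified_laguerre_semigroup \<alpha> j t f =
     (if t = 0 then f
      else (\<lambda>x. exp (- 2 * t) *
             (\<integral>y. x $ j * y $ j * laguerre_kernel (\<alpha> + axis j 1) t x y * f y \<partial>laguerre_measure \<alpha>)))"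

end

theory Submission
  imports Defs
begin

text \<open>
  Everything rests on the product structure of the kernel and on two facts per coordinate: Weber's
  exponential integrals, obtained by termwise integration of the Bessel series, which give the
  Chapman-Kolmogorov identity and the explicit action on Gaussians; and the image of the constant
  function 1. For coordinate \<open>j\<close> and \<open>\<nu> = \<alpha>\<^sub>j + 1\<close> the latter is \<open>cosh(2t) powr (-\<nu>) * exp(- w * sinh(2t)\<^sup>2)\<close>
  times \<open>sqrt (w / \<pi>) * \<integral> exp(- w v) * v powr (-1/2) * (1 - v) powr (\<nu> - 1/2) dv\<close> over \<open>(0,1)\<close>, where
  \<open>w = x\<^sub>j\<^sup>2 / (2 sinh(2t) cosh(2t))\<close>. Without the last factor and over \<open>(0,\<infinity>)\<close> this is a probability
  integral; so it is at most 1 for \<open>\<nu> \<ge> 1/2\<close>, bounded for all \<open>\<nu> > -1/2\<close>, and exceeds 1 for large \<open>w\<close>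
  if \<open>\<nu> < 1/2\<close>. By symmetry and Jensen's inequality the mass of the kernel bounds all the \<open>L\<^sup>p\<close> norms.
  Strong continuity is checked on Gaussians times \<open>x\<^sub>j\<close>, whose span is dense by a monotone class argument.
\<close>

section \<open>Lebesgue norms\<close>

text \<open>The modified kernel has Bessel index \<open>\<alpha> $ j + 1\<close> in coordinate
  \<open>j\<close>, while the measure still carries the exponent belonging to
  \<open>\<alpha> $ j\<close>. On functions with a factor \<open>x $ j\<close> the mismatch
  disappears and Gaussians go to Gaussians; on the constant 1 it stays, the Gamma quotients do not
  cancel, and the confluent integral \<open>lag_mass\<close> is left. The threshold
  \<open>- 1 / 2\<close> for \<open>\<alpha> $ j\<close> is the sign change of the exponent
  \<open>g - 1 / 2\<close> in that integral.

  Failure of contractivity is a short-time effect near the wall where \<open>x $ j\<close> vanishes.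
  A fixed window of \<open>w\<close> corresponds to \<open>x $ j\<close> of order
  \<open>sqrt t\<close>; all other factors of the mass tend to 1 there as \<open>t\<close> tends to
  0, while \<open>lag_mass\<close> stays above some \<open>1 + d\<close>. Since the constant 1 is
  not square integrable, contractivity is tested on indicators increasing to it. For
  \<open>\<alpha> $ j\<close> at least \<open>- 1 / 2\<close> the same mass formula gives a bound
  strictly below 1, which excludes the Markov property.\<close>

lemma powr_ge_tangent:
  fixes a l r :: real
  assumes "0 \<le> a" "0 < l" "1 \<le> r"
  shows "l powr r + r * l powr (r - 1) * (a - l) \<le> a powr r"
proof (cases "a = 0")
  case True
  have "l powr (r - 1) * l = l powr r"
    using assms by (simp add: powr_mult_base mult.commute)
  then have "l powr r + r * l powr (r - 1) * (a - l) = (1 - r) * l powr r"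
    using True by (simp add: algebra_simps)
  also have "\<dots> \<le> 0" using assms by (simp add: mult_nonpos_nonneg)
  finally show ?thesis using True by simp
next
  case False
  then have a: "a > 0" using assms by simp
  have "r * l powr (r - 1) * (a - l) \<le> a powr r - l powr r"
  proof (rule convex_on_imp_above_tangent[where A="{0<..}" and f="\<lambda>x. x powr r"])
    show "convex_on {0<..} (\<lambda>x. x powr r)"
    proof (rule convex_on_realI)
      fix x :: real assume "x \<in> {0<..}"
      then show "((\<lambda>x. x powr r) has_real_derivative r * x powr (r - 1)) (at x)"
        by (auto intro!: derivative_eq_intros)
    next
      fix x y :: real assume "x \<in> {0<..}" "y \<in> {0<..}" "x \<le> y"
      then show "r * x powr (r - 1) \<le> r * y powr (r - 1)"
        using assms by (intro mult_left_mono powr_mono2) auto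
    qed simp
    show "((\<lambda>x. x powr r) has_real_derivative r * l powr (r - 1)) (at l within {0<..})"
      using assms by (auto intro!: derivative_eq_intros)
  qed (use assms a in \<open>auto simp: interior_open\<close>)
  then show ?thesis by simp
qed

text \<open>Jensen's inequality for a weight whose mass is only bounded by \<open>C\<close>, not
  normalised: integrate the tangent inequality of \<open>powr_ge_tangent\<close> against
  \<open>w\<close>. The constant \<open>C powr (r - 1)\<close> is the one that later combines with a
  factor \<open>C\<close> to \<open>C powr r\<close>.\<close>

lemma Jensen_powr:
  fixes w f :: "'a \<Rightarrow> real"
  assumes [measurable]: "f \<in> borel_measurable M"
    and w: "\<And>x. x \<in> space M \<Longrightarrow> 0 \<le> w x" and wi: "integrable M w" and wC: "(\<integral>x. w x \<partial>M) \<le> C"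
    and C: "0 < C" and r: "1 \<le> r"
    and wf: "integrable M (\<lambda>x. w x * f x)" and wfr: "integrable M (\<lambda>x. w x * \<bar>f x\<bar> powr r)"
  shows "\<bar>\<integral>x. w x * f x \<partial>M\<bar> powr r \<le> C powr (r - 1) * (\<integral>x. w x * \<bar>f x\<bar> powr r \<partial>M)"
proof -
  let ?J = "\<integral>x. w x * \<bar>f x\<bar> powr r \<partial>M"
  define A where "A = (\<integral>x. w x * \<bar>f x\<bar> \<partial>M)"
  have wa: "integrable M (\<lambda>x. w x * \<bar>f x\<bar>)"
    using integrable_abs[OF wf] by (rule Bochner_Integration.integrable_cong[THEN iffD1, rotated -1]) (auto simp: abs_mult w)
  have "\<bar>\<integral>x. w x * f x \<partial>M\<bar> \<le> (\<integral>x. \<bar>w x * f x\<bar> \<partial>M)"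
    by (rule integral_abs_bound)
  also have "\<dots> = A" unfolding A_def by (rule Bochner_Integration.integral_cong) (auto simp: abs_mult w)
  finally have le: "\<bar>\<integral>x. w x * f x \<partial>M\<bar> powr r \<le> A powr r"
    using r by (intro powr_mono2) auto
  have A0: "0 \<le> A" unfolding A_def by (rule integral_nonneg_AE) (auto simp: w)
  have I0: "0 \<le> ?J" by (rule integral_nonneg_AE) (auto simp: w)
  show ?thesis
  proof (cases "A = 0")
    case True
    then have "A powr r = 0" by simp
    moreover have "0 \<le> C powr (r - 1) * ?J" using I0 by simp
    ultimately show ?thesis using le by linarith
  next
    case False
    \<comment> \<open>The tangent is taken at \<open>A / C\<close> instead of the true mean. In the
      integrated inequality the mass of \<open>w\<close> then has the coefficient
      \<open>(1 - r) * l powr r \<le> 0\<close>, so it may be replaced by its upper bound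
      \<open>C\<close>.\<close>
    define l where "l = A / C"
    have l: "l > 0" using False A0 C by (simp add: l_def)
    have Al: "A = l * C" using C by (simp add: l_def)
    have ll: "l powr (r - 1) * l = l powr r"
      using l by (simp add: powr_mult_base mult.commute)
    have "(\<integral>x. (l powr r - r * l powr (r - 1) * l) * w x + r * l powr (r - 1) * (w x * \<bar>f x\<bar>) \<partial>M)
       \<le> ?J"
    proof (rule integral_mono)
      fix x assume x: "x \<in> space M"
      have "w x * (l powr r + r * l powr (r - 1) * (\<bar>f x\<bar> - l)) \<le> w x * (\<bar>f x\<bar> powr r)"
        using w[OF x] l r by (intro mult_left_mono powr_ge_tangent) auto
      then show "(l powr r - r * l powr (r - 1) * l) * w x + r * l powr (r - 1) * (w x * \<bar>f x\<bar>) \<le> w x * \<bar>f x\<bar> powr r"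
        by (simp add: algebra_simps)
    qed (use wi wa wfr in auto)
    also have "(\<integral>x. (l powr r - r * l powr (r - 1) * l) * w x + r * l powr (r - 1) * (w x * \<bar>f x\<bar>) \<partial>M)
      = (l powr r - r * (l powr (r - 1) * l)) * (\<integral>x. w x \<partial>M) + r * l powr (r - 1) * A"
      using wi wa by (simp add: A_def)
    also have "\<dots> = r * l powr r * C - (r - 1) * l powr r * (\<integral>x. w x \<partial>M)"
      unfolding ll Al using ll by (simp add: algebra_simps)
    finally have *: "r * l powr r * C - (r - 1) * l powr r * (\<integral>x. w x \<partial>M) \<le> ?J" .
    have "(r - 1) * l powr r * (\<integral>x. w x \<partial>M) \<le> (r - 1) * l powr r * C"
      using r wC by (intro mult_left_mono) auto
    with * have "l powr r * C \<le> ?J" by (simp add: algebra_simps)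
    then have "C powr (r - 1) * (l powr r * C) \<le> C powr (r - 1) * ?J"
      by (rule mult_left_mono) simp
    moreover have "C powr (r - 1) * C = C powr r" using C by (simp add: powr_mult_base mult.commute)
    then have "C powr (r - 1) * (l powr r * C) = A powr r" 
      using C l by (simp add: Al powr_mult mult_ac)
    ultimately show ?thesis using le by linarith
  qed
qed

lemma Lp_norm_infinity: "f \<in> borel_measurable M \<Longrightarrow> Lp_norm M \<infinity> f = esssup M (\<lambda>x. ennreal \<bar>f x\<bar>)"
  by (simp add: Lp_norm_def)

lemma Lp_norm_infinity_AE:
  assumes "f \<in> borel_measurable M" "Lp_norm M \<infinity> f \<le> ennreal B" "0 \<le> B"
  shows "AE x in M. \<bar>f x\<bar> \<le> B"
proof -
  have "AE x in M. ennreal \<bar>f x\<bar> \<le> esssup M (\<lambda>x. ennreal \<bar>f x\<bar>)" by (rule esssup_AE)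
  then show ?thesis
  proof eventually_elim
    case (elim x)
    then have "ennreal \<bar>f x\<bar> \<le> ennreal B"
      using assms(2) unfolding Lp_norm_infinity[OF assms(1)] by (rule order_trans)
    then show ?case using assms(3) by (simp add: ennreal_le_iff)
  qed
qed

lemma Lp_norm_infinity_le:
  assumes "f \<in> borel_measurable M" "AE x in M. \<bar>f x\<bar> \<le> B" "0 \<le> B"
  shows "Lp_norm M \<infinity> f \<le> ennreal B"
  using assms(2,3) unfolding Lp_norm_infinity[OF assms(1)]
  by (intro esssup_I) (use assms(1) in \<open>auto elim!: eventually_mono simp: ennreal_leI\<close>)

lemma Lp_norm_finite_exponent:
  assumes "f \<in> borel_measurable M" "(\<integral>\<^sup>+x. ennreal (\<bar>f x\<bar> powr r) \<partial>M) = ennreal I" "0 \<le> I" "1 \<le> r"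
  shows "Lp_norm M (ennreal r) f = ennreal (I powr (1 / r))"
  using assms by (auto simp: Lp_norm_def Let_def)

lemma Lp_norm_finite_iff:
  assumes "f \<in> borel_measurable M" "1 \<le> r"
  shows "Lp_norm M (ennreal r) f < \<infinity> \<longleftrightarrow> (\<integral>\<^sup>+x. ennreal (\<bar>f x\<bar> powr r) \<partial>M) < \<infinity>"
  using assms by (auto simp: Lp_norm_def Let_def less_top)

lemma Lp_norm_cmult_le:
  assumes [measurable]: "f \<in> borel_measurable M" "g \<in> borel_measurable M" and r: "1 \<le> r" and C: "0 \<le> C"
    and le: "(\<integral>\<^sup>+x. ennreal (\<bar>f x\<bar> powr r) \<partial>M) \<le> ennreal (C powr r) * (\<integral>\<^sup>+x. ennreal (\<bar>g x\<bar> powr r) \<partial>M)"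
    and fin: "(\<integral>\<^sup>+x. ennreal (\<bar>g x\<bar> powr r) \<partial>M) < \<infinity>"
  shows "Lp_norm M (ennreal r) f \<le> ennreal C * Lp_norm M (ennreal r) g"
proof -
  let ?F = "\<integral>\<^sup>+x. ennreal (\<bar>f x\<bar> powr r) \<partial>M"
  obtain G where G: "(\<integral>\<^sup>+x. ennreal (\<bar>g x\<bar> powr r) \<partial>M) = ennreal G" "0 \<le> G"
    using fin by (metis ennreal_cases infinity_ennreal_def less_irrefl)
  have le': "?F \<le> ennreal (C powr r * G)"
    using le G by (simp add: ennreal_mult)
  then obtain F where F: "?F = ennreal F" "0 \<le> F"
    by (metis ennreal_cases infinity_ennreal_def ennreal_less_top leD top_unique)
  have FG: "F \<le> C powr r * G" using le' F G by (simp add: ennreal_le_iff)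
  have "F powr (1 / r) \<le> (C powr r * G) powr (1 / r)" using FG F r by (intro powr_mono2) auto
  also have "\<dots> = C * G powr (1 / r)" using G C r by (simp add: powr_mult powr_powr)
  finally show ?thesis
    using C by (simp add: Lp_norm_finite_exponent[OF _ F r] Lp_norm_finite_exponent[OF _ G r] ennreal_mult'[symmetric] ennreal_leI)
qed

lemma exponent_cases:
  fixes p :: ennreal
  assumes "1 \<le> p"
  obtains "p = \<infinity>" | r where "p = ennreal r" "1 \<le> r"
proof (cases p)
  case (real r)
  have "1 \<le> r" using assms real by (metis ennreal_1 ennreal_le_iff)
  then show ?thesis using real that by blast
qed (use that in auto)

text \<open>Squared \<open>L2\<close> norm as a plain integral. Strong continuity is proved in this
  form, because it is explicit on Gaussians and \<open>sqnorm_add_le\<close> with its factors 2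
  serves as triangle inequality; the root is taken only at the very end.\<close>

definition sqnorm :: "'a measure \<Rightarrow> ('a \<Rightarrow> real) \<Rightarrow> ennreal" where
  "sqnorm M f = (\<integral>\<^sup>+x. ennreal ((f x)\<^sup>2) \<partial>M)"

lemma sqnorm_eq: "sqnorm M f = (\<integral>\<^sup>+x. ennreal (\<bar>f x\<bar> powr 2) \<partial>M)"
  unfolding sqnorm_def by (intro nn_integral_cong) auto

lemma Lp_norm_2_finite_iff:
  assumes "f \<in> borel_measurable M"
  shows "Lp_norm M 2 f < \<infinity> \<longleftrightarrow> sqnorm M f < \<infinity>"
  using Lp_norm_finite_iff[OF assms, of 2] by (simp add: sqnorm_eq)

lemma Lp_space_2_iff: "f \<in> Lp_space M 2 \<longleftrightarrow> f \<in> borel_measurable M \<and> sqnorm M f < \<infinity>"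
  by (auto simp: Lp_space_def Lp_norm_2_finite_iff[unfolded infinity_ennreal_def])

lemma Lp_space_2_iff_integrable:
  "f \<in> Lp_space M 2 \<longleftrightarrow> f \<in> borel_measurable M \<and> integrable M (\<lambda>x. (f x)\<^sup>2)"
  by (auto simp: Lp_space_2_iff integrable_iff_bounded sqnorm_def)

lemma sqnorm_eq_Lp_norm:
  assumes [measurable]: "f \<in> borel_measurable M" and n: "Lp_norm M 2 f = ennreal n" "0 \<le> n"
  shows "sqnorm M f = ennreal (n\<^sup>2)"
proof -
  have "sqnorm M f < \<infinity>" using n by (subst Lp_norm_2_finite_iff[symmetric]) auto
  then obtain I where I: "sqnorm M f = ennreal I" "0 \<le> I"
    by (metis ennreal_cases infinity_ennreal_def less_irrefl)
  have "Lp_norm M 2 f = ennreal (I powr (1 / 2))"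
    using Lp_norm_finite_exponent[of f M 2 I] I by (simp add: sqnorm_eq)
  then have "n = I powr (1 / 2)" using n I by (simp add: ennreal_inj)
  then have "n\<^sup>2 = I" using I by (simp add: powr_half_sqrt)
  then show ?thesis using I by simp
qed

lemma Lp_norm_2_less:
  assumes [measurable]: "f \<in> borel_measurable M" and e: "0 < e" and s: "sqnorm M f < ennreal (e\<^sup>2)"
  shows "Lp_norm M 2 f < ennreal e"
proof -
  have "Lp_norm M 2 f < \<infinity>"
    using order_less_trans[OF s ennreal_less_top]
    by (simp add: Lp_norm_2_finite_iff[OF assms(1), unfolded infinity_ennreal_def])
  then obtain n where n: "Lp_norm M 2 f = ennreal n" "0 \<le> n"
    by (metis ennreal_cases infinity_ennreal_def less_irrefl)
  have "n\<^sup>2 < e\<^sup>2" using s e by (simp add: sqnorm_eq_Lp_norm[OF _ n] ennreal_less_iff)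
  then have "n < e" using e by (simp add: power2_less_imp_less)
  then show ?thesis using n by (simp add: ennreal_less_iff)
qed

lemma sqnorm_add_le:
  assumes [measurable]: "f \<in> borel_measurable M" "g \<in> borel_measurable M"
  shows "sqnorm M (\<lambda>x. f x + g x) \<le> 2 * sqnorm M f + 2 * sqnorm M g"
proof -
  have "sqnorm M (\<lambda>x. f x + g x) \<le> (\<integral>\<^sup>+x. 2 * ennreal ((f x)\<^sup>2) + 2 * ennreal ((g x)\<^sup>2) \<partial>M)"
    unfolding sqnorm_def
  proof (rule nn_integral_mono)
    fix x
    have "0 \<le> (f x - g x)\<^sup>2" by simp
    then have "(f x + g x)\<^sup>2 \<le> 2 * (f x)\<^sup>2 + 2 * (g x)\<^sup>2" by (simp add: power2_eq_square algebra_simps)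
    then have "ennreal ((f x + g x)\<^sup>2) \<le> ennreal (2 * (f x)\<^sup>2 + 2 * (g x)\<^sup>2)" by (rule ennreal_leI)
    also have "\<dots> = 2 * ennreal ((f x)\<^sup>2) + 2 * ennreal ((g x)\<^sup>2)"
      by (simp add: ennreal_plus ennreal_mult')
    finally show "ennreal ((f x + g x)\<^sup>2) \<le> 2 * ennreal ((f x)\<^sup>2) + 2 * ennreal ((g x)\<^sup>2)" .
  qed
  also have "\<dots> = 2 * sqnorm M f + 2 * sqnorm M g"
    unfolding sqnorm_def by (subst nn_integral_add) (auto simp: nn_integral_cmult)
  finally show ?thesis .
qed

section \<open>Integral operators with a Schur kernel\<close>

definition kernel_op :: "'a measure \<Rightarrow> ('a \<Rightarrow> 'a \<Rightarrow> real) \<Rightarrow> ('a \<Rightarrow> real) \<Rightarrow> 'a \<Rightarrow> real" where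
  "kernel_op M K f x = (\<integral>y. K x y * f y \<partial>M)"

text \<open>The setting of Schur's test. By symmetry the single bound \<open>C\<close> on the row
  masses is also a bound on the column masses, which yields the same operator bound \<open>C\<close>
  for every exponent.\<close>

locale schur_kernel = sigma_finite_measure M for M :: "'a measure" +
  fixes K :: "'a \<Rightarrow> 'a \<Rightarrow> real" and C :: real
  assumes measurable_kernel: "(\<lambda>(x, y). K x y) \<in> borel_measurable (M \<Otimes>\<^sub>M M)"
    and kernel_nonneg: "\<And>x y. x \<in> space M \<Longrightarrow> y \<in> space M \<Longrightarrow> 0 \<le> K x y"
    and kernel_sym: "\<And>x y. x \<in> space M \<Longrightarrow> y \<in> space M \<Longrightarrow> K x y = K y x"
    and C_pos: "0 < C"
    and kernel_bound: "\<And>x. x \<in> space M \<Longrightarrow> (\<integral>\<^sup>+y. ennreal (K x y) \<partial>M) \<le> ennreal C"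
begin

interpretation P: pair_sigma_finite M M ..

declare measurable_kernel [measurable]

lemma measurable_kernel_Pair1 [measurable]: "x \<in> space M \<Longrightarrow> K x \<in> borel_measurable M"
  using measurable_Pair2[OF measurable_kernel, of x] by simp

lemma measurable_kernel_op [measurable]:
  assumes [measurable]: "f \<in> borel_measurable M"
  shows "kernel_op M K f \<in> borel_measurable M"
  unfolding kernel_op_def by measurable

lemma integrable_kernel: "x \<in> space M \<Longrightarrow> integrable M (K x)"
  using order_le_less_trans[OF kernel_bound[of x] ennreal_less_top]
  by (intro integrableI_nonneg) (auto intro!: AE_I2 kernel_nonneg)

lemma integral_kernel_le: "x \<in> space M \<Longrightarrow> (\<integral>y. K x y \<partial>M) \<le> C"
  using C_pos kernel_bound[of x]
    nn_integral_eq_integral[OF integrable_kernel AE_I2[OF kernel_nonneg], of x]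
  by (simp add: ennreal_le_iff)

text \<open>The \<open>L1\<close> half of Schur's test: after Tonelli the inner integral is a column
  mass, which symmetry turns into a row mass.\<close>

lemma nn_integral_kernel_swap:
  assumes [measurable]: "h \<in> borel_measurable M"
  shows "(\<integral>\<^sup>+x. (\<integral>\<^sup>+y. ennreal (K x y) * h y \<partial>M) \<partial>M) \<le> ennreal C * (\<integral>\<^sup>+y. h y \<partial>M)"
proof -
  have "(\<integral>\<^sup>+x. (\<integral>\<^sup>+y. ennreal (K x y) * h y \<partial>M) \<partial>M) = (\<integral>\<^sup>+y. (\<integral>\<^sup>+x. ennreal (K x y) * h y \<partial>M) \<partial>M)"
    by (rule P.Fubini'[symmetric]) measurable
  also have "\<dots> = (\<integral>\<^sup>+y. (\<integral>\<^sup>+x. ennreal (K y x) \<partial>M) * h y \<partial>M)"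
    by (intro nn_integral_cong) (subst nn_integral_multc[symmetric], auto intro!: nn_integral_cong simp: kernel_sym)
  also have "\<dots> \<le> (\<integral>\<^sup>+y. ennreal C * h y \<partial>M)"
    by (intro nn_integral_mono mult_right_mono kernel_bound) auto
  also have "\<dots> = ennreal C * (\<integral>\<^sup>+y. h y \<partial>M)" by (rule nn_integral_cmult) measurable
  finally show ?thesis .
qed

text \<open>The double integral of \<open>K x y * \<bar>f y\<bar> powr r\<close> is finite, so the
  inner integral is finite for almost every \<open>x\<close>. Only at such points does the Bochner
  integral defining \<open>kernel_op\<close> carry information.\<close>

lemma kernel_powr_AE:
  assumes [measurable]: "f \<in> borel_measurable M" and r: "1 \<le> r"
    and fin: "(\<integral>\<^sup>+x. ennreal (\<bar>f x\<bar> powr r) \<partial>M) < \<infinity>"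
  shows "AE x in M. integrable M (\<lambda>y. K x y * \<bar>f y\<bar> powr r)"
    and "AE x in M. integrable M (\<lambda>y. K x y * f y)"
proof -
  let ?B = "\<lambda>x. \<integral>\<^sup>+y. ennreal (K x y) * ennreal (\<bar>f y\<bar> powr r) \<partial>M"
  have "(\<integral>\<^sup>+x. (?B x) \<partial>M) \<le> ennreal C * (\<integral>\<^sup>+x. ennreal (\<bar>f x\<bar> powr r) \<partial>M)"
    by (rule nn_integral_kernel_swap) measurable
  also have "\<dots> < \<infinity>" using fin by (simp add: ennreal_mult_less_top)
  finally have "(\<integral>\<^sup>+x. (?B x) \<partial>M) \<noteq> \<infinity>" by simp
  then have "AE x in M. (?B x) \<noteq> \<infinity>"
    by (rule nn_integral_PInf_AE[rotated]) measurable
  then show *: "AE x in M. integrable M (\<lambda>y. K x y * \<bar>f y\<bar> powr r)"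
  proof (rule AE_mp, intro AE_I2 impI)
    fix x assume x: "x \<in> space M" and "(?B x) \<noteq> \<infinity>"
    moreover have "(?B x) = (\<integral>\<^sup>+y. ennreal (K x y * \<bar>f y\<bar> powr r) \<partial>M)"
      by (intro nn_integral_cong) (simp add: ennreal_mult kernel_nonneg x)
    ultimately show "integrable M (\<lambda>y. K x y * \<bar>f y\<bar> powr r)"
      using x by (intro integrableI_nonneg) (auto intro!: AE_I2 mult_nonneg_nonneg kernel_nonneg simp: less_top)
  qed
  show "AE x in M. integrable M (\<lambda>y. K x y * f y)"
    using *
  proof (rule AE_mp, intro AE_I2 impI)
    fix x assume x: "x \<in> space M" and i: "integrable M (\<lambda>y. K x y * \<bar>f y\<bar> powr r)"
    have "integrable M (\<lambda>y. K x y + K x y * \<bar>f y\<bar> powr r)" using i integrable_kernel[OF x] by simp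
    then show "integrable M (\<lambda>y. K x y * f y)"
    proof (rule Bochner_Integration.integrable_bound)
      show "AE y in M. norm (K x y * f y) \<le> norm (K x y + K x y * \<bar>f y\<bar> powr r)"
      proof (intro AE_I2)
        fix y assume y: "y \<in> space M"
        \<comment> \<open>Integrability of \<open>K x\<close> itself pays for the 1, so the power
          \<open>r\<close> can be lowered to 1.\<close>
        have "\<bar>f y\<bar> \<le> 1 + \<bar>f y\<bar> powr r"
        proof (cases "\<bar>f y\<bar> \<le> 1")
          case True then show ?thesis by (simp add: add_increasing2)
        next
          case False
          then have "\<bar>f y\<bar> powr 1 \<le> \<bar>f y\<bar> powr r" using r by (intro powr_mono) auto
          then show ?thesis using False by simp
        qed
        then have "K x y * \<bar>f y\<bar> \<le> K x y * (1 + \<bar>f y\<bar> powr r)"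
          by (rule mult_left_mono) (use x y kernel_nonneg in auto)
        then show "norm (K x y * f y) \<le> norm (K x y + K x y * \<bar>f y\<bar> powr r)"
          using x y kernel_nonneg[of x y] by (simp add: abs_mult algebra_simps)
      qed
    qed (use x in measurable)
  qed
qed

text \<open>Jensen for fixed \<open>x\<close> costs \<open>C powr (r - 1)\<close>, and the
  integration over \<open>x\<close> costs a further \<open>C\<close> by
  \<open>nn_integral_kernel_swap\<close>.\<close>

lemma kernel_op_powr_le:
  assumes [measurable]: "f \<in> borel_measurable M" and r: "1 \<le> r"
    and fin: "(\<integral>\<^sup>+x. ennreal (\<bar>f x\<bar> powr r) \<partial>M) < \<infinity>"
  shows "(\<integral>\<^sup>+x. ennreal (\<bar>kernel_op M K f x\<bar> powr r) \<partial>M) \<le> ennreal (C powr r) * (\<integral>\<^sup>+x. ennreal (\<bar>f x\<bar> powr r) \<partial>M)"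
proof -
  let ?B = "\<lambda>x. \<integral>\<^sup>+y. ennreal (K x y) * ennreal (\<bar>f y\<bar> powr r) \<partial>M"
  let ?I = "\<integral>\<^sup>+x. ennreal (\<bar>f x\<bar> powr r) \<partial>M"
  have "(\<integral>\<^sup>+x. ennreal (\<bar>kernel_op M K f x\<bar> powr r) \<partial>M)
    \<le> (\<integral>\<^sup>+x. ennreal (C powr (r - 1)) * (?B x) \<partial>M)"
  proof (rule nn_integral_mono_AE)
    show "AE x in M. ennreal (\<bar>kernel_op M K f x\<bar> powr r) \<le> ennreal (C powr (r - 1)) * (?B x)"
      using kernel_powr_AE[OF assms] AE_space
    proof eventually_elim
      case (elim x)
      note x = \<open>x \<in> space M\<close>
      have "\<bar>kernel_op M K f x\<bar> powr r \<le> C powr (r - 1) * (\<integral>y. K x y * \<bar>f y\<bar> powr r \<partial>M)"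
        unfolding kernel_op_def
        by (rule Jensen_powr) (use elim C_pos r x integrable_kernel integral_kernel_le kernel_nonneg in auto)
      moreover have "(?B x) = ennreal (\<integral>y. K x y * \<bar>f y\<bar> powr r \<partial>M)"
        using elim x by (subst nn_integral_eq_integral[symmetric])
          (auto intro!: AE_I2 mult_nonneg_nonneg kernel_nonneg nn_integral_cong simp: ennreal_mult kernel_nonneg)
      ultimately show ?case by (simp add: ennreal_mult'[symmetric] ennreal_leI)
    qed
  qed
  also have "\<dots> = ennreal (C powr (r - 1)) * (\<integral>\<^sup>+x. (?B x) \<partial>M)"
    by (rule nn_integral_cmult) measurable
  also have "\<dots> \<le> ennreal (C powr (r - 1)) * (ennreal C * ?I)"
    by (intro mult_left_mono nn_integral_kernel_swap) auto
  also have "\<dots> = ennreal (C powr r) * ?I"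
    using C_pos by (simp add: mult.assoc[symmetric] ennreal_mult'[symmetric] powr_mult_base mult.commute[of _ C])
  finally show ?thesis .
qed

lemma kernel_op_bounded_le:
  assumes [measurable]: "f \<in> borel_measurable M" and f: "AE y in M. \<bar>f y\<bar> \<le> B" and x: "x \<in> space M" and B: "0 \<le> B"
  shows "integrable M (\<lambda>y. K x y * f y)" "\<bar>kernel_op M K f x\<bar> \<le> C * B"
proof -
  have *: "integrable M (\<lambda>y. B * K x y)" using integrable_kernel[OF x] by simp
  have AE: "AE y in M. \<bar>K x y * f y\<bar> \<le> B * K x y"
    using f AE_space by eventually_elim (use x in \<open>auto simp: abs_mult kernel_nonneg mult.commute[of B] intro!: mult_left_mono\<close>)
  show i: "integrable M (\<lambda>y. K x y * f y)"
    by (rule Bochner_Integration.integrable_bound[OF *]) (use x AE in \<open>auto elim!: eventually_mono\<close>)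
  have "\<bar>kernel_op M K f x\<bar> \<le> (\<integral>y. \<bar>K x y * f y\<bar> \<partial>M)"
    unfolding kernel_op_def by (rule integral_abs_bound)
  also have "\<dots> \<le> (\<integral>y. B * K x y \<partial>M)"
    by (rule integral_mono_AE) (use i * AE in auto)
  also have "\<dots> \<le> B * C" using B integral_kernel_le[OF x] by (simp add: mult_left_mono)
  finally show "\<bar>kernel_op M K f x\<bar> \<le> C * B" by (simp add: mult.commute)
qed

lemma integrable_kernel_Lp_AE:
  assumes p: "1 \<le> p" and f: "f \<in> Lp_space M p"
  shows "AE x in M. integrable M (\<lambda>y. K x y * f y)"
  using p
proof (cases rule: exponent_cases)
  case 1
  have [measurable]: "f \<in> borel_measurable M" using f by (simp add: Lp_space_def)
  have "Lp_norm M \<infinity> f < \<infinity>" using f 1 by (simp add: Lp_space_def)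
  then obtain n where n: "Lp_norm M \<infinity> f = ennreal n" "0 \<le> n"
    by (metis ennreal_cases infinity_ennreal_def less_irrefl)
  then have "AE x in M. \<bar>f x\<bar> \<le> n" by (intro Lp_norm_infinity_AE) auto
  from kernel_op_bounded_le(1)[OF _ this] n show ?thesis by (intro AE_I2) auto
next
  case (2 r)
  then show ?thesis using f by (intro kernel_powr_AE(2)) (auto simp: Lp_space_def Lp_norm_finite_iff[unfolded infinity_ennreal_def])
qed

lemma Lp_norm_kernel_op_le:
  assumes p: "1 \<le> p" and f: "f \<in> Lp_space M p"
  shows "Lp_norm M p (kernel_op M K f) \<le> ennreal C * Lp_norm M p f"
  using p
proof (cases rule: exponent_cases)
  case 1
  have [measurable]: "f \<in> borel_measurable M" using f by (simp add: Lp_space_def)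
  have "Lp_norm M \<infinity> f < \<infinity>" using f 1 by (simp add: Lp_space_def)
  then obtain n where n: "Lp_norm M \<infinity> f = ennreal n" "0 \<le> n"
    by (metis ennreal_cases infinity_ennreal_def less_irrefl)
  then have "AE x in M. \<bar>f x\<bar> \<le> n" by (intro Lp_norm_infinity_AE) auto
  from kernel_op_bounded_le(2)[OF _ this] have "Lp_norm M \<infinity> (kernel_op M K f) \<le> ennreal (C * n)"
    using n C_pos by (intro Lp_norm_infinity_le AE_I2) auto
  then show ?thesis using n C_pos 1 by (simp add: ennreal_mult')
next
  case (2 r)
  have [measurable]: "f \<in> borel_measurable M" using f by (simp add: Lp_space_def)
  have fin: "(\<integral>\<^sup>+x. ennreal (\<bar>f x\<bar> powr r) \<partial>M) < \<infinity>"
    using f 2 by (auto simp: Lp_space_def Lp_norm_finite_iff[unfolded infinity_ennreal_def])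
  show ?thesis unfolding 2(1)
    using C_pos 2(2) fin by (intro Lp_norm_cmult_le kernel_op_powr_le) auto
qed

lemma Lp_opnorm_kernel_op_le:
  assumes p: "1 \<le> p"
  shows "Lp_opnorm M p (kernel_op M K) \<le> ennreal C"
  unfolding Lp_opnorm_def
proof (rule SUP_least)
  fix f assume f: "f \<in> {f \<in> Lp_space M p. Lp_norm M p f \<le> 1}"
  then have "Lp_norm M p (kernel_op M K f) \<le> ennreal C * Lp_norm M p f"
    by (intro Lp_norm_kernel_op_le p) auto
  also have "\<dots> \<le> ennreal C * 1" using f by (intro mult_left_mono) auto
  finally show "Lp_norm M p (kernel_op M K f) \<le> ennreal C" by simp
qed

lemma sqnorm_kernel_op_le:
  assumes "f \<in> borel_measurable M" "sqnorm M f < \<infinity>"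
  shows "sqnorm M (kernel_op M K f) \<le> ennreal (C\<^sup>2) * sqnorm M f"
  using kernel_op_powr_le[of f 2] assms C_pos by (simp add: sqnorm_eq)

text \<open>Fubini and the symmetry of the kernel. Absolute integrability of the double integral
  comes from \<open>\<bar>f y\<bar> * \<bar>g x\<bar> \<le> (f y)\<^sup>2 + (g x)\<^sup>2\<close>,
  each square being absorbed by one of the two mass bounds.\<close>

lemma kernel_op_symmetric:
  assumes f: "f \<in> Lp_space M 2" and g: "g \<in> Lp_space M 2"
  shows "(\<integral>x. kernel_op M K f x * g x \<partial>M) = (\<integral>x. f x * kernel_op M K g x \<partial>M)" (is "?lhs = _")
proof -
  let ?N = "\<integral>\<^sup>+x. \<integral>\<^sup>+y. ennreal (norm (K x y * f y * g x)) \<partial>M \<partial>M"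
  have [measurable]: "f \<in> borel_measurable M" "g \<in> borel_measurable M"
    using f g by (auto simp: Lp_space_2_iff)
  have fin: "sqnorm M f < \<infinity>" "sqnorm M g < \<infinity>" using f g by (auto simp: Lp_space_2_iff)
  have le: "?N \<le> ennreal C * sqnorm M f + ennreal C * sqnorm M g"
  proof -
    have "?N
       \<le> (\<integral>\<^sup>+x. \<integral>\<^sup>+y. ennreal (K x y) * ennreal ((f y)\<^sup>2) + ennreal (K x y) * ennreal ((g x)\<^sup>2) \<partial>M \<partial>M)"
    proof (intro nn_integral_mono)
      fix x y assume xy: "x \<in> space M" "y \<in> space M"
      have "0 \<le> (\<bar>f y\<bar> - \<bar>g x\<bar>)\<^sup>2" by simp
      then have "2 * (\<bar>f y\<bar> * \<bar>g x\<bar>) \<le> (f y)\<^sup>2 + (g x)\<^sup>2" by (simp add: power2_diff)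
      moreover have "0 \<le> \<bar>f y\<bar> * \<bar>g x\<bar>" by simp
      ultimately have "\<bar>f y\<bar> * \<bar>g x\<bar> \<le> (f y)\<^sup>2 + (g x)\<^sup>2" by linarith
      then have "K x y * (\<bar>f y\<bar> * \<bar>g x\<bar>) \<le> K x y * ((f y)\<^sup>2 + (g x)\<^sup>2)"
        by (rule mult_left_mono) (rule kernel_nonneg[OF xy])
      then have "norm (K x y * f y * g x) \<le> K x y * (f y)\<^sup>2 + K x y * (g x)\<^sup>2"
        using kernel_nonneg[OF xy] by (simp add: abs_mult algebra_simps)
      then have "ennreal (norm (K x y * f y * g x)) \<le> ennreal (K x y * (f y)\<^sup>2 + K x y * (g x)\<^sup>2)" by (rule ennreal_leI)
      then show "ennreal (norm (K x y * f y * g x)) \<le> ennreal (K x y) * ennreal ((f y)\<^sup>2) + ennreal (K x y) * ennreal ((g x)\<^sup>2)"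
        using kernel_nonneg[OF xy] by (simp add: ennreal_plus ennreal_mult)
    qed
    also have "\<dots> = (\<integral>\<^sup>+x. (\<integral>\<^sup>+y. ennreal (K x y) * ennreal ((f y)\<^sup>2) \<partial>M) + (\<integral>\<^sup>+y. ennreal (K x y) \<partial>M) * ennreal ((g x)\<^sup>2) \<partial>M)"
      by (intro nn_integral_cong) (simp add: nn_integral_add nn_integral_multc)
    also have "\<dots> = (\<integral>\<^sup>+x. (\<integral>\<^sup>+y. ennreal (K x y) * ennreal ((f y)\<^sup>2) \<partial>M) \<partial>M) + (\<integral>\<^sup>+x. (\<integral>\<^sup>+y. ennreal (K x y) \<partial>M) * ennreal ((g x)\<^sup>2) \<partial>M)"
      by (rule nn_integral_add) measurable
    also have "\<dots> \<le> ennreal C * sqnorm M f + (\<integral>\<^sup>+x. ennreal C * ennreal ((g x)\<^sup>2) \<partial>M)"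
      unfolding sqnorm_def
      by (intro add_mono nn_integral_kernel_swap nn_integral_mono mult_right_mono kernel_bound) auto
    also have "(\<integral>\<^sup>+x. ennreal C * ennreal ((g x)\<^sup>2) \<partial>M) = ennreal C * sqnorm M g"
      unfolding sqnorm_def by (rule nn_integral_cmult) measurable
    finally show ?thesis .
  qed
  have int: "integrable (M \<Otimes>\<^sub>M M) (\<lambda>(x, y). K x y * f y * g x)"
  proof (rule integrableI_bounded)
    have "(\<integral>\<^sup>+z. ennreal (norm (case z of (x, y) \<Rightarrow> K x y * f y * g x)) \<partial>(M \<Otimes>\<^sub>M M)) = 
       ?N"
      using nn_integral_fst[of "\<lambda>z. ennreal (norm (case z of (x, y) \<Rightarrow> K x y * f y * g x))" M] by simp
    also have "\<dots> < \<infinity>"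
      by (rule order_le_less_trans[OF le]) (use fin in \<open>auto simp: ennreal_mult_less_top\<close>)
    finally show "(\<integral>\<^sup>+z. ennreal (norm (case z of (x, y) \<Rightarrow> K x y * f y * g x)) \<partial>(M \<Otimes>\<^sub>M M)) < \<infinity>" .
  qed measurable
  have "?lhs = (\<integral>x. (\<integral>y. K x y * f y * g x \<partial>M) \<partial>M)"
    by (simp add: kernel_op_def)
  also have "\<dots> = (\<integral>y. (\<integral>x. K x y * f y * g x \<partial>M) \<partial>M)"
    by (rule P.Fubini_integral[symmetric, OF int])
  also have "\<dots> = (\<integral>y. (\<integral>x. f y * (K y x * g x) \<partial>M) \<partial>M)"
    by (intro Bochner_Integration.integral_cong refl) (auto simp: kernel_sym mult_ac)
  also have "\<dots> = (\<integral>x. f x * kernel_op M K g x \<partial>M)"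
    by (simp add: kernel_op_def)
  finally show ?thesis .
qed

end

text \<open>Lifts a pointwise Chapman-Kolmogorov identity to operators. The same identity proves the
  hypothesis of Fubini: integrating absolute values over \<open>y\<close> first gives the integral
  of \<open>K'' x z * \<bar>f z\<bar>\<close>, which is finite for almost every
  \<open>x\<close>.\<close>

lemma kernel_op_compose:
  assumes "schur_kernel M K C" "schur_kernel M K' C'" "schur_kernel M K'' C''"
    and comp: "\<And>x z. x \<in> space M \<Longrightarrow> z \<in> space M \<Longrightarrow>
      (\<integral>\<^sup>+y. ennreal (K x y) * ennreal (K' y z) \<partial>M) = ennreal (K'' x z)"
    and p: "1 \<le> p" and f: "f \<in> Lp_space M p"
  shows "AE x in M. kernel_op M K'' f x = kernel_op M K (kernel_op M K' f) x"
proof -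
  interpret K: schur_kernel M K C by fact
  interpret K': schur_kernel M K' C' by fact
  interpret K'': schur_kernel M K'' C'' by fact
  interpret P: pair_sigma_finite M M ..
  note K.measurable_kernel[measurable] K'.measurable_kernel[measurable]
  have [measurable]: "f \<in> borel_measurable M" using f by (auto simp: Lp_space_def)
  show ?thesis
    using K''.integrable_kernel_Lp_AE[OF p f] AE_space
  proof eventually_elim
    case (elim x)
    have x: "x \<in> space M" and i: "integrable M (\<lambda>z. K'' x z * f z)" using elim by auto
    note K.measurable_kernel_Pair1[OF x, measurable]
    have int: "integrable (M \<Otimes>\<^sub>M M) (\<lambda>(y, z). K x y * K' y z * f z)"
    proof (rule integrableI_bounded)
      have "(\<integral>\<^sup>+w. ennreal (norm (case w of (y, z) \<Rightarrow> K x y * K' y z * f z)) \<partial>(M \<Otimes>\<^sub>M M)) = 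
         (\<integral>\<^sup>+z. \<integral>\<^sup>+y. ennreal (norm (K x y * K' y z * f z)) \<partial>M \<partial>M)"
        using P.nn_integral_snd[of "\<lambda>w. ennreal (norm (case w of (y, z) \<Rightarrow> K x y * K' y z * f z))"] by simp
      also have "\<dots> = (\<integral>\<^sup>+z. \<integral>\<^sup>+y. ennreal (K x y) * ennreal (K' y z) * ennreal (norm (f z)) \<partial>M \<partial>M)"
        by (intro nn_integral_cong) (simp add: abs_mult x K.kernel_nonneg K'.kernel_nonneg ennreal_mult)
      also have "\<dots> = (\<integral>\<^sup>+z. ennreal (norm (K'' x z * f z)) \<partial>M)"
        by (intro nn_integral_cong) (simp add: nn_integral_multc comp x abs_mult K''.kernel_nonneg ennreal_mult)
      also have "\<dots> < \<infinity>" using i by (simp add: integrable_iff_bounded)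
      finally show "(\<integral>\<^sup>+w. ennreal (norm (case w of (y, z) \<Rightarrow> K x y * K' y z * f z)) \<partial>(M \<Otimes>\<^sub>M M)) < \<infinity>" .
    qed measurable
    have "kernel_op M K'' f x = (\<integral>z. (\<integral>y. K x y * K' y z * f z \<partial>M) \<partial>M)"
      unfolding kernel_op_def
    proof (intro Bochner_Integration.integral_cong refl)
      fix z assume z: "z \<in> space M"
      have "(\<integral>y. K x y * K' y z \<partial>M) = enn2real (\<integral>\<^sup>+y. ennreal (K x y * K' y z) \<partial>M)"
        by (rule integral_eq_nn_integral) (use x z in \<open>auto intro!: AE_I2 K.kernel_nonneg K'.kernel_nonneg mult_nonneg_nonneg\<close>)
      also have "(\<integral>\<^sup>+y. ennreal (K x y * K' y z) \<partial>M) = ennreal (K'' x z)"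
        unfolding comp[OF x z, symmetric] by (intro nn_integral_cong ennreal_mult) (use x z K.kernel_nonneg K'.kernel_nonneg in auto)
      finally have "(\<integral>y. K x y * K' y z \<partial>M) = K'' x z" using K''.kernel_nonneg[OF x z] by simp
      then show "K'' x z * f z = (\<integral>y. K x y * K' y z * f z \<partial>M)" by simp
    qed
    also have "\<dots> = (\<integral>y. (\<integral>z. K x y * K' y z * f z \<partial>M) \<partial>M)"
      by (rule P.Fubini_integral[OF int])
    also have "\<dots> = kernel_op M K (kernel_op M K' f) x"
      by (simp add: kernel_op_def mult.assoc)
    finally show ?case .
  qed
qed

section \<open>Gaussian moments and Bessel functions\<close>

abbreviation half_line_integral :: "(real \<Rightarrow> real) \<Rightarrow> ennreal" where
  "half_line_integral f \<equiv> (\<integral>\<^sup>+v. ennreal (indicator {0<..} v * f v) \<partial>lborel)"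

lemma nn_integral_powr_exp_neg:
  fixes p m :: real
  assumes p: "0 < p" and m: "0 < m"
  shows "half_line_integral (\<lambda>u. u powr (m - 1) * exp (- p * u)) = ennreal (Gamma m * p powr (- m))" (is "?lhs = _")
proof -
  let ?h = "\<lambda>u. indicator {0<..} u * (u powr (m - 1) * exp (- p * u))"
  let ?k = "\<lambda>u. indicator {0..} (p * u) * (p * u) powr (m - 1) / exp (p * u)"
  have "ennreal (Gamma m) = (\<integral>\<^sup>+t. ennreal (indicator {0..} t * t powr (m - 1) / exp t) \<partial>lborel)"
    by (rule Gamma_conv_nn_integral_real[OF m])
  \<comment> \<open>Substitution \<open>t = p * u\<close>, expressed as Lebesgue measure being its
    image under the dilation with density \<open>p\<close>.\<close>
  also have "lborel = density (distr lborel borel (\<lambda>x. 0 + p * x)) (\<lambda>_. ennreal \<bar>p\<bar>)"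
    using p by (subst lborel_real_affine[of p 0]) auto
  also have "(\<integral>\<^sup>+t. ennreal (indicator {0..} t * t powr (m - 1) / exp t) \<partial>\<dots>)
     = (\<integral>\<^sup>+u. ennreal p * ennreal (?k u) \<partial>lborel)"
    using p by (simp add: nn_integral_density nn_integral_distr)
  also have "\<dots> = (\<integral>\<^sup>+u. ennreal (p powr m) * ennreal (?h u) \<partial>lborel)"
  proof (intro nn_integral_cong)
    fix u :: real
    have "p * (p * u) powr (m - 1) = p powr m * u powr (m - 1)" if "0 < u"
    proof -
      have "p * p powr (m - 1) = p powr m" using p by (simp add: powr_mult_base)
      then show ?thesis using p that by (simp add: powr_mult)
    qed
    then have "p * (?k u) =
       p powr m * (?h u)"
      using p by (auto simp: indicator_def exp_minus field_simps zero_le_mult_iff zero_less_mult_iff)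
    then show "ennreal p * ennreal (?k u) =
      ennreal (p powr m) * ennreal (?h u)"
      using p by (simp add: ennreal_mult'[symmetric])
  qed
  also have "\<dots> = ennreal (p powr m) * ?lhs" (is "_ = _ * ?I")
    by (rule nn_integral_cmult) measurable
  finally have *: "ennreal (Gamma m) = ennreal (p powr m) * ?I" .
  have "ennreal (Gamma m * p powr (- m)) = ennreal (p powr (- m)) * (ennreal (p powr m) * ?I)"
    unfolding *[symmetric] by (simp add: ennreal_mult''[symmetric] mult.commute)
  also have "\<dots> = ?I" using p by (simp add: mult.assoc[symmetric] ennreal_mult'[symmetric] powr_add[symmetric])
  finally show ?thesis ..
qed

text \<open>The substitution is made on \<open>[0, n]\<close>, whose image under squaring is
  \<open>[0, n^2]\<close>; monotone convergence then exhausts the half line on both sides.\<close>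

lemma nn_integral_square_substitution:
  fixes f :: "real \<Rightarrow> real"
  assumes [measurable]: "f \<in> borel_measurable borel"
  shows "half_line_integral (\<lambda>u. f u) = half_line_integral (\<lambda>y. 2 * y * f (y\<^sup>2))" (is "?lhs = _")
proof -
  let ?h = "\<lambda>n y. f (y\<^sup>2) * (2 * y) * indicator {0..real n} y"
  have *: "(\<integral>\<^sup>+u. ennreal (f u * indicator {(0::real)\<^sup>2..(real n)\<^sup>2} u) \<partial>lborel)
    = (\<integral>\<^sup>+y. ennreal (?h n y) \<partial>lborel)" for n
    using nn_integral_substitution[where a=0 and b="real n" and g="\<lambda>x. x\<^sup>2" and f=f and g'="\<lambda>x. 2 * x"]
    by (force simp: set_borel_measurable_def intro!: derivative_eq_intros continuous_intros)
  have ind: "(SUP n. ennreal (f u * indicator {0..(real n)\<^sup>2} u)) = ennreal (f u * indicator {0..} u)" for u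
  proof -
    obtain n :: nat where n: "u \<le> real n" "1 \<le> n" by (metis nat_ceiling_le_eq of_nat_1 of_nat_le_iff max.cobounded1 max.cobounded2 order.trans real_arch_simple)
    have "real n * 1 \<le> real n * real n" using n by (intro mult_left_mono) auto
    then have "u \<le> (real n)\<^sup>2" using n(1) unfolding power2_eq_square by linarith
    then have "f u * indicator {0..} u = f u * indicator {0..(real n)\<^sup>2} u" by (auto simp: indicator_def)
    then show ?thesis
      by (intro antisym SUP_least) (auto simp: indicator_def intro: SUP_upper2[of n])
  qed
  have ind2: "(SUP n. ennreal (?h n y)) = ennreal (f (y\<^sup>2) * (2 * y) * indicator {0..} y)" for y
  proof -
    obtain n :: nat where n: "y \<le> real n" using real_arch_simple by blast
    then have "f (y\<^sup>2) * (2 * y) * indicator {0..} y = f (y\<^sup>2) * (2 * y) * indicator {0..real n} y" by (auto simp: indicator_def)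
    then show ?thesis
      by (intro antisym SUP_least) (auto simp: indicator_def intro: SUP_upper2[of n])
  qed
  have "?lhs = (\<integral>\<^sup>+u. (SUP n. ennreal (f u * indicator {0..(real n)\<^sup>2} u)) \<partial>lborel)"
    unfolding ind by (intro nn_integral_cong_AE AE_I[where N="{0}"]) (auto simp: indicator_def)
  also have "\<dots> = (SUP n. (\<integral>\<^sup>+u. ennreal (f u * indicator {0..(real n)\<^sup>2} u) \<partial>lborel))"
  proof (rule nn_integral_monotone_convergence_SUP)
    have "(real m)\<^sup>2 \<le> (real n)\<^sup>2" if "m \<le> n" for m n using that by (intro power_mono) auto
    then show "incseq (\<lambda>n u. ennreal (f u * indicator {0..(real n)\<^sup>2} u))"
      by (fastforce simp: incseq_def le_fun_def indicator_def intro: order_trans)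
  qed measurable
  also have "\<dots> = (SUP n. (\<integral>\<^sup>+y. ennreal (?h n y) \<partial>lborel))"
    using * by simp
  also have "\<dots> = (\<integral>\<^sup>+y. (SUP n. ennreal (?h n y)) \<partial>lborel)"
    by (rule nn_integral_monotone_convergence_SUP[symmetric]) (auto simp: incseq_def le_fun_def indicator_def)
  also have "\<dots> = half_line_integral (\<lambda>y. 2 * y * f (y\<^sup>2))"
    unfolding ind2 by (intro nn_integral_cong) (auto simp: indicator_def mult_ac)
  finally show ?thesis .
qed

lemma nn_integral_powr_gaussian:
  fixes p m :: real
  assumes p: "0 < p" and m: "0 < m"
  shows "half_line_integral (\<lambda>y. y powr (2 * m - 1) * exp (- p * y\<^sup>2)) = ennreal (Gamma m * p powr (- m) / 2)" (is "?lhs = _")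
proof -
  let ?h = "\<lambda>y. indicator {0<..} y * (y powr (2 * m - 1) * exp (- p * y\<^sup>2))"
  let ?g = "\<lambda>y. 2 * y * ((y\<^sup>2) powr (m - 1) * exp (- p * y\<^sup>2))"
  have "half_line_integral (\<lambda>u. u powr (m - 1) * exp (- p * u))
    = half_line_integral (\<lambda>y. 2 * y * ((y\<^sup>2) powr (m - 1) * exp (- p * y\<^sup>2)))"
    by (rule nn_integral_square_substitution) measurable
  also have "\<dots> = (\<integral>\<^sup>+y. ennreal 2 * ennreal (?h y) \<partial>lborel)"
  proof (intro nn_integral_cong)
    fix y :: real
    have "y * (y\<^sup>2) powr (m - 1) = y powr (2 * m - 1)" if "0 < y"
    proof -
      have "y\<^sup>2 = y powr 2" using that by simp
      then have "(y\<^sup>2) powr (m - 1) = y powr (2 * (m - 1))" by (simp only: powr_powr)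
      then show ?thesis using powr_mult_base[of y "2 * (m - 1)"] that by simp
    qed
    then have "indicator {0<..} y * (?g y) = 2 * (?h y)"
      by (auto simp: indicator_def)
    then show "ennreal (indicator {0<..} y * (?g y)) = ennreal 2 * ennreal (?h y)"
      by (subst ennreal_mult'[symmetric], simp, simp only:)
  qed
  also have "\<dots> = ennreal 2 * ?lhs" (is "_ = _ * ?I")
    by (rule nn_integral_cmult) measurable
  finally have *: "ennreal (Gamma m * p powr (- m)) = ennreal 2 * ?I"
    by (simp only: nn_integral_powr_exp_neg[OF p m])
  have "ennreal (Gamma m * p powr (- m) / 2) = ennreal (1 / 2) * (ennreal 2 * ?I)"
    unfolding *[symmetric] by (subst ennreal_mult'[symmetric]) simp_all
  also have "\<dots> = ?I" by (simp only: mult.assoc[symmetric] ennreal_mult'[symmetric]) simp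
  finally show ?thesis ..
qed

lemma nn_integral_Beta_real:
  assumes "0 < a" "0 < b"
  shows "(\<integral>\<^sup>+v. ennreal (indicator {0<..<1} v * (v powr (a - 1) * (1 - v) powr (b - 1))) \<partial>lborel) = ennreal (Beta a b)" (is "?lhs = _")
proof -
  have "(\<integral>\<^sup>+v. ennreal (indicator {0..1} v * (v powr (a - 1) * (1 - v) powr (b - 1))) \<partial>lborel) = ennreal (Beta a b)"
    using nn_integral_has_integral_lebesgue[OF _ has_integral_Beta_real[OF assms]] by simp
  moreover have "(\<integral>\<^sup>+v. ennreal (indicator {0..1} v * (v powr (a - 1) * (1 - v) powr (b - 1))) \<partial>lborel)
    = ?lhs"
    by (intro nn_integral_cong_AE AE_I[where N="{0,1}"]) (auto simp: indicator_def emeasure_lborel_countable)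
  ultimately show ?thesis by simp
qed

text \<open>The entire part of the modified Bessel function: \<open>bessel_I g z\<close> is
  \<open>(z / 2) powr g\<close> times \<open>bessel_E g\<close> at \<open>(z / 2)\<^sup>2\<close>.
  The singular prefactor cancels in the Laguerre kernel, so all integrals can be done with this
  power series.\<close>

definition bessel_E :: "real \<Rightarrow> real \<Rightarrow> real" where
  "bessel_E g u = (\<Sum>k. rGamma (real k + g + 1) / fact k * u ^ k)"

lemma rGamma_nonneg_real: "0 < x \<Longrightarrow> 0 \<le> rGamma (x::real)"
  by (simp add: rGamma_inverse_Gamma Gamma_real_nonneg)

lemma summable_bessel_E: 
  assumes "- 1 < g" 
  shows "summable (\<lambda>k. rGamma (real k + g + 1) / fact k * u ^ k)"
proof -
  \<comment> \<open>The recursion for the reciprocal Gamma function makes the coefficients decrease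
    only where the argument is at least 1. For \<open>k = 0\<close> the argument
    \<open>g + 1\<close> may be smaller, hence the shift to \<open>Suc k\<close> and the comparison
    from index 1 on.\<close>
  have le: "rGamma (real (Suc k) + g + 1) \<le> rGamma (g + 2)" for k
  proof (induction k)
    case (Suc k)
    have "rGamma (real (Suc k) + g + 1) = (real (Suc k) + g + 1) * rGamma (real (Suc (Suc k)) + g + 1)"
      using rGamma_plus1[of "real (Suc k) + g + 1"] by (simp add: algebra_simps)
    moreover have "1 * rGamma (real (Suc (Suc k)) + g + 1) \<le> (real (Suc k) + g + 1) * rGamma (real (Suc (Suc k)) + g + 1)"
      using assms by (intro mult_right_mono rGamma_nonneg_real) auto
    ultimately show ?case using Suc by simp
  qed (simp add: algebra_simps)
  have "summable (\<lambda>k. rGamma (g + 2) * (\<bar>u\<bar> ^ k / fact k))"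
    using summable_exp[of "\<bar>u\<bar>"] by (intro summable_mult) (simp add: field_simps)
  then show ?thesis
  proof (rule summable_comparison_test'[where N=1])
    fix n :: nat assume "1 \<le> n"
    then obtain k where k: "n = Suc k" by (cases n) auto
    have n0: "0 \<le> rGamma (real n + g + 1)" using assms k by (intro rGamma_nonneg_real) auto
    have "norm (rGamma (real n + g + 1) / fact n * u ^ n) = rGamma (real n + g + 1) * (\<bar>u\<bar> ^ n / fact n)"
      using n0 by (simp add: abs_mult power_abs)
    also have "\<dots> \<le> rGamma (g + 2) * (\<bar>u\<bar> ^ n / fact n)"
      using le[of k] k by (intro mult_right_mono) auto
    finally show "norm (rGamma (real n + g + 1) / fact n * u ^ n) \<le> rGamma (g + 2) * (\<bar>u\<bar> ^ n / fact n)" .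
  qed
qed

lemma ennreal_bessel_E:
  assumes "- 1 < g" "0 \<le> u"
  shows "ennreal (bessel_E g u) = (\<Sum>k. ennreal (rGamma (real k + g + 1) / fact k * u ^ k))"
  unfolding bessel_E_def using assms
  by (intro suminf_ennreal2[symmetric] summable_bessel_E) (auto intro!: mult_nonneg_nonneg divide_nonneg_pos rGamma_nonneg_real)

lemma bessel_E_nonneg: "- 1 < g \<Longrightarrow> 0 \<le> u \<Longrightarrow> 0 \<le> bessel_E g u"
  unfolding bessel_E_def
  by (intro suminf_nonneg summable_bessel_E) (auto intro!: mult_nonneg_nonneg divide_nonneg_pos rGamma_nonneg_real)

lemma borel_measurable_bessel_E [measurable]: "bessel_E g \<in> borel_measurable borel"
  unfolding bessel_E_def by measurable

lemma bessel_I_eq: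
  assumes "- 1 < g" "0 < z"
  shows "bessel_I g z = (z / 2) powr g * bessel_E g ((z / 2)\<^sup>2)"
proof -
  have "bessel_I g z = (\<Sum>k. (z / 2) powr g * (rGamma (real k + g + 1) / fact k * ((z / 2)\<^sup>2) ^ k))"
    unfolding bessel_I_def
  proof (intro suminf_cong)
    fix k :: nat
    have "(z / 2) powr (2 * real k) = (z / 2) ^ (2 * k)"
      using assms powr_realpow[of "z / 2" "2 * k"] by simp
    then show "rGamma (real k + g + 1) / fact k * (z / 2) powr (2 * real k + g) = (z / 2) powr g * (rGamma (real k + g + 1) / fact k * ((z / 2)\<^sup>2) ^ k)"
      by (simp add: powr_add power_mult)
  qed
  also have "\<dots> = (z / 2) powr g * bessel_E g ((z / 2)\<^sup>2)"
    unfolding bessel_E_def by (rule suminf_mult) (rule summable_bessel_E[OF assms(1)])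
  finally show ?thesis .
qed

lemma nn_integral_bessel_E_termwise:
  fixes f :: "real \<Rightarrow> ennreal"
  assumes g: "- 1 < g" and b: "0 \<le> b" and [measurable]: "f \<in> borel_measurable borel"
  shows "(\<integral>\<^sup>+y. f y * ennreal (bessel_E g (b * y\<^sup>2)) \<partial>lborel)
    = (\<Sum>k. ennreal (rGamma (real k + g + 1) / fact k * b ^ k) * (\<integral>\<^sup>+y. f y * ennreal ((y\<^sup>2) ^ k) \<partial>lborel))" (is "?lhs = _")
proof -
  let ?c = "\<lambda>k. rGamma (real k + g + 1) / fact k * b ^ k"
  have c: "0 \<le> ?c k" for k
    using g b by (intro mult_nonneg_nonneg divide_nonneg_pos rGamma_nonneg_real) auto
  have "f y * ennreal (bessel_E g (b * y\<^sup>2)) = (\<Sum>k. ennreal (?c k) * (f y * ennreal ((y\<^sup>2) ^ k)))" for y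
  proof -
    have "ennreal (rGamma (real k + g + 1) / fact k * (b * y\<^sup>2) ^ k) = ennreal (?c k) * ennreal ((y\<^sup>2) ^ k)" for k
      unfolding ennreal_mult'[OF c, symmetric] by (simp add: power_mult_distrib mult.assoc)
    then show ?thesis
      using g b by (subst ennreal_bessel_E) (simp_all add: mult.left_commute flip: ennreal_suminf_cmult)
  qed
  then have "?lhs = (\<integral>\<^sup>+y. (\<Sum>k. ennreal (?c k) * (f y * ennreal ((y\<^sup>2) ^ k))) \<partial>lborel)" by (simp only:)
  also have "\<dots> = (\<Sum>k. \<integral>\<^sup>+y. ennreal (?c k) * (f y * ennreal ((y\<^sup>2) ^ k)) \<partial>lborel)"
    by (rule nn_integral_suminf) measurable
  finally show ?thesis by (simp add: nn_integral_cmult)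
qed

lemma half_line_powr_shift:
  "ennreal (indicator {0<..} y * (y powr a * c)) * ennreal ((y\<^sup>2) ^ k) = ennreal (indicator {0<..} y * (y powr (a + 2 * real k) * c))"
proof (cases "0 < y")
  case True
  have "y powr (real (2 * k)) = (y\<^sup>2) ^ k" using True powr_realpow[of y "2 * k"] by (simp add: power_mult)
  then show ?thesis using True by (simp add: ennreal_mult''[symmetric] powr_add mult_ac)
qed simp

lemma nn_integral_bessel_E_weighted:
  assumes g: "- 1 < g" and p: "0 < p" and m: "0 < m" and a: "0 \<le> a"
  shows "half_line_integral (\<lambda>y. y powr (2 * m - 1) * exp (- p * y\<^sup>2) * bessel_E g (a * y\<^sup>2))
    = (\<Sum>k. ennreal (rGamma (real k + g + 1) / fact k * a ^ k * (Gamma (m + real k) * p powr (- (m + real k)) / 2)))" (is "?lhs = _")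
proof -
  have e: "2 * m - 1 + 2 * real k = 2 * (m + real k) - 1" for k by simp
  have "?lhs = (\<integral>\<^sup>+y. ennreal (indicator {0<..} y * (y powr (2 * m - 1) * exp (- p * y\<^sup>2))) * ennreal (bessel_E g (a * y\<^sup>2)) \<partial>lborel)"
    by (intro nn_integral_cong) (simp add: ennreal_mult'[symmetric] mult.assoc)
  also have "\<dots> = (\<Sum>k. ennreal (rGamma (real k + g + 1) / fact k * a ^ k)
      * half_line_integral (\<lambda>y. y powr (2 * (m + real k) - 1) * exp (- p * y\<^sup>2)))"
    by (subst nn_integral_bessel_E_termwise[OF g a], measurable, simp only: half_line_powr_shift e)
  also have "\<dots> = (\<Sum>k. ennreal (rGamma (real k + g + 1) / fact k * a ^ k * (Gamma (m + real k) * p powr (- (m + real k)) / 2)))"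
    using p m by (intro suminf_cong) (subst nn_integral_powr_gaussian, auto simp: ennreal_mult''[symmetric] Gamma_real_nonneg)
  finally show ?thesis .
qed

text \<open>Weber's first exponential integral. The weight exponent \<open>2 * g + 1\<close> makes
  the \<open>k\<close>-th Gaussian moment \<open>Gamma (g + 1 + k)\<close>, which cancels the Bessel
  coefficient exactly; an exponential series remains.\<close>

lemma nn_integral_bessel_E_gaussian:
  assumes g: "- 1 < g" and p: "0 < p" and a: "0 \<le> a"
  shows "half_line_integral (\<lambda>y. y powr (2 * g + 1) * exp (- p * y\<^sup>2) * bessel_E g (a * y\<^sup>2))
    = ennreal (p powr (- (g + 1)) / 2 * exp (a / p))" (is "?lhs = _")
proof -
  have "?lhs
    = (\<Sum>k. ennreal (rGamma (real k + g + 1) / fact k * a ^ k * (Gamma (g + 1 + real k) * p powr (- (g + 1 + real k)) / 2)))"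
    using nn_integral_bessel_E_weighted[of g p "g + 1" a] g p a by (simp add: algebra_simps)
  also have "\<dots> = (\<Sum>k. ennreal (p powr (- (g + 1)) / 2 * ((a / p) ^ k / fact k)))"
  proof (intro suminf_cong arg_cong[where f=ennreal])
    fix k
    have "real k + g + 1 = g + 1 + real k" by simp
    then have "rGamma (real k + g + 1) * Gamma (g + 1 + real k) = 1"
      using Gamma_real_pos[of "g + 1 + real k"] g
      by (simp only: rGamma_inverse_Gamma) (intro left_inverse, linarith)
    moreover have "p powr (- (g + 1 + real k)) = p powr (- (g + 1)) / p ^ k"
      using p by (simp add: powr_diff[symmetric] powr_realpow[symmetric])
    ultimately show "rGamma (real k + g + 1) / fact k * a ^ k * (Gamma (g + 1 + real k) * p powr (- (g + 1 + real k)) / 2) = p powr (- (g + 1)) / 2 * ((a / p) ^ k / fact k)"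
      by (simp add: power_divide field_simps)
  qed
  also have "\<dots> = ennreal (\<Sum>k. p powr (- (g + 1)) / 2 * ((a / p) ^ k / fact k))"
  proof (rule suminf_ennreal2)
    have "summable (\<lambda>k. (a / p) ^ k / fact k)" using summable_exp[of "a / p"] by (simp add: field_simps)
    then show "summable (\<lambda>k. p powr (- (g + 1)) / 2 * ((a / p) ^ k / fact k))" by (rule summable_mult)
  qed (use a p in simp)
  also have "(\<Sum>k. p powr (- (g + 1)) / 2 * ((a / p) ^ k / fact k)) = p powr (- (g + 1)) / 2 * exp (a / p)"
    using exp_converges[of "a / p"] by (intro sums_unique[symmetric] sums_mult) (simp add: field_simps)
  finally show ?thesis .
qed

section \<open>Resummation of double series and Weber's second exponential integral\<close>

lemma ennreal_suminf_swap:
  fixes f :: "nat \<Rightarrow> nat \<Rightarrow> ennreal"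
  shows "(\<Sum>i. \<Sum>j. f i j) = (\<Sum>j. \<Sum>i. f i j)"
proof -
  have "(\<Sum>i. \<Sum>j. f i j) = (\<integral>\<^sup>+i. (\<Sum>j. f i j) \<partial>count_space UNIV)"
    by (rule nn_integral_count_space_nat[symmetric])
  also have "\<dots> = (\<Sum>j. \<integral>\<^sup>+i. f i j \<partial>count_space UNIV)"
    by (rule nn_integral_suminf) simp
  also have "\<dots> = (\<Sum>j. \<Sum>i. f i j)"
    by (intro suminf_cong nn_integral_count_space_nat)
  finally show ?thesis .
qed

lemma ennreal_suminf_shift:
  fixes h :: "nat \<Rightarrow> ennreal"
  shows "(\<Sum>k. if m \<le> k then h (k - m) else 0) = (\<Sum>k. h k)"
  using suminf_offset[of "\<lambda>k. if m \<le> k then h (k - m) else 0" m]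
  by simp

lemma ennreal_exp:
  assumes "0 \<le> x"
  shows "ennreal (exp x) = (\<Sum>k. ennreal (x ^ k / fact k))"
proof -
  have "(\<lambda>k. x ^ k / fact k) sums exp x"
    using exp_converges[of x] by (simp add: field_simps)
  then show ?thesis
    using assms by (intro suminf_ennreal_eq[symmetric]) auto
qed

lemma gbinomial_Gamma_real:
  fixes z :: real
  assumes "0 < z + 1"
  shows "z gchoose n = Gamma (z + 1) * rGamma (z - real n + 1) / fact n"
proof -
  have "z + 1 \<notin> \<int>\<^sub>\<le>\<^sub>0" using assms by (auto elim!: nonpos_Ints_cases)
  from gbinomial_Gamma[OF this, of n] show ?thesis
    by (simp add: rGamma_inverse_Gamma divide_inverse mult_ac)
qed

lemma rGamma_Gamma_real:
  assumes "0 < (x::real)"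
  shows "rGamma x * Gamma x = 1"
proof -
  have "Gamma x \<noteq> 0" using Gamma_real_pos[OF assms] by linarith
  then show ?thesis unfolding rGamma_inverse_Gamma by (rule left_inverse)
qed

text \<open>Vandermonde's identity for \<open>k + (l + g)\<close> choose \<open>l\<close>, with both
  sides written in Gamma functions. The condition \<open>m \<le> k\<close> reflects that
  \<open>k\<close> choose \<open>m\<close> vanishes beyond \<open>k\<close>.\<close>

lemma bessel_coeff_product:
  assumes g: "- 1 < g"
  shows "Gamma (real k + real l + g + 1) * rGamma (real k + g + 1) * rGamma (real l + g + 1) / (fact k * fact l)
    = (\<Sum>m\<le>l. if m \<le> k then rGamma (real m + g + 1) / (fact m * fact (k - m) * fact (l - m)) else 0)"
proof -
  let ?b = "\<lambda>m. if m \<le> k then fact k / (fact m * fact (k - m)) else 0"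
  let ?c = "\<lambda>m. Gamma (real l + g + 1) * rGamma (real m + g + 1) / fact (l - m)"
  have rl: "rGamma (real l + g + 1) * Gamma (real l + g + 1) = 1"
    using g by (intro rGamma_Gamma_real) auto
  have "(real k + (real l + g)) gchoose l = (\<Sum>m\<le>l. (real k gchoose m) * ((real l + g) gchoose (l - m)))"
    using gbinomial_Vandermonde[of "real k" "real l + g" l] by (simp add: atMost_atLeast0)
  also have "\<dots> = (\<Sum>m\<le>l. (?b m) * (?c m))"
  proof (intro sum.cong refl arg_cong2[where f="(*)"])
    fix m assume "m \<in> {..l}"
    then have m: "real (l - m) = real l - real m" by (simp add: of_nat_diff)
    show "real k gchoose m = ?b m"
      by (simp add: binomial_gbinomial[symmetric] binomial_fact binomial_eq_0)
    show "(real l + g) gchoose (l - m) = Gamma (real l + g + 1) * rGamma (real m + g + 1) / fact (l - m)"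
      using g by (subst gbinomial_Gamma_real) (auto simp: m algebra_simps)
  qed
  also have "(real k + (real l + g)) gchoose l = Gamma (real k + real l + g + 1) * rGamma (real k + g + 1) / fact l"
    using g by (subst gbinomial_Gamma_real) (auto simp: algebra_simps)
  finally have "Gamma (real k + real l + g + 1) * rGamma (real k + g + 1) / fact l * (rGamma (real l + g + 1) / fact k)
    = (\<Sum>m\<le>l. (?b m) * (?c m) * (rGamma (real l + g + 1) / fact k))"
    by (simp only: sum_distrib_right)
  also have "\<dots> = (\<Sum>m\<le>l. if m \<le> k then rGamma (real m + g + 1) / (fact m * fact (k - m) * fact (l - m)) else 0)"
  proof (intro sum.cong refl)
    fix m
    have "fact k / (fact m * fact (k - m)) * (G * r / fact (l - m)) * (R / fact k) = (R * G) * (r / (fact m * fact (k - m) * fact (l - m)))"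
      for G r R :: real by (simp add: mult_ac)
    then show "(?b m) * (?c m) * (rGamma (real l + g + 1) / fact k)
      = (if m \<le> k then rGamma (real m + g + 1) / (fact m * fact (k - m) * fact (l - m)) else 0)"
      by (simp add: rl)
  qed
  finally show ?thesis
    by (simp only: times_divide_eq_left times_divide_eq_right divide_divide_eq_left mult.commute[of "fact l"])
qed

text \<open>Weber's second exponential integral. The double power series is resummed by Vandermonde's identity.\<close>

lemma nn_integral_bessel_E_product:
  assumes g: "- 1 < g" and p: "0 < p" and a: "0 \<le> a" and b: "0 \<le> b"
  shows "half_line_integral (\<lambda>y. y powr (2 * g + 1) * exp (- p * y\<^sup>2) * bessel_E g (a * y\<^sup>2) * bessel_E g (b * y\<^sup>2))
    = ennreal (p powr (- (g + 1)) / 2 * exp ((a + b) / p) * bessel_E g (a * b / p\<^sup>2))" (is "?lhs = _")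
proof -
  let ?r = "\<lambda>k. rGamma (real k + g + 1)"
  let ?G = "\<lambda>k l. ?r k / fact k * a ^ k * (Gamma (g + 1 + real l + real k) * p powr (- (g + 1 + real l + real k)) / 2)"
  let ?u = "\<lambda>l. ?r l / fact l * b ^ l"
  define A where "A = a / p"
  define B where "B = b / p"
  have A: "0 \<le> A" and B: "0 \<le> B" using a b p by (auto simp: A_def B_def)
  have r0: "0 \<le> ?r k" for k using g by (intro rGamma_nonneg_real) auto
  have z: "0 \<le> a * b / p\<^sup>2" using a b by simp
  define P where "P = p powr (- (g + 1)) / 2"
  have P: "0 \<le> P" by (simp add: P_def)
  \<comment> \<open>The Vandermonde index \<open>m\<close> becomes a third summation index. In the
    sum over \<open>k\<close> and \<open>l\<close> at fixed \<open>m\<close>, the shifts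
    \<open>k - m\<close> and \<open>l - m\<close> produce the series of \<open>exp A\<close> and
    \<open>exp B\<close>; the remaining sum over \<open>m\<close> is again a Bessel series.\<close>
  define t where "t = (\<lambda>k l m. if m \<le> k \<and> m \<le> l then A ^ k * B ^ l * ?r m / (fact m * fact (k - m) * fact (l - m)) else 0)"
  have t0: "0 \<le> t k l m" for k l m using A B r0 by (simp add: t_def)
  have e: "2 * g + 1 + 2 * real l = 2 * (g + 1 + real l) - 1" for l by simp
  have "?lhs = (\<integral>\<^sup>+y. ennreal (indicator {0<..} y * (y powr (2 * g + 1) * (exp (- p * y\<^sup>2) * bessel_E g (a * y\<^sup>2)))) * ennreal (bessel_E g (b * y\<^sup>2)) \<partial>lborel)"
    using g a by (intro nn_integral_cong) (simp add: ennreal_mult'[symmetric] bessel_E_nonneg mult.assoc)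
  also have "\<dots> = (\<Sum>l. ennreal (?u l) * half_line_integral (\<lambda>y. y powr (2 * (g + 1 + real l) - 1) * exp (- p * y\<^sup>2) * bessel_E g (a * y\<^sup>2)))"
    by (subst nn_integral_bessel_E_termwise[OF g b], measurable, simp only: half_line_powr_shift e mult.assoc)
  also have "\<dots> = (\<Sum>l. \<Sum>k. ennreal (?u l) * ennreal (?G k l))"
    using g a p by (subst nn_integral_bessel_E_weighted) simp_all
  also have "\<dots> = (\<Sum>l. \<Sum>k. ennreal P * (\<Sum>m. ennreal (t k l m)))"
  proof (intro suminf_cong)
    fix l k :: nat
    have eq: "real k + real l + g + 1 = g + 1 + real l + real k" by simp
    have coeff: "Gamma (g + 1 + real l + real k) * ?r k * ?r l / (fact k * fact l) = (\<Sum>m\<le>l. if m \<le> k then ?r m / (fact m * fact (k - m) * fact (l - m)) else 0)"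
      using bessel_coeff_product[OF g, of k l] by (simp only: eq)
    have "g + 1 + real l + real k = (g + 1) + real (k + l)" by simp
    then have pp: "p powr (- (g + 1 + real l + real k)) = p powr (- (g + 1)) / p ^ (k + l)"
      using p by (simp only: minus_add_distrib powr_add powr_minus powr_realpow) (simp add: divide_inverse)
    have key: "r / f * b ^ l * (q / h * a ^ k * (G * (Q / p ^ (k + l)) / 2)) = Q / 2 * ((a / p) ^ k * (b / p) ^ l * (G * q * r / (h * f)))" for r f q h G Q :: real
      by (simp add: power_divide power_add mult_ac)
    have "?r l / fact l * b ^ l * (?G k l)
      = P * (A ^ k * B ^ l * (Gamma (g + 1 + real l + real k) * ?r k * ?r l / (fact k * fact l)))"
      unfolding pp P_def A_def B_def by (rule key)
    also have "A ^ k * B ^ l * (Gamma (g + 1 + real l + real k) * ?r k * ?r l / (fact k * fact l)) = (\<Sum>m\<le>l. t k l m)"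
      unfolding coeff sum_distrib_left by (intro sum.cong) (auto simp: t_def)
    finally have eq: "?r l / fact l * b ^ l * (?G k l) = P * (\<Sum>m\<le>l. t k l m)" .
    have nn: "0 \<le> ?r l / fact l * b ^ l" using r0 b by simp
    have "(\<Sum>m. ennreal (t k l m)) = (\<Sum>m\<le>l. ennreal (t k l m))"
      by (rule suminf_finite) (auto simp: t_def)
    also have "\<dots> = ennreal (\<Sum>m\<le>l. t k l m)" using t0 by simp
    finally show "ennreal (?u l) * ennreal (?G k l) = ennreal P * (\<Sum>m. ennreal (t k l m))"
      by (simp only: ennreal_mult'[OF nn, symmetric] ennreal_mult'[OF P, symmetric] eq)
  qed
  also have "\<dots> = ennreal P * (\<Sum>l. \<Sum>k. \<Sum>m. ennreal (t k l m))" by simp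
  also have "(\<Sum>l. \<Sum>k. \<Sum>m. ennreal (t k l m)) = (\<Sum>l. \<Sum>m. \<Sum>k. ennreal (t k l m))"
    by (intro suminf_cong ennreal_suminf_swap)
  also have "\<dots> = (\<Sum>m. \<Sum>l. \<Sum>k. ennreal (t k l m))" by (rule ennreal_suminf_swap)
  also have "\<dots> = (\<Sum>m. ennreal (?r m / fact m * (a * b / p\<^sup>2) ^ m) * (ennreal (exp A) * ennreal (exp B)))"
  proof (intro suminf_cong)
    fix m
    define u where "u = (\<lambda>l. if m \<le> l then ennreal (B ^ (l - m) / fact (l - m)) else 0)"
    define v where "v = (\<lambda>k. if m \<le> k then ennreal (A ^ (k - m) / fact (k - m)) else 0)"
    have tuv: "ennreal (t k l m) = ennreal (?r m / fact m * (a * b / p\<^sup>2) ^ m) * (u l * v k)" for k l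
    proof (cases "m \<le> k \<and> m \<le> l")
      case True
      then have kl: "A ^ k = A ^ m * A ^ (k - m)" "B ^ l = B ^ m * B ^ (l - m)" by (simp_all add: power_add[symmetric])
      have ab: "(a * b / p\<^sup>2) ^ m = A ^ m * B ^ m" by (simp add: A_def B_def power2_eq_square power_mult_distrib[symmetric])
      have "t k l m = ?r m / fact m * (a * b / p\<^sup>2) ^ m * ((B ^ (l - m) / fact (l - m)) * (A ^ (k - m) / fact (k - m)))"
        using True unfolding ab by (simp add: t_def kl mult_ac)
      moreover have n1: "0 \<le> ?r m / fact m * (a * b / p\<^sup>2) ^ m" using r0 a b by simp
      moreover have n2: "0 \<le> B ^ (l - m) / fact (l - m)" using B by simp
      moreover have "u l = ennreal (B ^ (l - m) / fact (l - m))" "v k = ennreal (A ^ (k - m) / fact (k - m))"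
        using True by (simp_all add: u_def v_def)
      ultimately show ?thesis by (simp only: ennreal_mult'[OF n1] ennreal_mult'[OF n2])
    qed (auto simp: t_def u_def v_def)
    have "(\<Sum>l. \<Sum>k. ennreal (t k l m)) = ennreal (?r m / fact m * (a * b / p\<^sup>2) ^ m) * ((\<Sum>l. u l) * (\<Sum>k. v k))"
      unfolding tuv by simp
    also have "(\<Sum>l. u l) = ennreal (exp B)" unfolding u_def ennreal_exp[OF B] by (rule ennreal_suminf_shift)
    also have "(\<Sum>l. v l) = ennreal (exp A)" unfolding v_def ennreal_exp[OF A] by (rule ennreal_suminf_shift)
    finally show "(\<Sum>l. \<Sum>k. ennreal (t k l m)) = ennreal (?r m / fact m * (a * b / p\<^sup>2) ^ m) * (ennreal (exp A) * ennreal (exp B))"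
      by (simp add: mult.commute)
  qed
  also have "\<dots> = ennreal (bessel_E g (a * b / p\<^sup>2)) * ennreal (exp (A + B))"
    unfolding ennreal_suminf_multc ennreal_bessel_E[OF g z] exp_add by (simp only: ennreal_mult'[OF exp_ge_zero])
  also have "ennreal P * (ennreal (bessel_E g (a * b / p\<^sup>2)) * ennreal (exp (A + B)))
     = ennreal (P * (bessel_E g (a * b / p\<^sup>2) * exp (A + B)))"
    by (simp only: ennreal_mult'[OF P] ennreal_mult'[OF bessel_E_nonneg[OF g z]])
  also have "P * (bessel_E g (a * b / p\<^sup>2) * exp (A + B)) = p powr (- (g + 1)) / 2 * exp ((a + b) / p) * bessel_E g (a * b / p\<^sup>2)"
    by (simp add: P_def A_def B_def add_divide_distrib)
  finally show ?thesis .
qed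

section \<open>The one-dimensional Laguerre kernel\<close>

text \<open>The one-coordinate factor of \<open>laguerre_kernel\<close>, that is, the Hille-Hardy
  kernel in closed form.\<close>

definition lag1 :: "real \<Rightarrow> real \<Rightarrow> real \<Rightarrow> real \<Rightarrow> real" where
  "lag1 g t u v = 1 / sinh (2 * t) * exp (- (1 / 2) * (cosh (2 * t) / sinh (2 * t)) * (u\<^sup>2 + v\<^sup>2))
     * ((u * v) powr (- g) * bessel_I g (u * v / sinh (2 * t)))"

text \<open>The power \<open>(u * v) powr (- g)\<close> cancels the prefactor of the Bessel
  function. What remains is a Gaussian times \<open>bessel_E\<close> in \<open>v\<^sup>2\<close>,
  the shape treated by Weber's integrals.\<close>

lemma lag1_eq:
  assumes g: "- 1 < g" and t: "0 < t" and u: "0 < u" and v: "0 < v"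
  shows "lag1 g t u v = 1 / sinh (2 * t) * (2 * sinh (2 * t)) powr (- g) * exp (- (cosh (2 * t) / (2 * sinh (2 * t))) * u\<^sup>2)
    * exp (- (cosh (2 * t) / (2 * sinh (2 * t))) * v\<^sup>2) * bessel_E g ((u / (2 * sinh (2 * t)))\<^sup>2 * v\<^sup>2)"
proof -
  define s where "s = sinh (2 * t)"
  have s: "0 < s" using t by (simp add: s_def)
  have "(u * v) powr (- g) * bessel_I g (u * v / s) = (u * v) powr (- g) * ((u * v / s / 2) powr g * bessel_E g ((u * v / s / 2)\<^sup>2))"
    using g u v s by (simp add: bessel_I_eq)
  also have "\<dots> = ((u * v) powr (- g) * (u * v / s / 2) powr g) * bessel_E g ((u / (2 * s))\<^sup>2 * v\<^sup>2)"
    by (simp add: power_mult_distrib power_divide mult_ac)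
  also have "(u * v) powr (- g) * (u * v / s / 2) powr g = (2 * s) powr (- g)"
    using u v s by (simp add: powr_divide powr_mult powr_minus field_simps)
  finally have *: "(u * v) powr (- g) * bessel_I g (u * v / s) = (2 * s) powr (- g) * bessel_E g ((u / (2 * s))\<^sup>2 * v\<^sup>2)" .
  have "exp (- (1 / 2) * (cosh (2 * t) / s) * (u\<^sup>2 + v\<^sup>2)) = exp (- (cosh (2 * t) / (2 * s)) * u\<^sup>2) * exp (- (cosh (2 * t) / (2 * s)) * v\<^sup>2)"
    by (simp add: exp_add[symmetric] algebra_simps add_divide_distrib)
  then show ?thesis
    unfolding lag1_def s_def[symmetric] * by (simp add: mult_ac)
qed

lemma lag1_sym: "lag1 g t u v = lag1 g t v u"
  by (simp add: lag1_def mult.commute add.commute)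

lemma lag1_nonneg: "- 1 < g \<Longrightarrow> 0 < t \<Longrightarrow> 0 < u \<Longrightarrow> 0 < v \<Longrightarrow> 0 \<le> lag1 g t u v"
  by (simp add: lag1_eq bessel_E_nonneg)

lemma borel_measurable_bessel_I [measurable]: "bessel_I g \<in> borel_measurable borel"
  unfolding bessel_I_def by measurable

lemma borel_measurable_lag1 [measurable (raw)]:
  assumes [measurable]: "f \<in> borel_measurable M" "h \<in> borel_measurable M"
  shows "(\<lambda>x. lag1 g t (f x) (h x)) \<in> borel_measurable M"
  unfolding lag1_def by measurable

lemma nn_integral_cmult_real:
  assumes "\<And>x. f x = c * h x" "0 \<le> c" "h \<in> borel_measurable M" "(\<integral>\<^sup>+x. ennreal (h x) \<partial>M) = ennreal I"
  shows "(\<integral>\<^sup>+x. ennreal (f x) \<partial>M) = ennreal (c * I)" (is "?lhs = _")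
proof -
  have "?lhs = (\<integral>\<^sup>+x. ennreal c * ennreal (h x) \<partial>M)"
    by (intro nn_integral_cong) (simp add: assms(1) ennreal_mult'[OF assms(2)])
  also have "\<dots> = ennreal c * (\<integral>\<^sup>+x. ennreal (h x) \<partial>M)"
    using assms(3) by (intro nn_integral_cmult) measurable
  finally show ?thesis by (simp add: assms(4) ennreal_mult'[OF assms(2)])
qed

lemma lag1_gaussian:
  fixes q t u g :: real
  defines "s \<equiv> sinh (2 * t)" and "c \<equiv> cosh (2 * t)"
  assumes g: "- 1 < g" and t: "0 < t" and u: "0 < u" and q: "0 \<le> q"
  shows "half_line_integral (\<lambda>v. v powr (2 * g + 1) * (exp (- q * v\<^sup>2) * lag1 g t u v))
    = ennreal ((c + 2 * s * q) powr (- (g + 1)) * exp (- ((s + 2 * c * q) / (2 * (c + 2 * s * q))) * u\<^sup>2))" (is "?lhs = _")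
proof -
  have s: "0 < s" using t by (simp add: s_def)
  have c: "1 \<le> c" by (simp add: c_def cosh_real_ge_1)
  have cs: "c\<^sup>2 = 1 + s\<^sup>2" by (simp add: c_def s_def cosh_square_eq)
  define D where "D = c + 2 * s * q"
  have D: "0 < D" using c s q by (simp add: D_def add_pos_nonneg)
  define p where "p = c / (2 * s) + q"
  have pD: "p = D / (2 * s)" using s by (simp add: p_def D_def field_simps)
  have p: "0 < p" using D s by (simp add: pD)
  define a where "a = (u / (2 * s))\<^sup>2"
  define K where "K = 1 / s * (2 * s) powr (- g) * exp (- (c / (2 * s)) * u\<^sup>2)"
  have "?lhs
    = ennreal (K * (p powr (- (g + 1)) / 2 * exp (a / p)))"
  proof (rule nn_integral_cmult_real)
    show "half_line_integral (\<lambda>y. y powr (2 * g + 1) * exp (- p * y\<^sup>2) * bessel_E g (a * y\<^sup>2))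
      = ennreal (p powr (- (g + 1)) / 2 * exp (a / p))"
      by (rule nn_integral_bessel_E_gaussian) (use g p in \<open>auto simp: a_def\<close>)
    fix v :: real
    have "exp (- q * v\<^sup>2) * exp (- (c / (2 * s)) * v\<^sup>2) = exp (- p * v\<^sup>2)"
      by (simp add: exp_add[symmetric] p_def algebra_simps)
    then have "v powr (2 * g + 1) * (exp (- q * v\<^sup>2) * lag1 g t u v) = K * (v powr (2 * g + 1) * exp (- p * v\<^sup>2) * bessel_E g (a * v\<^sup>2))" if "0 < v"
      using lag1_eq[OF g t u that] by (simp add: K_def a_def s_def c_def mult_ac)
    then show "indicator {0<..} v * (v powr (2 * g + 1) * (exp (- q * v\<^sup>2) * lag1 g t u v)) = K * (indicator {0<..} v * (v powr (2 * g + 1) * exp (- p * v\<^sup>2) * bessel_E g (a * v\<^sup>2)))"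
      by (auto simp: indicator_def)
  qed (use s in \<open>simp_all add: K_def\<close>)
  also have "K * (p powr (- (g + 1)) / 2 * exp (a / p)) = D powr (- (g + 1)) * exp (- ((s + 2 * c * q) / (2 * D)) * u\<^sup>2)"
  proof -
    have "p powr (- (g + 1)) = D powr (- (g + 1)) * (2 * s) powr (g + 1)"
      unfolding pD powr_divide powr_minus by (simp add: divide_inverse)
    moreover have "(2 * s) powr (- g) * (2 * s) powr (g + 1) = 2 * s"
      using s by (simp add: powr_add[symmetric])
    ultimately have 1: "1 / s * (2 * s) powr (- g) * (p powr (- (g + 1)) / 2) = D powr (- (g + 1))"
      using s by (simp add: field_simps)
    have ap: "a / p = u\<^sup>2 * (1 / (2 * s * D))"
      using s D by (simp add: a_def pD power2_eq_square field_simps)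
    have "c / (2 * s) - 1 / (2 * s * D) = (c * D - 1) / (2 * s * D)"
      using s D by (simp add: field_simps)
    \<comment> \<open>The relation \<open>c\<^sup>2 = 1 + s\<^sup>2\<close> splits off a factor
      \<open>s\<close>, which keeps the new width regular as \<open>t\<close> tends to 0.\<close>
    also have "c * D - 1 = s * (s + 2 * c * q)"
      using cs by (simp add: D_def power2_eq_square algebra_simps)
    also have "s * (s + 2 * c * q) / (2 * s * D) = (s + 2 * c * q) / (2 * D)" using s by simp
    finally have "c / (2 * s) - 1 / (2 * s * D) = (s + 2 * c * q) / (2 * D)" .
    moreover have "- x * y + y * z = - (x - z) * y" for x y z :: real by (simp add: algebra_simps)
    ultimately have "- (c / (2 * s)) * u\<^sup>2 + a / p = - ((s + 2 * c * q) / (2 * D)) * u\<^sup>2"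
      unfolding ap by (simp only:)
    then have 2: "exp (- (c / (2 * s)) * u\<^sup>2) * exp (a / p) = exp (- ((s + 2 * c * q) / (2 * D)) * u\<^sup>2)"
      unfolding exp_add[symmetric] by (rule arg_cong)
    have "K * (p powr (- (g + 1)) / 2 * exp (a / p)) = (1 / s * (2 * s) powr (- g) * (p powr (- (g + 1)) / 2)) * (exp (- (c / (2 * s)) * u\<^sup>2) * exp (a / p))"
      by (simp add: K_def)
    then show ?thesis unfolding 1 2 .
  qed
  finally show ?thesis by (simp add: D_def)
qed

text \<open>Weber's second integral, after which the addition theorem for \<open>sinh\<close> turns
  the summed Gaussian width \<open>p\<close> into \<open>R / (2 * S * T)\<close> and reassembles the
  kernel at time \<open>s + t\<close>.\<close>

lemma lag1_Chapman_Kolmogorov: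
  assumes g: "- 1 < g" and s: "0 < s" and t: "0 < t" and u: "0 < u" and w: "0 < w"
  shows "half_line_integral (\<lambda>v. v powr (2 * g + 1) * (lag1 g s u v * lag1 g t v w))
    = ennreal (lag1 g (s + t) u w)" (is "?lhs = _")
proof -
  define S where "S = sinh (2 * s)"
  define T where "T = sinh (2 * t)"
  define cS where "cS = cosh (2 * s)"
  define cT where "cT = cosh (2 * t)"
  define R where "R = sinh (2 * (s + t))"
  define cR where "cR = cosh (2 * (s + t))"
  have R_eq: "R = S * cT + cS * T" by (simp add: R_def S_def T_def cS_def cT_def sinh_add distrib_left)
  have cR_eq: "cR = cS * cT + S * T" by (simp add: cR_def S_def T_def cS_def cT_def cosh_add distrib_left)
  have S: "0 < S" and T: "0 < T" and R: "0 < R" using s t by (simp_all add: S_def T_def R_def)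
  have cS: "cS\<^sup>2 = 1 + S\<^sup>2" and cT: "cT\<^sup>2 = 1 + T\<^sup>2" by (simp_all add: S_def T_def cS_def cT_def cosh_square_eq)
  define p where "p = cS / (2 * S) + cT / (2 * T)"
  have pR: "p = R / (2 * S * T)" using S T by (simp add: p_def R_eq field_simps)
  have p: "0 < p" using S T R by (simp add: pR)
  define a where "a = (u / (2 * S))\<^sup>2"
  define b where "b = (w / (2 * T))\<^sup>2"
  define K where "K = (1 / S * (2 * S) powr (- g) * exp (- (cS / (2 * S)) * u\<^sup>2)) * (1 / T * (2 * T) powr (- g) * exp (- (cT / (2 * T)) * w\<^sup>2))"
  let ?V = "p powr (- (g + 1)) / 2 * exp ((a + b) / p) * bessel_E g (a * b / p\<^sup>2)"
  have "?lhs
    = ennreal (K * ?V)"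
  proof (rule nn_integral_cmult_real)
    show "half_line_integral (\<lambda>y. y powr (2 * g + 1) * exp (- p * y\<^sup>2) * bessel_E g (a * y\<^sup>2) * bessel_E g (b * y\<^sup>2))
      = ennreal ?V"
      by (rule nn_integral_bessel_E_product) (use g p in \<open>auto simp: a_def b_def\<close>)
    fix v :: real
    have e: "exp (- (cS / (2 * S)) * v\<^sup>2) * exp (- (cT / (2 * T)) * v\<^sup>2) = exp (- p * v\<^sup>2)"
      by (simp add: exp_add[symmetric] p_def algebra_simps)
    have "v powr (2 * g + 1) * (lag1 g s u v * lag1 g t v w) = K * (v powr (2 * g + 1) * exp (- p * v\<^sup>2) * bessel_E g (a * v\<^sup>2) * bessel_E g (b * v\<^sup>2))" if "0 < v"
      unfolding lag1_sym[of g t v w] lag1_eq[OF g s u that] lag1_eq[OF g t w that] e[symmetric]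
      by (simp add: K_def a_def b_def S_def T_def cS_def cT_def mult_ac)
    then show "indicator {0<..} v * (v powr (2 * g + 1) * (lag1 g s u v * lag1 g t v w)) = K * (indicator {0<..} v * (v powr (2 * g + 1) * exp (- p * v\<^sup>2) * bessel_E g (a * v\<^sup>2) * bessel_E g (b * v\<^sup>2)))"
      by (auto simp: indicator_def)
  qed (use S T in \<open>simp_all add: K_def\<close>)
  also have "K * ?V = lag1 g (s + t) u w"
  proof -
    have st: "0 < s + t" using s t by simp
    have "p powr (- (g + 1)) = R powr (- (g + 1)) * (2 * S * T) powr (g + 1)"
      unfolding pR powr_divide powr_minus by (simp add: divide_inverse)
    moreover have "(2 * S) powr (- g) * (2 * T) powr (- g) * (2 * S * T) powr (g + 1) = 2 powr (- g) * (2 * S * T)"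
    proof -
      have "(2 * S) powr (- g) * (2 * T) powr (- g) = 2 powr (- g) * (2 * S * T) powr (- g)"
        using S T by (simp add: powr_mult mult_ac)
      moreover have "(2 * S * T) powr (- g) * (2 * S * T) powr (g + 1) = 2 * S * T"
        using S T by (simp add: powr_add[symmetric])
      ultimately show ?thesis by (simp only: mult.assoc)
    qed
    ultimately have "1 / S * (2 * S) powr (- g) * (1 / T * (2 * T) powr (- g)) * (p powr (- (g + 1)) / 2) = 1 / (S * T) * (2 powr (- g) * (2 * S * T)) * R powr (- (g + 1)) / 2"
      by (simp add: mult_ac)
    also have "\<dots> = 2 powr (- g) * R powr (- (g + 1))" using S T by simp
    also have "R powr (- (g + 1)) = 1 / R * R powr (- g)" using R by (simp add: powr_diff divide_inverse)
    also have "2 powr (- g) * (1 / R * R powr (- g)) = 1 / R * (2 * R) powr (- g)" using R by (simp add: powr_mult)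
    finally have 1: "1 / S * (2 * S) powr (- g) * (1 / T * (2 * T) powr (- g)) * (p powr (- (g + 1)) / 2) = 1 / R * (2 * R) powr (- g)" .
    \<comment> \<open>These two identities are the subtraction formula for \<open>sinh\<close>, with
      \<open>2 * t\<close> written as \<open>2 * (s + t) - 2 * s\<close>, and likewise with
      \<open>s\<close> and \<open>t\<close> exchanged.\<close>
    have c1: "cS * R - T = S * cR" 
      using cS unfolding R_eq cR_eq by algebra
    have c2: "cT * R - S = T * cR"
      using cT unfolding R_eq cR_eq by algebra
    have e1: "- (cS / (2 * S)) * u\<^sup>2 + a / p = - (cR / (2 * R)) * u\<^sup>2"
    proof -
      have "- (cS / (2 * S)) * u\<^sup>2 + a / p = - ((cS * R - T) / (2 * S * R)) * u\<^sup>2"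
        using S T R by (simp add: a_def pR power2_eq_square field_simps)
      then show ?thesis unfolding c1 using S by simp
    qed
    have e2: "- (cT / (2 * T)) * w\<^sup>2 + b / p = - (cR / (2 * R)) * w\<^sup>2"
    proof -
      have "- (cT / (2 * T)) * w\<^sup>2 + b / p = - ((cT * R - S) / (2 * T * R)) * w\<^sup>2"
        using S T R by (simp add: b_def pR power2_eq_square field_simps)
      then show ?thesis unfolding c2 using T by simp
    qed
    have 2: "exp (- (cS / (2 * S)) * u\<^sup>2) * exp (- (cT / (2 * T)) * w\<^sup>2) * exp ((a + b) / p) = exp (- (cR / (2 * R)) * u\<^sup>2) * exp (- (cR / (2 * R)) * w\<^sup>2)"
      unfolding exp_add[symmetric] e1[symmetric] e2[symmetric] by (simp add: add_divide_distrib algebra_simps)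
    have 3: "a * b / p\<^sup>2 = (u / (2 * R))\<^sup>2 * w\<^sup>2"
      using S T R by (simp add: a_def b_def pR power_divide power_mult_distrib field_simps)
    have "K * ?V 
      = (1 / S * (2 * S) powr (- g) * (1 / T * (2 * T) powr (- g)) * (p powr (- (g + 1)) / 2)) * (exp (- (cS / (2 * S)) * u\<^sup>2) * exp (- (cT / (2 * T)) * w\<^sup>2) * exp ((a + b) / p)) * bessel_E g (a * b / p\<^sup>2)"
      by (simp add: K_def)
    then show ?thesis
      unfolding 1 2 3 lag1_eq[OF g st u w] R_def cR_def by (simp only: mult.assoc)
  qed
  finally show ?thesis .
qed

section \<open>The mass of the modified one-dimensional kernel\<close>

text \<open>Up to a Beta constant this is \<open>sqrt w\<close> times Kummer's function 1F1 with
  parameters \<open>1/2\<close> and \<open>g + 1\<close> at \<open>- w\<close>. It is the part of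
  the mass in coordinate \<open>j\<close> that is not an elementary factor, and it depends on
  position and time through \<open>w\<close> alone.\<close>

definition lag_mass :: "real \<Rightarrow> real \<Rightarrow> ennreal" where
  "lag_mass g w = (\<integral>\<^sup>+v. ennreal (indicator {0<..<1} v * (sqrt (w / pi) * exp (- w * v) * v powr (- 1 / 2) * (1 - v) powr (g - 1 / 2))) \<partial>lborel)"

text \<open>Kummer's transformation. Each quotient of Gamma values is a Beta integral with
  parameters \<open>1/2\<close> and \<open>g + 1/2 + k\<close>; summing under the integral produces
  \<open>exp (w * (1 - v))\<close>. The assumption on \<open>g\<close> makes the first of these
  integrals converge at \<open>v = 1\<close>.\<close>

lemma suminf_Beta_exp:
  assumes g: "- 1 / 2 < g" and w: "0 \<le> w"
  shows "(\<Sum>k. ennreal (w ^ k / fact k * (rGamma (real k + g + 1) * Gamma (g + 1 / 2 + real k))))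
    = ennreal (exp w / sqrt pi) * (\<integral>\<^sup>+v. ennreal (indicator {0<..<1} v * (exp (- w * v) * v powr (- 1 / 2) * (1 - v) powr (g - 1 / 2))) \<partial>lborel)"
proof -
  let ?h = "\<lambda>k v. indicator {0<..<1} v * (v powr (1 / 2 - 1) * (1 - v) powr (g + 1 / 2 + real k - 1))"
  let ?f = "\<lambda>v. exp (- w * v) * v powr (- 1 / 2) * (1 - v) powr (g - 1 / 2)"
  let ?c = "\<lambda>k. w ^ k / fact k * (rGamma (real k + g + 1) * Gamma (g + 1 / 2 + real k))"
  let ?d = "\<lambda>k. w ^ k / fact k * (1 / sqrt pi)"
  have B: "rGamma (real k + g + 1) * Gamma (g + 1 / 2 + real k) = 1 / sqrt pi * Beta (1 / 2) (g + 1 / 2 + real k)" for k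
  proof -
    have "Beta (1 / 2) (g + 1 / 2 + real k) = sqrt pi * Gamma (g + 1 / 2 + real k) * rGamma (real k + g + 1)"
    proof -
      have "1 / 2 + (g + 1 / 2 + real k) = real k + g + 1" by simp
      then show ?thesis
        unfolding Beta_def rGamma_inverse_Gamma by (simp only: Gamma_one_half_real divide_inverse[of _ "Gamma (real k + g + 1)"])
    qed
    then show ?thesis by simp
  qed
  have "(\<Sum>k. ennreal (?c k))
    = (\<Sum>k. \<integral>\<^sup>+v. ennreal (?d k) * ennreal (?h k v) \<partial>lborel)"
  proof (intro suminf_cong)
    fix k
    have n: "0 \<le> w ^ k / fact k * (1 / sqrt pi)" using w by simp
    have "ennreal (?c k)
      = ennreal (?d k) * ennreal (Beta (1 / 2) (g + 1 / 2 + real k))"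
      unfolding B ennreal_mult'[OF n, symmetric] by (simp only: mult.assoc)
    also have "ennreal (Beta (1 / 2) (g + 1 / 2 + real k)) = (\<integral>\<^sup>+v. ennreal (?h k v) \<partial>lborel)"
      using g by (intro nn_integral_Beta_real[symmetric]) auto
    finally show "ennreal (?c k)
      = (\<integral>\<^sup>+v. ennreal (?d k) * ennreal (?h k v) \<partial>lborel)"
      by (subst nn_integral_cmult) auto
  qed
  also have "\<dots> = (\<integral>\<^sup>+v. (\<Sum>k. ennreal (?d k) * ennreal (?h k v)) \<partial>lborel)"
    by (rule nn_integral_suminf[symmetric]) measurable
  also have "\<dots> = (\<integral>\<^sup>+v. ennreal (exp w / sqrt pi) * ennreal (indicator {0<..<1} v * (?f v)) \<partial>lborel)"
  proof (intro nn_integral_cong)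
    fix v :: real
    show "(\<Sum>k. ennreal (?d k) * ennreal (?h k v))
      = ennreal (exp w / sqrt pi) * ennreal (indicator {0<..<1} v * (?f v))"
    proof (cases "0 < v \<and> v < 1")
      case True
      define b where "b = 1 / sqrt pi * (v powr (- 1 / 2) * (1 - v) powr (g - 1 / 2))"
      have b: "0 \<le> b" using w by (simp add: b_def)
      have "(\<Sum>k. ennreal (?d k) * ennreal (?h k v))
        = (\<Sum>k. ennreal b * ennreal ((w * (1 - v)) ^ k / fact k))"
      proof (intro suminf_cong)
        fix k
        have n: "0 \<le> w ^ k / fact k * (1 / sqrt pi)" using w by simp
        have "(1 - v) powr (g + 1 / 2 + real k - 1) = (1 - v) powr ((g - 1 / 2) + real k)" by (simp add: algebra_simps)
        also have "\<dots> = (1 - v) powr (g - 1 / 2) * (1 - v) ^ k"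
          using True by (simp only: powr_add) (simp add: powr_realpow)
        finally have pw: "(1 - v) powr (g + 1 / 2 + real k - 1) = (1 - v) powr (g - 1 / 2) * (1 - v) ^ k" .
        have hh: "(1 / 2 - 1 :: real) = - 1 / 2" by simp
        have "w ^ k / fact k * (1 / sqrt pi) * (?h k v)
          = b * ((w * (1 - v)) ^ k / fact k)"
          unfolding pw b_def hh using True by (simp add: power_mult_distrib mult_ac)
        then show "ennreal (?d k) * ennreal (?h k v)
          = ennreal b * ennreal ((w * (1 - v)) ^ k / fact k)"
          by (simp only: ennreal_mult'[OF n, symmetric] ennreal_mult'[OF b, symmetric])
      qed
      also have "\<dots> = ennreal b * ennreal (exp (w * (1 - v)))"
        using True w by (subst ennreal_exp) auto
      also have "\<dots> = ennreal (b * exp (w * (1 - v)))" by (simp only: ennreal_mult'[OF b])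
      also have "b * exp (w * (1 - v)) = (exp w / sqrt pi) * (?f v)"
      proof -
        have "exp (w * (1 - v)) = exp w * exp (- w * v)" by (simp add: exp_add[symmetric] algebra_simps)
        then show ?thesis by (simp only: b_def) simp
      qed
      finally show ?thesis using True by (subst ennreal_mult'[symmetric]) auto
    qed auto
  qed
  also have "\<dots> = ennreal (exp w / sqrt pi) * (\<integral>\<^sup>+v. ennreal (indicator {0<..<1} v * (?f v)) \<partial>lborel)"
    by (rule nn_integral_cmult) measurable
  finally show ?thesis .
qed

text \<open>With \<open>g = \<alpha> $ j + 1\<close> the exponent \<open>2 * g - 1\<close> is that
  of the measure in coordinate \<open>j\<close>. The factor \<open>v\<close> of the modified kernel
  raises it to \<open>2 * g\<close> only, so the moments are \<open>Gamma (g + 1/2 + k)\<close>: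
  they no longer cancel the Bessel coefficients, and a confluent series replaces the exponential
  one.\<close>

lemma lag1_mass:
  fixes t u g :: real
  defines "s \<equiv> sinh (2 * t)" and "c \<equiv> cosh (2 * t)"
  assumes g: "- 1 / 2 < g" and t: "0 < t" and u: "0 < u"
  shows "half_line_integral (\<lambda>v. v powr (2 * g - 1) * (u * v * lag1 g t u v))
    = ennreal (c powr (- g) * exp (- (u\<^sup>2 / (2 * s * c)) * s\<^sup>2)) * lag_mass g (u\<^sup>2 / (2 * s * c))" (is "?lhs = _")
proof -
  have s: "0 < s" using t by (simp add: s_def)
  have c: "0 < c" by (simp add: c_def)
  have cs: "c\<^sup>2 = 1 + s\<^sup>2" by (simp add: c_def s_def cosh_square_eq)
  define p where "p = c / (2 * s)"
  have p: "0 < p" using c s by (simp add: p_def)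
  define a where "a = (u / (2 * s))\<^sup>2"
  define w where "w = u\<^sup>2 / (2 * s * c)"
  have w: "0 < w" using u s c by (simp add: w_def)
  have ap: "a / p = w" using s c by (simp add: a_def p_def w_def power2_eq_square field_simps)
  define K where "K = u * (1 / s * (2 * s) powr (- g) * exp (- (c / (2 * s)) * u\<^sup>2))"
  have K: "0 \<le> K" using s u by (simp add: K_def)
  define P where "P = p powr (- (g + 1 / 2)) / 2"
  let ?h = "\<lambda>v. v powr (2 * (g + 1 / 2) - 1) * exp (- p * v\<^sup>2) * bessel_E g (a * v\<^sup>2)"
  let ?c = "\<lambda>k. w ^ k / fact k * (rGamma (real k + g + 1) * Gamma (g + 1 / 2 + real k))"
  let ?l = "\<lambda>v. v powr (2 * g - 1) * (u * v * lag1 g t u v)"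
  let ?G = "\<lambda>k. Gamma (g + 1 / 2 + real k) * p powr (- (g + 1 / 2 + real k)) / 2"
  have P: "0 \<le> P" by (simp add: P_def)
  have g1: "- 1 < g" using g by simp
  have m: "0 < g + 1 / 2" using g by simp
  have a: "0 \<le> a" by (simp add: a_def)
  have "?lhs
    = (\<integral>\<^sup>+v. ennreal K * ennreal (indicator {0<..} v * (?h v)) \<partial>lborel)"
  proof (intro nn_integral_cong)
    fix v :: real
    have "v powr (2 * g - 1) * (u * v * lag1 g t u v) = K * (?h v)" if v: "0 < v"
    proof -
      have "v powr (2 * (g + 1 / 2) - 1) = v powr (2 * g - 1) * v"
        using powr_mult_base[of v "2 * g - 1"] v by (simp add: mult.commute)
      then show ?thesis
        using lag1_eq[OF g1 t u v] by (simp add: K_def a_def p_def s_def c_def mult_ac)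
    qed
    then have "indicator {0<..} v * (?l v) = K * (indicator {0<..} v * (?h v))"
      by (auto simp: indicator_def)
    then show "ennreal (indicator {0<..} v * (?l v)) = ennreal K * ennreal (indicator {0<..} v * (?h v))"
      by (simp only: ennreal_mult'[OF K, symmetric])
  qed
  also have "\<dots> = ennreal K * half_line_integral (\<lambda>v. ?h v)"
    by (rule nn_integral_cmult) measurable
  also have "half_line_integral (\<lambda>v. ?h v)
    = (\<Sum>k. ennreal (rGamma (real k + g + 1) / fact k * a ^ k * (?G k)))"
    by (rule nn_integral_bessel_E_weighted[OF g1 p m a])
  also have "\<dots> = (\<Sum>k. ennreal P * ennreal (?c k))"
  proof (intro suminf_cong)
    fix k
    have "- (g + 1 / 2 + real k) = - (g + 1 / 2) - real k" by simp
    then have "p powr (- (g + 1 / 2 + real k)) = p powr (- (g + 1 / 2)) / p ^ k"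
      by (simp only: powr_diff powr_realpow[OF p])
    then have "rGamma (real k + g + 1) / fact k * a ^ k * (?G k)
      = P * (?c k)"
      unfolding ap[symmetric] by (simp add: P_def power_divide mult_ac)
    then show "ennreal (rGamma (real k + g + 1) / fact k * a ^ k * (?G k))
      = ennreal P * ennreal (?c k)"
      by (simp only: ennreal_mult'[OF P, symmetric])
  qed
  also have "\<dots> = ennreal P * (ennreal (exp w / sqrt pi) * (\<integral>\<^sup>+v. ennreal (indicator {0<..<1} v * (exp (- w * v) * v powr (- 1 / 2) * (1 - v) powr (g - 1 / 2))) \<partial>lborel))" (is "_ = _ * (_ * ?I)")
    using g w by (subst suminf_Beta_exp[symmetric]) auto
  also have "ennreal K * (ennreal P * (ennreal (exp w / sqrt pi) * ?I)) = ennreal (K * (P * (exp w / sqrt pi))) * ?I"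
    by (simp only: ennreal_mult'[OF K] ennreal_mult'[OF P] mult.assoc)
  also have "K * (P * (exp w / sqrt pi)) = c powr (- g) * exp (- w * s\<^sup>2) * sqrt (w / pi)"
  proof -
    have "(c / (2 * s)) powr (- m) = c powr (- m) * (2 * s) powr m" for m
      unfolding powr_divide by (simp add: powr_minus_divide)
    then have 1: "p powr (- (g + 1 / 2)) = c powr (- (g + 1 / 2)) * (2 * s) powr (g + 1 / 2)"
      unfolding p_def .
    have 2: "(2 * s) powr (- g) * (2 * s) powr (g + 1 / 2) = sqrt (2 * s)"
      using s by (simp add: powr_add[symmetric] powr_half_sqrt)
    have 3: "c powr (- (g + 1 / 2)) = c powr (- g) / sqrt c"
      using c by (simp add: powr_diff powr_half_sqrt)
    have sq: "sqrt w = u / (sqrt (2 * s) * sqrt c)"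
      using u by (simp add: w_def real_sqrt_divide real_sqrt_mult)
    have "u / s * ((2 * s) powr (- g) * p powr (- (g + 1 / 2)) / 2) = u / (2 * s) * c powr (- g) / sqrt c * sqrt (2 * s)"
      unfolding 1 3 2[symmetric] by (simp add: field_simps)
    also have "\<dots> = c powr (- g) * (u / (sqrt (2 * s) * sqrt c))"
    proof -
      have h: "1 / (2 * s) * sqrt (2 * s) = 1 / sqrt (2 * s)" using s by (simp add: real_div_sqrt divide_simps)
      have "u / (2 * s) * c powr (- g) / sqrt c * sqrt (2 * s) = u * c powr (- g) / sqrt c * (1 / (2 * s) * sqrt (2 * s))" by simp
      also have "\<dots> = c powr (- g) * (u / (sqrt (2 * s) * sqrt c))" unfolding h by (simp add: mult_ac)
      finally show ?thesis .
    qed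
    finally have 4: "u / s * ((2 * s) powr (- g) * p powr (- (g + 1 / 2)) / 2) = c powr (- g) * sqrt w" unfolding sq .
    have "c / (2 * s) * u\<^sup>2 = w * c\<^sup>2" using s c by (simp add: w_def power2_eq_square)
    then have "- (c / (2 * s)) * u\<^sup>2 + w = - w * s\<^sup>2" unfolding cs by (simp add: algebra_simps)
    then have 5: "exp (- (c / (2 * s)) * u\<^sup>2) * exp w = exp (- w * s\<^sup>2)" by (simp only: exp_add[symmetric])
    have "K * (P * (exp w / sqrt pi)) = (u / s * ((2 * s) powr (- g) * p powr (- (g + 1 / 2)) / 2)) * (exp (- (c / (2 * s)) * u\<^sup>2) * exp w) / sqrt pi"
      by (simp add: K_def P_def mult_ac)
    then show ?thesis unfolding 4 5 by (simp add: real_sqrt_divide)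
  qed
  also have "ennreal (c powr (- g) * exp (- w * s\<^sup>2) * sqrt (w / pi)) * ?I = ennreal (c powr (- g) * exp (- w * s\<^sup>2)) * (ennreal (sqrt (w / pi)) * ?I)"
    by (subst ennreal_mult') (simp_all add: mult.assoc)
  also have "ennreal (sqrt (w / pi)) * ?I = lag_mass g w"
    unfolding lag_mass_def
    by (subst nn_integral_cmult[symmetric], measurable, intro nn_integral_cong)
       (use w in \<open>simp add: ennreal_mult'[symmetric] mult_ac\<close>)
  finally show ?thesis by (simp add: w_def)
qed

section \<open>Upper and lower bounds for the normalised mass\<close>

lemma nn_integral_lag_mass_weight:
  assumes w: "0 < w"
  shows "half_line_integral (\<lambda>v. sqrt (w / pi) * exp (- w * v) * v powr (- 1 / 2)) = 1" (is "?lhs = _")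
proof -
  have "?lhs = ennreal (sqrt (w / pi) * (Gamma (1 / 2) * w powr (- (1 / 2))))"
  proof (rule nn_integral_cmult_real)
    show "half_line_integral (\<lambda>v. v powr (1 / 2 - 1) * exp (- w * v)) = ennreal (Gamma (1 / 2) * w powr (- (1 / 2)))"
      using w by (intro nn_integral_powr_exp_neg) auto
  qed (use w in auto)
  also have "sqrt (w / pi) * (Gamma (1 / 2) * w powr (- (1 / 2))) = 1"
    using w by (simp add: Gamma_one_half_real real_sqrt_divide powr_minus powr_half_sqrt)
  finally show ?thesis by simp
qed

lemma lag_mass_le_1:
  assumes w: "0 < w" and g: "1 / 2 \<le> g"
  shows "lag_mass g w \<le> 1"
  unfolding nn_integral_lag_mass_weight[OF w, symmetric] lag_mass_def
proof (intro nn_integral_mono ennreal_leI)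
  fix v :: real
  have "(1 - v) powr (g - 1 / 2) \<le> 1" if "0 < v" "v < 1" using that g by (intro powr_le1) auto
  then show "indicator {0<..<1} v * (sqrt (w / pi) * exp (- w * v) * v powr (- 1 / 2) * (1 - v) powr (g - 1 / 2)) \<le> indicator {0<..} v * (sqrt (w / pi) * exp (- w * v) * v powr (- 1 / 2))"
    using w by (auto simp: indicator_def intro!: mult_left_le)
qed

text \<open>For \<open>v < 1/2\<close> the factor \<open>(1 - v) powr (g - 1/2)\<close> is at most 2
  and the rest has total mass 1; for \<open>v \<ge> 1/2\<close> the rest is at most 2 and the factor
  integrates to \<open>Beta 1 (g + 1/2)\<close>. This is the origin of the constant.\<close>

lemma lag_mass_bounded:
  assumes w: "0 < w" and g: "- 1 / 2 < g"
  shows "lag_mass g w \<le> ennreal (2 + 2 * Beta 1 (g + 1 / 2))"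
proof -
  let ?h = "\<lambda>v. indicator {0<..} v * (sqrt (w / pi) * exp (- w * v) * v powr (- 1 / 2))"
  let ?k = "\<lambda>v. indicator {0<..<1} v * (v powr (1 - 1) * (1 - v) powr (g + 1 / 2 - 1))"
  have "lag_mass g w \<le> (\<integral>\<^sup>+v. ennreal 2 * ennreal (?h v) + ennreal 2 * ennreal (?k v) \<partial>lborel)"
    unfolding lag_mass_def
  proof (intro nn_integral_mono)
    fix v :: real
    show "ennreal (indicator {0<..<1} v * (sqrt (w / pi) * exp (- w * v) * v powr (- 1 / 2) * (1 - v) powr (g - 1 / 2)))
      \<le> ennreal 2 * ennreal (?h v) + ennreal 2 * ennreal (?k v)"
    proof (cases "0 < v \<and> v < 1")
      case True
      define J where "J = sqrt (w / pi) * exp (- w * v) * v powr (- 1 / 2)"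
      have J: "0 \<le> J" using w by (simp add: J_def)
      have eq: "ennreal 2 * ennreal J + ennreal 2 * ennreal ((1 - v) powr (g - 1 / 2)) = ennreal (2 * J + 2 * (1 - v) powr (g - 1 / 2))"
        using J by (simp add: ennreal_mult')
      have "J * (1 - v) powr (g - 1 / 2) \<le> 2 * J + 2 * (1 - v) powr (g - 1 / 2)"
      proof (cases "v < 1 / 2")
        case v: True
        have "(1 - v) powr (g - 1 / 2) \<le> 2"
        proof (cases "1 / 2 \<le> g")
          case gh: True
          then have "(1 - v) powr (g - 1 / 2) \<le> 1" using True by (intro powr_le1) auto
          then show ?thesis by simp
        next
          case gh: False
          have "(1 - v) powr (g - 1 / 2) \<le> (1 / 2) powr (g - 1 / 2)"
            using gh v by (intro powr_mono2') auto
          also have "\<dots> = 2 powr (1 / 2 - g)"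
            by (simp add: powr_divide powr_minus[symmetric] powr_diff)
          also have "\<dots> \<le> 2 powr 1" using g by (intro powr_mono) auto
          finally show ?thesis by simp
        qed
        then have "J * (1 - v) powr (g - 1 / 2) \<le> J * 2" using J by (rule mult_left_mono)
        moreover have "0 \<le> 2 * (1 - v) powr (g - 1 / 2)" by simp
        ultimately show ?thesis by linarith
      next
        case v: False
        \<comment> \<open>Away from 0 the weight is at most \<open>sqrt w * exp (- w / 2)\<close>,
          which is bounded uniformly in \<open>w\<close>.\<close>
        have "J \<le> 2"
        proof -
          have "w * v \<ge> w * (1 / 2)" using v w by (intro mult_left_mono) auto
          then have "exp (- w * v) \<le> exp (- w / 2)" by simp
          moreover have "v powr (- 1 / 2) \<le> (1 / 2) powr (- 1 / 2)" using v by (intro powr_mono2') auto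
          moreover have "(1 / 2) powr (- 1 / 2) = sqrt (2 :: real)"
            by (simp add: powr_divide powr_minus powr_half_sqrt)
          ultimately have "exp (- w * v) * v powr (- 1 / 2) \<le> exp (- w / 2) * sqrt 2" by (intro mult_mono) auto
          then have "sqrt (w / pi) * (exp (- w * v) * v powr (- 1 / 2)) \<le> sqrt (w / pi) * (exp (- w / 2) * sqrt 2)"
            using w by (intro mult_left_mono) auto
          also have "\<dots> = sqrt (w * 2 / pi) * exp (- w / 2)" by (simp add: real_sqrt_mult real_sqrt_divide)
          also have "\<dots> \<le> sqrt w * exp (- w / 2)"
          proof (intro mult_right_mono real_sqrt_le_mono)
            have "w * (2 / pi) \<le> w * 1" using w pi_ge_two by (intro mult_left_mono) auto
            then show "w * 2 / pi \<le> w" by simp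
          qed simp
          also have "\<dots> \<le> 1"
          proof -
            have "w \<le> exp w" using exp_ge_add_one_self[of w] by linarith
            then have "sqrt w \<le> sqrt (exp w)" by simp
            also have "sqrt (exp w) = exp (w / 2)" by (rule real_sqrt_unique) (simp_all add: power2_eq_square exp_add[symmetric])
            finally have "sqrt w * exp (- w / 2) \<le> exp (w / 2) * exp (- w / 2)" by (intro mult_right_mono) auto
            then show ?thesis by (simp add: exp_add[symmetric])
          qed
          finally show ?thesis by (simp add: J_def mult_ac)
        qed
        then have "J * (1 - v) powr (g - 1 / 2) \<le> 2 * (1 - v) powr (g - 1 / 2)" by (intro mult_right_mono) auto
        then show ?thesis using J by linarith
      qed
      then have "ennreal (J * (1 - v) powr (g - 1 / 2)) \<le> ennreal 2 * ennreal J + ennreal 2 * ennreal ((1 - v) powr (g - 1 / 2))"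
        unfolding eq by (rule ennreal_leI)
      then show ?thesis using True by (simp add: J_def)
    qed auto
  qed
  also have "\<dots> = ennreal 2 * (\<integral>\<^sup>+v. ennreal (?h v) \<partial>lborel) + ennreal 2 * (\<integral>\<^sup>+v. ennreal (?k v) \<partial>lborel)"
    by (subst nn_integral_add) (auto simp: nn_integral_cmult)
  also have "\<dots> = ennreal 2 * 1 + ennreal 2 * ennreal (Beta 1 (g + 1 / 2))"
    using g by (simp only: nn_integral_lag_mass_weight[OF w]) (subst nn_integral_Beta_real, auto)
  also have "\<dots> = ennreal (2 + 2 * Beta 1 (g + 1 / 2))"
  proof -
    have "0 \<le> Beta 1 (g + 1 / 2)" using g by (auto simp: Beta_def Gamma_real_nonneg)
    then show ?thesis by (simp add: ennreal_mult)
  qed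
  finally show ?thesis .
qed

text \<open>The substitution weight is the Gamma density of total mass 1; replacing \<open>(1 - v) powr (- a)\<close> by
  \<open>1 + a * v\<close> gains a term of order \<open>1 / w\<close>, whereas truncation at 1 loses only an exponentially small one.\<close>

lemma lag_mass_ge:
  assumes g: "- 1 / 2 < g" "g < 1 / 2" and w: "1 < w" and we: "16 * exp 1 * (w * exp (- w / 2)) \<le> 1 / 2 - g"
  shows "ennreal (1 + (1 / 2 - g) * sqrt (w / pi) / (8 * exp 1 * w\<^sup>2)) \<le> lag_mass g w"
proof -
  define a where "a = 1 / 2 - g"
  have a: "0 < a" "a < 1" using g by (auto simp: a_def)
  define J where "J = (\<lambda>v. sqrt (w / pi) * exp (- w * v) * v powr (- 1 / 2))"
  let ?A = "\<integral>\<^sup>+v. ennreal (indicator {0<..<1} v * (a * v * J v)) \<partial>lborel"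
  let ?B = "\<integral>\<^sup>+v. ennreal (indicator {0<..<1} v * J v) \<partial>lborel"
  let ?C = "\<integral>\<^sup>+v. ennreal (indicator {1..} v * J v) \<partial>lborel"
  let ?f = "\<lambda>v. v powr (1 - 1) * exp (- (w / 2) * v)"
  let ?k = "a * sqrt (w / pi) * (exp (- 1) * (1 / (2 * w)))"
  have J0: "0 \<le> J v" for v using w by (simp add: J_def)
  have [measurable]: "J \<in> borel_measurable borel" unfolding J_def by measurable
  define gain where "gain = a * sqrt (w / pi) / (4 * exp 1 * w\<^sup>2)"
  have gain0: "0 \<le> gain" using a w by (simp add: gain_def)
  \<comment> \<open>Half of the exponent is frozen at its value for \<open>v = 1\<close>, the other
    half is integrated over the half line. Hypothesis \<open>we\<close> says precisely that the
    result is at most \<open>gain / 2\<close>.\<close>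
  have tail: "?C \<le> ennreal (gain / 2)"
  proof -
    have "?C 
      \<le> (\<integral>\<^sup>+v. ennreal (sqrt (w / pi) * exp (- w / 2) * (indicator {0<..} v * (?f v))) \<partial>lborel)"
    proof (intro nn_integral_mono ennreal_leI)
      fix v :: real
      show "indicator {1..} v * J v \<le> sqrt (w / pi) * exp (- w / 2) * (indicator {0<..} v * (?f v))"
      proof (cases "1 \<le> v")
        case True
        have "v powr (- 1 / 2) \<le> 1 powr (- 1 / 2)" using True by (intro powr_mono2') auto
        then have 1: "v powr (- 1 / 2) \<le> 1" by simp
        have "w / 2 * 1 \<le> w / 2 * v" using True w by (intro mult_left_mono) auto
        then have "- w * v \<le> - w / 2 + - (w / 2) * v" by simp
        then have 2: "exp (- w * v) \<le> exp (- w / 2) * exp (- (w / 2) * v)" by (simp only: exp_add[symmetric] exp_le_cancel_iff)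
        have "exp (- w * v) * v powr (- 1 / 2) \<le> exp (- w / 2) * exp (- (w / 2) * v) * 1"
          using 1 2 by (intro mult_mono) auto
        then have "sqrt (w / pi) * (exp (- w * v) * v powr (- 1 / 2)) \<le> sqrt (w / pi) * (exp (- w / 2) * exp (- (w / 2) * v) * 1)"
          using w by (intro mult_left_mono) auto
        then show ?thesis using True by (simp add: J_def mult_ac)
      qed (use w in simp)
    qed
    also have "\<dots> = ennreal (sqrt (w / pi) * exp (- w / 2) * (Gamma 1 * (w / 2) powr (- 1)))"
    proof (rule nn_integral_cmult_real)
      show "half_line_integral (\<lambda>v. v powr (1 - 1) * exp (- (w / 2) * v)) = ennreal (Gamma 1 * (w / 2) powr (- 1))"
        using w by (intro nn_integral_powr_exp_neg) auto
    qed (use w in auto)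
    also have "sqrt (w / pi) * exp (- w / 2) * (Gamma 1 * (w / 2) powr (- 1)) = sqrt (w / pi) / (8 * exp 1 * w\<^sup>2) * (16 * exp 1 * (w * exp (- w / 2)))"
      using w by (simp add: powr_minus power2_eq_square field_simps)
    also have "\<dots> \<le> sqrt (w / pi) / (8 * exp 1 * w\<^sup>2) * a"
      using we w by (intro mult_left_mono) (auto simp: a_def)
    also have "\<dots> = gain / 2" by (simp add: gain_def mult_ac)
    finally show ?thesis by (simp add: ennreal_leI)
  qed
  \<comment> \<open>Only the interval from \<open>1 / (2 * w)\<close> to \<open>1 / w\<close> is
    kept. There \<open>exp (- w * v)\<close> is at least \<open>exp (- 1)\<close> and
    \<open>v * v powr (- 1/2)\<close> is at least \<open>1 / (2 * w)\<close>; multiplying by the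
    length \<open>1 / (2 * w)\<close> gives the factor \<open>1 / (4 * exp 1 * w\<^sup>2)\<close> in
    \<open>gain\<close>.\<close>
  have gain: "ennreal gain \<le> ?A"
  proof -
    have iv: "1 / (2 * w) \<le> 1 / w" using w by (simp add: field_simps)
    have "ennreal gain = ennreal ?k * emeasure lborel {1 / (2 * w)..1 / w}"
      using w a iv by (simp add: gain_def ennreal_mult'[symmetric] exp_minus power2_eq_square field_simps)
    also have "\<dots> = (\<integral>\<^sup>+v. ennreal ?k * indicator {1 / (2 * w)..1 / w} v \<partial>lborel)"
      by (simp add: nn_integral_cmult_indicator)
    also have "\<dots> \<le> ?A"
    proof (intro nn_integral_mono)
      fix v :: real
      show "ennreal ?k * indicator {1 / (2 * w)..1 / w} v \<le> ennreal (indicator {0<..<1} v * (a * v * J v))"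
      proof (cases "v \<in> {1 / (2 * w)..1 / w}")
        case True
        have "0 < 1 / (2 * w)" "1 / w < 1" using w by auto
        then have v: "0 < v" "v < 1" using True unfolding atLeastAtMost_iff by linarith+
        have "v * w \<le> 1" using True w by (simp add: field_simps)
        then have 1: "exp (- 1) \<le> exp (- w * v)" by (simp add: mult.commute)
        have "v = v powr 1" using v by simp
        also have "\<dots> \<le> v powr (1 / 2)" using v by (intro powr_mono') auto
        also have "\<dots> = v * v powr (- 1 / 2)" using v powr_mult_base[of v "- 1 / 2"] by simp
        finally have 2: "1 / (2 * w) \<le> v * v powr (- 1 / 2)" using True by auto
        have "exp (- 1) * (1 / (2 * w)) \<le> exp (- w * v) * (v * v powr (- 1 / 2))"
          using 1 2 w by (intro mult_mono) auto
        then have "a * sqrt (w / pi) * (exp (- 1) * (1 / (2 * w))) \<le> a * sqrt (w / pi) * (exp (- w * v) * (v * v powr (- 1 / 2)))"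
          using a w by (intro mult_left_mono) auto
        then show ?thesis using True v by (simp add: J_def mult_ac ennreal_leI)
      qed simp
    qed
    finally show ?thesis .
  qed
  have one: "1 \<le> ?B + ?C"
  proof -
    have "1 = half_line_integral (\<lambda>v. J v)"
      using nn_integral_lag_mass_weight[of w] w by (simp add: J_def)
    also have "\<dots> \<le> (\<integral>\<^sup>+v. ennreal (indicator {0<..<1} v * J v) + ennreal (indicator {1..} v * J v) \<partial>lborel)"
      by (intro nn_integral_mono) (auto simp: indicator_def)
    also have "\<dots> = ?B + ?C"
      by (rule nn_integral_add) measurable
    finally show ?thesis .
  qed
  have low: "?B + ?A \<le> lag_mass g w"
  proof -
    have "?B + ?A
      = (\<integral>\<^sup>+v. ennreal (indicator {0<..<1} v * J v) + ennreal (indicator {0<..<1} v * (a * v * J v)) \<partial>lborel)"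
      by (rule nn_integral_add[symmetric]) measurable
    also have "\<dots> \<le> lag_mass g w"
      unfolding lag_mass_def
    proof (intro nn_integral_mono)
      fix v :: real
      show "ennreal (indicator {0<..<1} v * J v) + ennreal (indicator {0<..<1} v * (a * v * J v))
        \<le> ennreal (indicator {0<..<1} v * (sqrt (w / pi) * exp (- w * v) * v powr (- 1 / 2) * (1 - v) powr (g - 1 / 2)))"
      proof (cases "0 < v \<and> v < 1")
        case True
        have "ln (1 - v) \<le> - v" using True ln_le_minus_one[of "1 - v"] by simp
        then have "a * v \<le> a * (- ln (1 - v))" using a by (intro mult_left_mono) auto
        then have "1 + a * v \<le> 1 + a * (- ln (1 - v))" by simp
        also have "\<dots> \<le> exp (a * (- ln (1 - v)))" by (rule exp_ge_add_one_self)
        also have "\<dots> = (1 - v) powr (g - 1 / 2)" using True by (simp add: powr_def a_def algebra_simps)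
        finally have "J v * (1 + a * v) \<le> J v * (1 - v) powr (g - 1 / 2)" using J0 by (rule mult_left_mono)
        then have "ennreal (J v + a * v * J v) \<le> ennreal (J v * (1 - v) powr (g - 1 / 2))"
          by (intro ennreal_leI) (simp add: algebra_simps)
        moreover have "ennreal (J v + a * v * J v) = ennreal (J v) + ennreal (a * v * J v)"
          using J0[of v] a True by (intro ennreal_plus) auto
        ultimately show ?thesis using True by (simp add: J_def)
      qed auto
    qed
    finally show ?thesis .
  qed
  have "1 + ennreal gain \<le> lag_mass g w + ennreal (gain / 2)"
  proof -
    have "1 + ennreal gain \<le> (?B + ennreal (gain / 2)) + ?A"
      by (intro add_mono gain order_trans[OF one] tail order_refl)
    also have "\<dots> \<le> lag_mass g w + ennreal (gain / 2)"
      using add_right_mono[OF low, of "ennreal (gain / 2)"] by (simp add: add_ac)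
    finally show ?thesis .
  qed
  \<comment> \<open>The cancellation of \<open>gain / 2\<close> is made in the reals; for infinite
    mass the claim is trivial.\<close>
  then have "ennreal (1 + gain / 2) \<le> lag_mass g w"
  proof (cases "lag_mass g w")
    case (real m)
    then have "ennreal (1 + gain) \<le> ennreal (m + gain / 2)"
      using \<open>1 + ennreal gain \<le> lag_mass g w + ennreal (gain / 2)\<close> gain0
      by (simp add: ennreal_plus)
    then have "1 + gain \<le> m + gain / 2" using real gain0 by (simp add: ennreal_le_iff del: ennreal_plus)
    then show ?thesis using real by (simp add: ennreal_leI)
  qed simp
  then show ?thesis by (simp add: gain_def a_def mult.assoc)
qed

text \<open>An excess \<open>d\<close> uniform on a whole window of \<open>w\<close> is what is
  needed later: the points violating contractivity must fill an open set, and the excess must not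
  depend on \<open>t\<close>.\<close>

lemma lag_mass_greater_1:
  assumes g: "- 1 / 2 < g" "g < 1 / 2"
  obtains w0 d where "1 < w0" "0 < d" "\<And>w. w0 \<le> w \<Longrightarrow> w \<le> w0 + 1 \<Longrightarrow> ennreal (1 + d) \<le> lag_mass g w"
proof -
  define a where "a = 1 / 2 - g"
  have a: "0 < a" using g by (simp add: a_def)
  \<comment> \<open>From \<open>w\<^sup>2 * exp (- w / 2) \<le> 16\<close> the smallness condition
    of \<open>lag_mass_ge\<close> follows as soon as \<open>256 * exp 1 \<le> a * w\<close>.\<close>
  define w0 where "w0 = 2 + 256 * exp 1 / a"
  have w0: "1 < w0" using a by (simp add: w0_def add_pos_nonneg)
  \<comment> \<open>The excess of \<open>lag_mass_ge\<close> with \<open>w\<close> replaced by 1 in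
    the numerator and by \<open>w0 + 1\<close> in the denominator, hence a lower bound on the whole
    window.\<close>
  define d where "d = a * sqrt (1 / pi) / (8 * exp 1 * (w0 + 1)\<^sup>2)"
  have d: "0 < d" using a w0 by (simp add: d_def)
  have "ennreal (1 + d) \<le> lag_mass g w" if w: "w0 \<le> w" "w \<le> w0 + 1" for w
  proof -
    have w1: "1 < w" using w w0 by simp
    have "w / 4 \<le> exp (w / 4)" using exp_ge_add_one_self[of "w / 4"] by linarith
    then have "(w / 4) * (w / 4) \<le> exp (w / 4) * exp (w / 4)" using w1 by (intro mult_mono) auto
    then have "w * w \<le> 16 * exp (w / 2)" by (simp add: exp_add[symmetric])
    then have "w * w * exp (- w / 2) \<le> 16 * exp (w / 2) * exp (- w / 2)" by (intro mult_right_mono) auto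
    moreover have "exp (w / 2) * exp (- w / 2) = 1" by (simp add: exp_add[symmetric])
    ultimately have 1: "w * w * exp (- w / 2) \<le> 16" by (simp only: mult.assoc[of 16])
    have "256 * exp 1 / a \<le> w" using w by (simp add: w0_def)
    then have 2: "256 * exp 1 \<le> a * w" using a by (simp add: field_simps)
    have "16 * exp 1 * (w * w * exp (- w / 2)) \<le> 16 * exp 1 * 16" using 1 by (intro mult_left_mono) auto
    moreover have "16 * exp 1 * (w * exp (- w / 2)) * w = 16 * exp 1 * (w * w * exp (- w / 2))" by (simp add: mult_ac)
    ultimately have "16 * exp 1 * (w * exp (- w / 2)) * w \<le> a * w" using 2 by linarith
    then have "16 * exp 1 * (w * exp (- w / 2)) \<le> a" by (rule mult_right_le_imp_le) (use w1 in simp)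
    then have ge: "ennreal (1 + a * sqrt (w / pi) / (8 * exp 1 * w\<^sup>2)) \<le> lag_mass g w"
      using lag_mass_ge[OF g w1] by (simp add: a_def)
    have "d \<le> a * sqrt (w / pi) / (8 * exp 1 * w\<^sup>2)"
      unfolding d_def
    proof (intro frac_le mult_left_mono mult_nonneg_nonneg power_mono)
      show "sqrt (1 / pi) \<le> sqrt (w / pi)" using w1 by (simp add: divide_right_mono)
    qed (use a w1 w in auto)
    then have "ennreal (1 + d) \<le> ennreal (1 + a * sqrt (w / pi) / (8 * exp 1 * w\<^sup>2))" by (intro ennreal_leI) simp
    then show ?thesis using ge by (rule order_trans)
  qed
  then show ?thesis using w0 d that by blast
qed

section \<open>The modified kernel on the orthant\<close>

lemma open_orthant: "open (orthant :: (real ^ 'n) set)"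
proof -
  have *: "(orthant :: (real ^ 'n) set) = (\<Inter>i\<in>UNIV. {x. 0 < x $ i})" by (auto simp: orthant_def)
  show ?thesis unfolding * by (intro open_INT ballI finite open_Collect_less continuous_intros)
qed

lemma orthant_borel [measurable]: "(orthant :: (real ^ 'n) set) \<in> sets borel"
  using open_orthant by (rule borel_open)

lemma space_laguerre_measure [simp]: "space (laguerre_measure \<alpha>) = orthant"
  by (simp add: laguerre_measure_def space_restrict_space)

lemma measurable_nth [measurable]: "(\<lambda>x :: real ^ 'n. x $ i) \<in> borel_measurable borel"
  by (intro borel_measurable_continuous_onI continuous_intros)

lemma borel_measurable_laguerre [measurable (raw)]:
  "f \<in> borel_measurable borel \<Longrightarrow> f \<in> borel_measurable (laguerre_measure \<alpha>)"
  unfolding laguerre_measure_def by (simp add: measurable_restrict_space1)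

lemma nn_integral_laguerre:
  fixes \<alpha> :: "real ^ 'n"
  assumes [measurable]: "f \<in> borel_measurable borel"
  shows "(\<integral>\<^sup>+y. f y \<partial>laguerre_measure \<alpha>)
    = (\<integral>\<^sup>+y. indicator orthant y * ennreal (\<Prod>i\<in>UNIV. (y $ i) powr (2 * \<alpha> $ i + 1)) * f y \<partial>lborel)" (is "?lhs = _")
proof -
  let ?w = "\<lambda>y. \<Prod>i\<in>UNIV. (y $ i) powr (2 * \<alpha> $ i + 1)"
  have [measurable]: "(\<lambda>x::real^'n. ennreal (\<Prod>i\<in>UNIV. (x $ i) powr (2 * \<alpha> $ i + 1))) \<in> borel_measurable borel" by measurable
  have "?lhs = (\<integral>\<^sup>+y. ennreal (?w y) * f y \<partial>restrict_space lborel orthant)"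
    unfolding laguerre_measure_def
    by (intro nn_integral_density measurable_restrict_space1) auto
  also have "\<dots> = (\<integral>\<^sup>+y. ennreal (?w y) * f y * indicator orthant y \<partial>lborel)"
    by (intro nn_integral_restrict_space) auto
  finally show ?thesis by (simp add: mult_ac)
qed

abbreviation coord_integral :: "real ^ 'n \<Rightarrow> 'n \<Rightarrow> (real \<Rightarrow> ennreal) \<Rightarrow> ennreal" where
  "coord_integral \<alpha> i f \<equiv> (\<integral>\<^sup>+v. ennreal (indicator {0<..} v * v powr (2 * \<alpha> $ i + 1)) * f v \<partial>lborel)"

lemma nn_integral_laguerre_prod:
  fixes f :: "'n::finite \<Rightarrow> real \<Rightarrow> ennreal"
  assumes [measurable]: "\<And>i. f i \<in> borel_measurable borel"
  shows "(\<integral>\<^sup>+y. (\<Prod>i\<in>UNIV. f i (y $ i)) \<partial>laguerre_measure \<alpha>)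
    = (\<Prod>i\<in>UNIV. coord_integral \<alpha> i (f i))" (is "?lhs = _")
proof -
  let ?w = "\<lambda>y. \<Prod>i\<in>UNIV. (y $ i) powr (2 * \<alpha> $ i + 1)"
  define h where "h i v = ennreal (indicator {0<..} v * v powr (2 * \<alpha> $ i + 1)) * f i v" for i v
  have [measurable]: "h i \<in> borel_measurable borel" for i unfolding h_def by measurable
  have "?lhs
    = (\<integral>\<^sup>+y. indicator orthant y * ennreal (?w y) * (\<Prod>i\<in>UNIV. f i (y $ i)) \<partial>lborel)"
    by (rule nn_integral_laguerre) measurable
  also have "\<dots> = (\<integral>\<^sup>+y. (\<Prod>i\<in>UNIV. h i (y $ i)) \<partial>lborel)"
  proof (intro nn_integral_cong)
    fix y :: "real ^ 'n"
    have "indicator orthant y = (\<Prod>i\<in>UNIV. ennreal (indicator {0<..} (y $ i)))"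
      by (auto simp: orthant_def indicator_def prod_zero_iff)
    moreover have "ennreal (?w y) = (\<Prod>i\<in>UNIV. ennreal ((y $ i) powr (2 * \<alpha> $ i + 1)))"
      by (rule prod_ennreal[symmetric]) simp
    ultimately show "indicator orthant y * ennreal (?w y) * (\<Prod>i\<in>UNIV. f i (y $ i)) = (\<Prod>i\<in>UNIV. h i (y $ i))"
      by (simp add: h_def prod.distrib ennreal_mult)
  qed
  \<comment> \<open>Tonelli for Lebesgue measure runs over \<open>Basis\<close>; the description
    operator recovers the coordinate from its unit vector.\<close>
  also have "\<dots> = (\<integral>\<^sup>+(y :: real ^ 'n). (\<Prod>b\<in>Basis. h (THE i. b = axis i 1) (y \<bullet> b)) \<partial>lborel)"
  proof (intro nn_integral_cong)
    fix y :: "real ^ 'n"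
    have B: "Basis = (\<lambda>i. axis i (1::real)) ` (UNIV :: 'n set)" by (auto simp: Basis_vec_def)
    have the: "(THE k. axis i (1::real) = axis k 1) = i" for i :: 'n by (auto simp: axis_eq_axis)
    have inj: "inj (\<lambda>i::'n. axis i (1::real))" by (auto simp: inj_on_def axis_eq_axis)
    show "(\<Prod>i\<in>UNIV. h i (y $ i)) = (\<Prod>b\<in>Basis. h (THE i. b = axis i 1) (y \<bullet> b))"
      unfolding B by (subst prod.reindex[OF inj]) (simp add: the inner_axis)
  qed
  also have "\<dots> = (\<Prod>b\<in>(Basis :: (real^'n) set). \<integral>\<^sup>+v. h (THE i. b = axis i 1) v \<partial>lborel)"
    by (rule nn_integral_lborel_prod) auto
  also have "\<dots> = (\<Prod>i\<in>UNIV. \<integral>\<^sup>+v. h i v \<partial>lborel)"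
  proof -
    have B: "Basis = (\<lambda>i. axis i (1::real)) ` (UNIV :: 'n set)" by (auto simp: Basis_vec_def)
    have the: "(THE k. axis i (1::real) = axis k 1) = i" for i :: 'n by (auto simp: axis_eq_axis)
    have inj: "inj (\<lambda>i::'n. axis i (1::real))" by (auto simp: inj_on_def axis_eq_axis)
    show ?thesis unfolding B by (subst prod.reindex[OF inj]) (simp add: the)
  qed
  finally show ?thesis by (simp add: h_def)
qed

lemma sigma_finite_laguerre: "sigma_finite_measure (laguerre_measure \<alpha> :: (real ^ 'n) measure)"
proof -
  interpret L: sigma_finite_measure "restrict_space lborel (orthant :: (real ^ 'n) set)"
    by (rule sigma_finite_measure_restrict_space) (auto intro: lborel.sigma_finite_measure_axioms)
  have "sigma_finite_measure (density (restrict_space lborel orthant) (\<lambda>x::real^'n. ennreal (\<Prod>i\<in>UNIV. (x $ i) powr (2 * \<alpha> $ i + 1))))"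
    by (subst L.sigma_finite_iff_density_finite) (auto intro!: measurable_restrict_space1)
  then show ?thesis by (simp add: laguerre_measure_def)
qed

locale modified_laguerre =
  fixes \<alpha> :: "real ^ 'n" and j :: 'n
  assumes alpha_j: "- 3 / 2 < \<alpha> $ j" and alpha_i: "\<And>i. i \<noteq> j \<Longrightarrow> - 1 < \<alpha> $ i"
begin

abbreviation "M \<equiv> laguerre_measure \<alpha>"

definition gam :: "'n \<Rightarrow> real" where "gam i = (\<alpha> + axis j 1) $ i"

lemma gam_j: "gam j = \<alpha> $ j + 1" by (simp add: gam_def)

lemma gam_i: "i \<noteq> j \<Longrightarrow> gam i = \<alpha> $ i" by (simp add: gam_def axis_def)

lemma gam_gt: "- 1 < gam i" and gam_j_gt: "- 1 / 2 < gam j"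
  using alpha_j alpha_i by (cases "i = j"; simp add: gam_j gam_i)+

text \<open>The extra factor \<open>x $ j * y $ j\<close> of the modified kernel is stored in
  coordinate \<open>j\<close>, so that \<open>K\<close> remains a pure product.\<close>

definition kap :: "'n \<Rightarrow> real \<Rightarrow> real \<Rightarrow> real \<Rightarrow> real" where
  "kap i t u v = (if i = j then u * v else 1) * lag1 (gam i) t u v"

definition K :: "real \<Rightarrow> real ^ 'n \<Rightarrow> real ^ 'n \<Rightarrow> real" where
  "K t x y = exp (- 2 * t) * (\<Prod>i\<in>UNIV. kap i t (x $ i) (y $ i))"

lemma prod_if_j: "(\<Prod>i\<in>UNIV. (if i = j then a i else 1) * b i) = a j * (\<Prod>i\<in>UNIV. b i)" for a b :: "'n \<Rightarrow> 'b::comm_monoid_mult"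
  by (simp add: prod.distrib)

lemma K_eq: "K t x y = exp (- 2 * t) * (x $ j * y $ j * laguerre_kernel (\<alpha> + axis j 1) t x y)"
proof -
  have "(\<Prod>i\<in>UNIV. kap i t (x $ i) (y $ i)) = x $ j * y $ j * (\<Prod>i\<in>UNIV. lag1 (gam i) t (x $ i) (y $ i))"
    unfolding kap_def by (rule prod_if_j)
  also have "(\<Prod>i\<in>UNIV. lag1 (gam i) t (x $ i) (y $ i)) = laguerre_kernel (\<alpha> + axis j 1) t x y"
  proof -
    have "(norm x)\<^sup>2 + (norm y)\<^sup>2 = (\<Sum>i\<in>UNIV. (x $ i)\<^sup>2 + (y $ i)\<^sup>2)"
      by (simp add: power2_norm_eq_inner inner_vec_def sum.distrib) (simp add: power2_eq_square)
    then have "exp (- (1 / 2) * (cosh (2 * t) / sinh (2 * t)) * ((norm x)\<^sup>2 + (norm y)\<^sup>2))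
      = (\<Prod>i\<in>UNIV. exp (- (1 / 2) * (cosh (2 * t) / sinh (2 * t)) * ((x $ i)\<^sup>2 + (y $ i)\<^sup>2)))"
      by (simp only: sum_distrib_left exp_sum finite)
    moreover have "1 / sinh (2 * t) ^ CARD('n) = (\<Prod>i\<in>(UNIV::'n set). 1 / sinh (2 * t))"
      by (simp add: power_one_over)
    ultimately show ?thesis
      unfolding laguerre_kernel_def lag1_def gam_def by (simp only: prod.distrib)
  qed
  finally show ?thesis by (simp add: K_def)
qed

lemma modified_laguerre_eq:
  "modified_laguerre_semigroup \<alpha> j t f = (if t = 0 then f else kernel_op M (K t) f)"
proof (cases "t = 0")
  case False
  have "exp (- 2 * t) * (\<integral>y. x $ j * y $ j * laguerre_kernel (\<alpha> + axis j 1) t x y * f y \<partial>M)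
    = (\<integral>y. exp (- 2 * t) * (x $ j * y $ j * laguerre_kernel (\<alpha> + axis j 1) t x y * f y) \<partial>M)" for x
    by simp
  then show ?thesis using False
    by (auto simp: modified_laguerre_semigroup_def kernel_op_def K_eq fun_eq_iff mult.assoc)
qed (simp add: modified_laguerre_semigroup_def)

lemma kap_sym: "kap i t u v = kap i t v u"
  by (simp add: kap_def lag1_sym[of _ _ u] mult.commute)

lemma kap_nonneg: "0 < t \<Longrightarrow> 0 < u \<Longrightarrow> 0 < v \<Longrightarrow> 0 \<le> kap i t u v"
  by (simp add: kap_def lag1_nonneg[OF gam_gt])

lemma K_sym: "K t x y = K t y x"
  unfolding K_def by (simp add: kap_sym[of _ t "x $ _"])

lemma K_nonneg: "0 < t \<Longrightarrow> x \<in> orthant \<Longrightarrow> y \<in> orthant \<Longrightarrow> 0 \<le> K t x y"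
  unfolding K_def by (auto intro!: mult_nonneg_nonneg prod_nonneg kap_nonneg simp: orthant_def)

lemma borel_measurable_kap [measurable (raw)]:
  assumes [measurable]: "f \<in> borel_measurable N" "h \<in> borel_measurable N"
  shows "(\<lambda>x. kap i t (f x) (h x)) \<in> borel_measurable N"
  unfolding kap_def by measurable

lemma K_measurable: "(\<lambda>(x, y). K t x y) \<in> borel_measurable (M \<Otimes>\<^sub>M M)"
proof -
  have [measurable]: "(\<lambda>z. fst z $ i) \<in> borel_measurable (M \<Otimes>\<^sub>M M)" "(\<lambda>z. snd z $ i) \<in> borel_measurable (M \<Otimes>\<^sub>M M)" for i
    by (rule measurable_compose[OF measurable_fst borel_measurable_laguerre[OF measurable_nth]],
        rule measurable_compose[OF measurable_snd borel_measurable_laguerre[OF measurable_nth]])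
  show ?thesis unfolding K_def split_beta by measurable
qed

text \<open>In coordinate \<open>j\<close> one factor \<open>v\<close> comes from the kernel and one
  from the integrand; together they raise the exponent of the measure to
  \<open>2 * gam j + 1\<close>, the one matching the Bessel index. This is why test functions carry
  the factor \<open>x $ j\<close>.\<close>

lemma coord_integral_kap:
  assumes t: "0 < t" and u: "0 < u" and [measurable]: "h \<in> borel_measurable borel"
    and I: "half_line_integral (\<lambda>v. v powr (2 * gam i + 1) * (h v * lag1 (gam i) t u v)) = ennreal I"
  shows "coord_integral \<alpha> i (\<lambda>v. ennreal (kap i t u v) * ennreal ((if i = j then v else 1) * h v))
    = ennreal ((if i = j then u else 1) * I)"
proof (rule nn_integral_cmult_real[OF _ _ _ I, THEN trans[rotated]])
  let ?e = "if i = j then u else 1"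
  let ?H = "\<lambda>v. indicator {0<..} v * (v powr (2 * gam i + 1) * (h v * lag1 (gam i) t u v))"
  show "coord_integral \<alpha> i (\<lambda>v. ennreal (kap i t u v) * ennreal ((if i = j then v else 1) * h v)) = (\<integral>\<^sup>+v. ennreal (?e * ?H v) \<partial>lborel)"
  proof (intro nn_integral_cong)
    fix v :: real
    show "ennreal (indicator {0<..} v * v powr (2 * \<alpha> $ i + 1)) * (ennreal (kap i t u v) * ennreal ((if i = j then v else 1) * h v)) = ennreal (?e * ?H v)"
    proof (cases "0 < v")
      case True
      have k0: "0 \<le> kap i t u v" using t u True by (rule kap_nonneg)
      have "v powr (2 * gam j + 1) = v powr (2 * \<alpha> $ j + 1) * v powr 2" using powr_add[of v "2 * \<alpha> $ j + 1" 2] by (simp add: gam_j)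
      then have eq: "v powr (2 * \<alpha> $ i + 1) * (kap i t u v * ((if i = j then v else 1) * h v)) = ?e * ?H v"
        using True by (cases "i = j") (simp_all add: kap_def gam_i power2_eq_square mult_ac)
      have "ennreal (v powr (2 * \<alpha> $ i + 1)) * (ennreal (kap i t u v) * ennreal x) = ennreal (v powr (2 * \<alpha> $ i + 1) * (kap i t u v * x))" for x
        using k0 by (simp add: ennreal_mult')
      then show ?thesis using True unfolding eq[symmetric] by simp
    qed simp
  qed
qed (use u in auto)

lemma kap_Chapman_Kolmogorov:
  assumes s: "0 < s" and t: "0 < t" and u: "0 < u" and w: "0 < w"
  shows "coord_integral \<alpha> i (\<lambda>v. ennreal (kap i s u v) * ennreal (kap i t v w)) = ennreal (kap i (s + t) u w)"
proof -
  \<comment> \<open>The factor \<open>v\<close> of the second kernel plays the role of the test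
    function's factor; its other variable \<open>w\<close> is a constant in the integral.\<close>
  define e where "e = (if i = j then w else 1)"
  have "half_line_integral (\<lambda>v. v powr (2 * gam i + 1) * (e * lag1 (gam i) t v w * lag1 (gam i) s u v)) = ennreal (e * lag1 (gam i) (s + t) u w)"
    by (rule nn_integral_cmult_real[OF _ _ _ lag1_Chapman_Kolmogorov[OF gam_gt s t u w]]) (use w in \<open>auto simp: e_def mult_ac\<close>)
  from coord_integral_kap[OF s u _ this]
  have "coord_integral \<alpha> i (\<lambda>v. ennreal (kap i s u v) * ennreal ((if i = j then v else 1) * (e * lag1 (gam i) t v w))) = ennreal ((if i = j then u else 1) * (e * lag1 (gam i) (s + t) u w))"
    by simp
  moreover have "kap i t v w = (if i = j then v else 1) * (e * lag1 (gam i) t v w)" for t v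
    by (simp add: kap_def e_def)
  ultimately show ?thesis by simp
qed

lemma nn_integral_K_prod:
  assumes t: "0 < t" and x: "x \<in> orthant" and [measurable]: "\<And>i. f i \<in> borel_measurable borel"
  shows "(\<integral>\<^sup>+y. ennreal (K t x y) * (\<Prod>i\<in>UNIV. f i (y $ i)) \<partial>M)
    = ennreal (exp (- 2 * t)) * (\<Prod>i\<in>UNIV. coord_integral \<alpha> i (\<lambda>v. ennreal (kap i t (x $ i) v) * f i v))" (is "?lhs = _")
proof -
  have "?lhs = (\<integral>\<^sup>+y. ennreal (exp (- 2 * t)) * (\<Prod>i\<in>UNIV. ennreal (kap i t (x $ i) (y $ i)) * f i (y $ i)) \<partial>M)"
  proof (intro nn_integral_cong)
    fix y assume "y \<in> space M"
    then have "0 \<le> kap i t (x $ i) (y $ i)" for i using t x by (auto intro!: kap_nonneg simp: orthant_def)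
    then show "ennreal (K t x y) * (\<Prod>i\<in>UNIV. f i (y $ i)) = ennreal (exp (- 2 * t)) * (\<Prod>i\<in>UNIV. ennreal (kap i t (x $ i) (y $ i)) * f i (y $ i))"
      by (simp add: K_def prod.distrib prod_ennreal ennreal_mult' mult.assoc)
  qed
  also have "\<dots> = ennreal (exp (- 2 * t)) * (\<integral>\<^sup>+y. (\<Prod>i\<in>UNIV. ennreal (kap i t (x $ i) (y $ i)) * f i (y $ i)) \<partial>M)"
    by (rule nn_integral_cmult) measurable
  finally show ?thesis by (subst (asm) nn_integral_laguerre_prod) measurable
qed

lemma K_Chapman_Kolmogorov:
  assumes s: "0 < s" and t: "0 < t" and x: "x \<in> orthant" and z: "z \<in> orthant"
  shows "(\<integral>\<^sup>+y. ennreal (K s x y) * ennreal (K t y z) \<partial>M) = ennreal (K (s + t) x z)" (is "?lhs = _")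
proof -
  have "?lhs = (\<integral>\<^sup>+y. ennreal (exp (- 2 * t)) * (ennreal (K s x y) * (\<Prod>i\<in>UNIV. ennreal (kap i t (y $ i) (z $ i)))) \<partial>M)"
  proof (intro nn_integral_cong)
    fix y assume "y \<in> space M"
    then have "0 \<le> kap i t (y $ i) (z $ i)" for i using t z by (auto intro!: kap_nonneg simp: orthant_def)
    then show "ennreal (K s x y) * ennreal (K t y z) = ennreal (exp (- 2 * t)) * (ennreal (K s x y) * (\<Prod>i\<in>UNIV. ennreal (kap i t (y $ i) (z $ i))))"
      by (simp add: K_def[of t] prod_ennreal ennreal_mult' mult.left_commute)
  qed
  also have "\<dots> = ennreal (exp (- 2 * t)) * (\<integral>\<^sup>+y. ennreal (K s x y) * (\<Prod>i\<in>UNIV. ennreal (kap i t (y $ i) (z $ i))) \<partial>M)"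
    by (rule nn_integral_cmult) (simp add: K_def)
  also have "\<dots> = ennreal (exp (- 2 * t)) * (ennreal (exp (- 2 * s)) * (\<Prod>i\<in>UNIV. ennreal (kap i (s + t) (x $ i) (z $ i))))"
    using s t x z by (subst nn_integral_K_prod) (simp_all add: kap_Chapman_Kolmogorov orthant_def)
  also have "(\<Prod>i\<in>UNIV. ennreal (kap i (s + t) (x $ i) (z $ i))) = ennreal (\<Prod>i\<in>UNIV. kap i (s + t) (x $ i) (z $ i))"
    using s t x z by (intro prod_ennreal kap_nonneg) (auto simp: orthant_def)
  finally show ?thesis by (simp add: K_def ennreal_mult'[symmetric] mult.assoc[symmetric] exp_add[symmetric] algebra_simps)
qed

end

section \<open>Action on Gaussians, their inner products, and the mass of the full kernel\<close>

context modified_laguerre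
begin

text \<open>Gaussian widths move by this fractional linear map. Its fixed point \<open>1/2\<close>
  is the width of the ground state, and at \<open>t = 0\<close> it is the identity.\<close>

definition theta :: "real \<Rightarrow> real \<Rightarrow> real" where
  "theta t q = (sinh (2 * t) + 2 * cosh (2 * t) * q) / (2 * (cosh (2 * t) + 2 * sinh (2 * t) * q))"

definition amp :: "real \<Rightarrow> real \<Rightarrow> 'n \<Rightarrow> real" where
  "amp t q i = (cosh (2 * t) + 2 * sinh (2 * t) * q) powr (- (gam i + 1))"

definition phi :: "('n \<Rightarrow> real) \<Rightarrow> real ^ 'n \<Rightarrow> real" where
  "phi q y = (\<Prod>i\<in>UNIV. (if i = j then y $ i else 1) * exp (- q i * (y $ i)\<^sup>2))"

lemma phi_measurable [measurable]: "phi q \<in> borel_measurable borel"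
  unfolding phi_def by measurable

lemma phi_pos: "y \<in> orthant \<Longrightarrow> 0 < phi q y"
  unfolding phi_def by (auto intro!: prod_pos simp: orthant_def)

lemma kap_gaussian:
  assumes t: "0 < t" and u: "0 < u" and q: "0 \<le> q"
  shows "coord_integral \<alpha> i (\<lambda>v. ennreal (kap i t u v) * ennreal ((if i = j then v else 1) * exp (- q * v\<^sup>2)))
    = ennreal ((if i = j then u else 1) * (amp t q i * exp (- theta t q * u\<^sup>2)))"
  unfolding amp_def theta_def by (rule coord_integral_kap[OF t u _ lag1_gaussian[OF gam_gt t u q]]) measurable

lemma nn_integral_K_phi:
  assumes t: "0 < t" and x: "x \<in> orthant" and q: "\<And>i. 0 \<le> q i"
  shows "(\<integral>\<^sup>+y. ennreal (K t x y * phi q y) \<partial>M)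
    = ennreal (exp (- 2 * t) * (\<Prod>i\<in>UNIV. amp t (q i) i) * phi (\<lambda>i. theta t (q i)) x)" (is "?lhs = _")
proof -
  let ?g = "\<lambda>i. (if i = j then x $ i else 1) * (amp t (q i) i * exp (- theta t (q i) * (x $ i)\<^sup>2))"
  have "?lhs = (\<integral>\<^sup>+y. ennreal (K t x y) * (\<Prod>i\<in>UNIV. ennreal ((if i = j then y $ i else 1) * exp (- q i * (y $ i)\<^sup>2))) \<partial>M)"
  proof (intro nn_integral_cong)
    fix y assume y: "y \<in> space M"
    then have "(\<Prod>i\<in>UNIV. ennreal ((if i = j then y $ i else 1) * exp (- q i * (y $ i)\<^sup>2))) = ennreal (phi q y)"
      unfolding phi_def by (intro prod_ennreal) (auto simp: orthant_def less_imp_le)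
    then show "ennreal (K t x y * phi q y) = ennreal (K t x y) * (\<Prod>i\<in>UNIV. ennreal ((if i = j then y $ i else 1) * exp (- q i * (y $ i)\<^sup>2)))"
      using y t x by (simp add: ennreal_mult' K_nonneg)
  qed
  also have "\<dots> = ennreal (exp (- 2 * t)) * (\<Prod>i\<in>UNIV. ennreal (?g i))"
    using t x q by (subst nn_integral_K_prod) (simp_all only: kap_gaussian orthant_def mem_Collect_eq, measurable)
  also have "(\<Prod>i\<in>UNIV. ennreal (?g i)) = ennreal (\<Prod>i\<in>UNIV. ?g i)"
    using x by (intro prod_ennreal) (auto simp: orthant_def amp_def less_imp_le)
  also have "(\<Prod>i\<in>UNIV. ?g i) = (\<Prod>i\<in>UNIV. amp t (q i) i) * phi (\<lambda>i. theta t (q i)) x"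
    by (simp only: prod.distrib phi_def mult.left_commute)
  finally show ?thesis by (simp add: ennreal_mult'[symmetric] mult.assoc)
qed

lemma kernel_op_phi:
  assumes t: "0 < t" and x: "x \<in> orthant" and q: "\<And>i. 0 \<le> q i"
  shows "kernel_op M (K t) (phi q) x = exp (- 2 * t) * (\<Prod>i\<in>UNIV. amp t (q i) i) * phi (\<lambda>i. theta t (q i)) x"
proof -
  have [measurable]: "K t x \<in> borel_measurable borel" unfolding K_def by measurable
  have "kernel_op M (K t) (phi q) x = enn2real (\<integral>\<^sup>+y. ennreal (K t x y * phi q y) \<partial>M)"
    unfolding kernel_op_def
    by (intro integral_eq_nn_integral) (use t x in \<open>auto intro!: AE_I2 mult_nonneg_nonneg K_nonneg less_imp_le[OF phi_pos]\<close>)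
  also have "\<dots> = exp (- 2 * t) * (\<Prod>i\<in>UNIV. amp t (q i) i) * phi (\<lambda>i. theta t (q i)) x"
    unfolding nn_integral_K_phi[OF t x q] using phi_pos[OF x, of "\<lambda>i. theta t (q i)"]
    by (intro enn2real_ennreal mult_nonneg_nonneg prod_nonneg) (auto simp: amp_def)
  finally show ?thesis .
qed

lemma Gamma_gam_nonneg: "0 \<le> Gamma (gam i + 1)"
  using gam_gt[of i] by (intro Gamma_real_nonneg) simp

text \<open>The argument is the sum of two widths: the inner product of two test functions depends
  on nothing else.\<close>

definition phi_inner :: "('n \<Rightarrow> real) \<Rightarrow> real" where
  "phi_inner q = (\<Prod>i\<in>UNIV. Gamma (gam i + 1) * (q i) powr (- (gam i + 1)) / 2)"

lemma phi_inner:
  assumes "\<And>i. 0 < p i + q i"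
  shows "integrable M (\<lambda>y. phi p y * phi q y)" "(\<integral>y. phi p y * phi q y \<partial>M) = phi_inner (\<lambda>i. p i + q i)"
proof -
  let ?h = "\<lambda>i v. (if i = j then v\<^sup>2 else 1) * exp (- (p i + q i) * v\<^sup>2)"
  let ?G = "\<lambda>i. Gamma (gam i + 1) * (p i + q i) powr (- (gam i + 1)) / 2"
  have nn0: "0 \<le> phi_inner (\<lambda>i. p i + q i)"
    unfolding phi_inner_def by (intro prod_nonneg divide_nonneg_pos mult_nonneg_nonneg Gamma_gam_nonneg) auto
  have nn: "AE y in M. 0 \<le> phi p y * phi q y" by (auto intro!: AE_I2 mult_nonneg_nonneg less_imp_le[OF phi_pos])
  have "(\<integral>\<^sup>+y. ennreal (phi p y * phi q y) \<partial>M)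
    = (\<integral>\<^sup>+y. (\<Prod>i\<in>UNIV. ennreal ((if i = j then (y $ i)\<^sup>2 else 1) * exp (- (p i + q i) * (y $ i)\<^sup>2))) \<partial>M)"
  proof (intro nn_integral_cong)
    fix y assume "y \<in> space M"
    have "phi p y * phi q y = (\<Prod>i\<in>UNIV. (if i = j then (y $ i)\<^sup>2 else 1) * exp (- (p i + q i) * (y $ i)\<^sup>2))"
      unfolding phi_def prod.distrib[symmetric]
      by (intro prod.cong refl) (auto simp: power2_eq_square exp_add[symmetric] algebra_simps)
    then show "ennreal (phi p y * phi q y) = (\<Prod>i\<in>UNIV. ennreal ((if i = j then (y $ i)\<^sup>2 else 1) * exp (- (p i + q i) * (y $ i)\<^sup>2)))"
      by (subst prod_ennreal) auto
  qed
  also have "\<dots> = (\<Prod>i\<in>UNIV. coord_integral \<alpha> i (\<lambda>v. ennreal (?h i v)))"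
    by (rule nn_integral_laguerre_prod) measurable
  also have "\<dots> = (\<Prod>i\<in>UNIV. ennreal (?G i))"
  proof (intro prod.cong refl)
    fix i
    have "(coord_integral \<alpha> i (\<lambda>v. ennreal (?h i v)))
      = half_line_integral (\<lambda>v. v powr (2 * (gam i + 1) - 1) * exp (- (p i + q i) * v\<^sup>2))"
    proof (intro nn_integral_cong)
      fix v :: real
      have "v powr (2 * (gam i + 1) - 1) = v powr (2 * \<alpha> $ i + 1) * (if i = j then v\<^sup>2 else 1)" if "0 < v"
        using powr_add[of v "2 * \<alpha> $ j + 1" 2] that by (auto simp: gam_j gam_i add.commute)
      then show "ennreal (indicator {0<..} v * v powr (2 * \<alpha> $ i + 1)) * ennreal (?h i v)
        = ennreal (indicator {0<..} v * (v powr (2 * (gam i + 1) - 1) * exp (- (p i + q i) * v\<^sup>2)))"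
        by (cases "0 < v") (simp_all add: ennreal_mult[symmetric] mult_ac)
    qed
    also have "\<dots> = ennreal (?G i)"
      using assms gam_gt[of i] by (intro nn_integral_powr_gaussian) auto
    finally show "(coord_integral \<alpha> i (\<lambda>v. ennreal (?h i v)))
      = ennreal (?G i)" .
  qed
  also have "\<dots> = ennreal (phi_inner (\<lambda>i. p i + q i))"
    unfolding phi_inner_def by (intro prod_ennreal divide_nonneg_pos mult_nonneg_nonneg Gamma_gam_nonneg) auto
  finally have eq: "(\<integral>\<^sup>+y. ennreal (phi p y * phi q y) \<partial>M) = ennreal (phi_inner (\<lambda>i. p i + q i))" .
  show "integrable M (\<lambda>y. phi p y * phi q y)"
    using nn eq by (intro integrableI_nonneg) auto
  show "(\<integral>y. phi p y * phi q y \<partial>M) = phi_inner (\<lambda>i. p i + q i)"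
    by (rule integral_eq_nn_integral[THEN trans]) (use nn nn0 eq in auto)
qed

text \<open>Each coordinate other than \<open>j\<close> is the Gaussian formula at width 0 and
  contributes the exponent \<open>- (\<alpha> $ i + 1)\<close> of \<open>cosh\<close>; coordinate
  \<open>j\<close> contributes \<open>- gam j = - (\<alpha> $ j + 1)\<close>. The sum of these is
  the exponent in the theorem.\<close>

lemma nn_integral_K:
  assumes t: "0 < t" and x: "x \<in> orthant"
  defines "c \<equiv> cosh (2 * t)" and "s \<equiv> sinh (2 * t)"
  shows "(\<integral>\<^sup>+y. ennreal (K t x y) \<partial>M)
    = ennreal (exp (- 2 * t) * c powr (- ((\<Sum>i\<in>UNIV. \<alpha> $ i) + real CARD('n)))
        * exp (- (\<Sum>i\<in>UNIV - {j}. s / (2 * c) * (x $ i)\<^sup>2) - (x $ j)\<^sup>2 / (2 * s * c) * s\<^sup>2)) * lag_mass (gam j) ((x $ j)\<^sup>2 / (2 * s * c))" (is "?lhs = _")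
proof -
  let ?q = "\<Sum>i\<in>UNIV - {j}. s / (2 * c) * (x $ i)\<^sup>2"
  let ?r = "c powr (- (\<alpha> $ j + 1)) * exp (- ((x $ j)\<^sup>2 / (2 * s * c)) * s\<^sup>2)"
  let ?e = "\<Sum>i\<in>UNIV - {j}. - (\<alpha> $ i + 1)"
  let ?S = "(\<Sum>i\<in>UNIV. \<alpha> $ i) + real CARD('n)"
  let ?w = "(x $ j)\<^sup>2 / (2 * s * c)"
  have c0: "0 < c" by (simp add: c_def)
  have xi: "0 < x $ i" for i using x by (simp add: orthant_def)
  have kap0: "0 \<le> kap i t (x $ i) v" if "0 < v" for i v using t xi that by (rule kap_nonneg)
  define I where "I i = coord_integral \<alpha> i (\<lambda>v. ennreal (kap i t (x $ i) v))" for i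
  have "?lhs = ennreal (exp (- 2 * t)) * (\<Prod>i\<in>UNIV. I i)"
    using nn_integral_K_prod[OF t x, of "\<lambda>_ _. 1"] by (simp add: I_def)
  also have "(\<Prod>i\<in>UNIV. I i) = I j * (\<Prod>i\<in>UNIV - {j}. I i)"
    by (rule prod.remove) auto
  also have "I j = ennreal ?r * lag_mass (gam j) ?w"
  proof -
    have "I j = half_line_integral (\<lambda>v. v powr (2 * gam j - 1) * (x $ j * v * lag1 (gam j) t (x $ j) v))"
      unfolding I_def
    proof (intro nn_integral_cong)
      fix v :: real
      have eq: "2 * gam j - 1 = 2 * \<alpha> $ j + 1" by (simp add: gam_j)
      show "ennreal (indicator {0<..} v * v powr (2 * \<alpha> $ j + 1)) * ennreal (kap j t (x $ j) v) = ennreal (indicator {0<..} v * (v powr (2 * gam j - 1) * (x $ j * v * lag1 (gam j) t (x $ j) v)))"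
        unfolding eq using kap0[of v j] by (cases "0 < v") (simp_all add: ennreal_mult[symmetric] kap_def)
    qed
    also have "\<dots> = ennreal (c powr (- gam j) * exp (- ?w * s\<^sup>2)) * lag_mass (gam j) ?w"
      unfolding c_def s_def by (rule lag1_mass[OF gam_j_gt t xi])
    finally show ?thesis by (simp add: gam_j)
  qed
  also have "(\<Prod>i\<in>UNIV - {j}. I i)
     = (\<Prod>i\<in>UNIV - {j}. ennreal (c powr (- (\<alpha> $ i + 1)) * exp (- (s / (2 * c) * (x $ i)\<^sup>2))))"
  proof (intro prod.cong refl)
    fix i assume "i \<in> UNIV - {j}"
    then have i: "i \<noteq> j" by simp
    show "I i = ennreal (c powr (- (\<alpha> $ i + 1)) * exp (- (s / (2 * c) * (x $ i)\<^sup>2)))"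
      using kap_gaussian[OF t xi, of 0 i] i by (simp add: I_def amp_def theta_def gam_i c_def s_def)
  qed
  also have "\<dots> = ennreal (\<Prod>i\<in>UNIV - {j}. c powr (- (\<alpha> $ i + 1)) * exp (- (s / (2 * c) * (x $ i)\<^sup>2)))"
    by (rule prod_ennreal) simp
  also have "(\<Prod>i\<in>UNIV - {j}. c powr (- (\<alpha> $ i + 1)) * exp (- (s / (2 * c) * (x $ i)\<^sup>2)))
     = c powr ?e * exp (- ?q)"
    using c0 by (simp add: prod.distrib powr_sum exp_sum sum_negf[symmetric])
  also have "ennreal (exp (- 2 * t)) * (ennreal ?r * lag_mass (gam j) ?w
      * ennreal (c powr ?e * exp (- ?q)))
    = ennreal (exp (- 2 * t) * (?r * (c powr ?e * exp (- ?q))))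
       * lag_mass (gam j) ?w"
    by (simp add: ennreal_mult' mult_ac)
  also have "exp (- 2 * t) * (?r * (c powr ?e * exp (- ?q)))
    = exp (- 2 * t) * c powr (- ?S)
        * exp (- ?q - (x $ j)\<^sup>2 / (2 * s * c) * s\<^sup>2)"
  proof -
    have "- ?S = (\<Sum>i\<in>UNIV. - (\<alpha> $ i + 1))"
      by (simp add: sum_subtractf sum_negf)
    also have "\<dots> = - (\<alpha> $ j + 1) + ?e"
      by (rule sum.remove) auto
    finally have 1: "c powr (- ?S) = c powr (- (\<alpha> $ j + 1)) * c powr ?e"
      by (simp only: powr_add)
    have 2: "exp (- a - b * d) = exp (- b * d) * exp (- a)" for a b d :: real by (simp add: exp_add[symmetric])
    show ?thesis unfolding 1 2 by (simp only: mult_ac)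
  qed
  finally show ?thesis .
qed

text \<open>The position-dependent exponential in the mass formula is at most 1, so any uniform
  bound \<open>B\<close> for \<open>lag_mass\<close> becomes the constant of the norm estimate, in
  both ranges of \<open>\<alpha> $ j\<close>.\<close>

lemma schur_kernel_K:
  assumes t: "0 < t" and B: "0 < B" "\<And>w. 0 < w \<Longrightarrow> lag_mass (gam j) w \<le> ennreal B"
  shows "schur_kernel M (K t) (B * exp (- 2 * t) * cosh (2 * t) powr (- ((\<Sum>i\<in>UNIV. \<alpha> $ i) + real CARD('n))))"
proof -
  let ?S = "(\<Sum>i\<in>UNIV. \<alpha> $ i) + real CARD('n)"
  interpret sigma_finite_measure M by (rule sigma_finite_laguerre)
  show ?thesis
  proof
    fix x assume "x \<in> space M"
    then have x: "x \<in> orthant" by simp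
    define c where "c = cosh (2 * t)"
    define s where "s = sinh (2 * t)"
    define P where "P = exp (- 2 * t) * c powr (- ?S)"
    define E where "E = exp (- (\<Sum>i\<in>UNIV - {j}. s / (2 * c) * (x $ i)\<^sup>2) - (x $ j)\<^sup>2 / (2 * s * c) * s\<^sup>2)"
    have cs: "0 < c" "0 < s" using t by (auto simp: c_def s_def)
    have "0 < x $ j" using x by (simp add: orthant_def)
    then have w: "0 < (x $ j)\<^sup>2 / (2 * s * c)" using cs by simp
    have P: "0 \<le> P" by (simp add: P_def)
    have "0 \<le> (\<Sum>i\<in>UNIV - {j}. s / (2 * c) * (x $ i)\<^sup>2)" using cs by (intro sum_nonneg) auto
    moreover have "0 \<le> (x $ j)\<^sup>2 / (2 * s * c) * s\<^sup>2" using cs by simp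
    ultimately have E: "E \<le> 1" by (simp add: E_def)
    have "(\<integral>\<^sup>+y. ennreal (K t x y) \<partial>M) = ennreal (P * E) * lag_mass (gam j) ((x $ j)\<^sup>2 / (2 * s * c))"
      using nn_integral_K[OF t x] by (simp add: P_def E_def c_def s_def)
    also have "\<dots> \<le> ennreal P * ennreal B"
      using w cs E P by (intro mult_mono B(2) ennreal_leI mult_left_le) auto
    also have "\<dots> = ennreal (B * exp (- 2 * t) * cosh (2 * t) powr (- ?S))"
      using P B by (simp add: ennreal_mult'[symmetric] P_def c_def mult_ac)
    finally show "(\<integral>\<^sup>+y. ennreal (K t x y) \<partial>M) \<le> ennreal (B * exp (- 2 * t) * cosh (2 * t) powr (- ?S))" .
  qed (use t B K_measurable K_nonneg K_sym in auto)
qed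

end

section \<open>Strong continuity of contractions\<close>

text \<open>The factor \<open>n\<close> in the exponent makes the limit equal to 1 also at \<open>u = 1/2\<close>. With a Gaussian in place
  of \<open>u\<close> the left-hand side is a finite combination of Gaussians, so half-spaces are pointwise limits of such.\<close>

lemma threshold_power_limit:
  fixes u :: real
  assumes u: "0 \<le> u" "u \<le> 1"
  shows "(\<lambda>n. 1 - (1 - u ^ n) ^ (n * 2 ^ n)) \<longlonglongrightarrow> (if 1 / 2 \<le> u then 1 else 0)"
proof -
  have un: "0 \<le> u ^ n" "u ^ n \<le> 1" for n using u by (auto simp: power_le_one)
  have nu: "real (n * 2 ^ n) * u ^ n = real n * (2 * u) ^ n" for n by (simp add: power_mult_distrib)
  show ?thesis
  proof (cases "1 / 2 \<le> u")
    case True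
    have "(1 - u ^ n) ^ (n * 2 ^ n) \<le> 1 / (1 + real n)" for n
    proof -
      have "real n * 1 \<le> real n * (2 * u) ^ n" using True by (intro mult_left_mono one_le_power) auto
      then have "1 + real n \<le> 1 + real (n * 2 ^ n) * u ^ n" unfolding nu by simp
      also have "\<dots> \<le> (1 + u ^ n) ^ (n * 2 ^ n)" using un[of n] by (intro Bernoulli_inequality) linarith
      finally have 1: "1 + real n \<le> (1 + u ^ n) ^ (n * 2 ^ n)" .
      \<comment> \<open>The product of the two powers is at most 1, so Bernoulli's lower bound for
        the power of \<open>1 + u ^ n\<close> becomes an upper bound for the power of
        \<open>1 - u ^ n\<close>.\<close>
      have "(1 - z) * (1 + z) = 1 - z\<^sup>2" for z :: real by (simp add: power2_eq_square algebra_simps)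
      then have "(1 - u ^ n) ^ (n * 2 ^ n) * (1 + u ^ n) ^ (n * 2 ^ n) = (1 - (u ^ n)\<^sup>2) ^ (n * 2 ^ n)"
        by (simp only: power_mult_distrib[symmetric])
      also have "\<dots> \<le> 1" using un[of n] by (intro power_le_one) (auto simp: power_le_one)
      finally have 2: "(1 - u ^ n) ^ (n * 2 ^ n) * (1 + u ^ n) ^ (n * 2 ^ n) \<le> 1" .
      have "(1 - u ^ n) ^ (n * 2 ^ n) * (1 + real n) \<le> (1 - u ^ n) ^ (n * 2 ^ n) * (1 + u ^ n) ^ (n * 2 ^ n)"
        using 1 un[of n] by (intro mult_left_mono zero_le_power) auto
      then have "(1 - u ^ n) ^ (n * 2 ^ n) * (1 + real n) \<le> 1" using 2 by linarith
      then show ?thesis by (simp add: pos_le_divide_eq)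
    qed
    note le = this
    have ge: "0 \<le> (1 - u ^ n) ^ (n * 2 ^ n)" for n using un[of n] by simp
    have "(\<lambda>n. 1 / (1 + real n)) \<longlonglongrightarrow> 0"
      using LIMSEQ_inverse_real_of_nat by (simp add: inverse_eq_divide add.commute)
    then have "(\<lambda>n. (1 - u ^ n) ^ (n * 2 ^ n)) \<longlonglongrightarrow> 0"
      by (rule real_tendsto_sandwich[OF always_eventually[OF allI[OF ge]] always_eventually[OF allI[OF le]] tendsto_const])
    from tendsto_diff[OF tendsto_const[of 1] this] show ?thesis using True by simp
  next
    case False
    have le: "1 - (1 - u ^ n) ^ (n * 2 ^ n) \<le> real n * (2 * u) ^ n" for n
    proof -
      have "1 + real (n * 2 ^ n) * (- (u ^ n)) \<le> (1 + - (u ^ n)) ^ (n * 2 ^ n)"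
        using un[of n] by (intro Bernoulli_inequality) linarith
      moreover have "real (n * 2 ^ n) * (- (u ^ n)) = - (real n * (2 * u) ^ n)" using nu[of n] by simp
      ultimately show ?thesis by simp
    qed
    have ge: "0 \<le> 1 - (1 - u ^ n) ^ (n * 2 ^ n)" for n using un[of n] by (simp add: power_le_one)
    have "(\<lambda>n. real n * (2 * u) ^ n) \<longlonglongrightarrow> 0"
      using False u by (intro powser_times_n_limit_0) auto
    then have "(\<lambda>n. 1 - (1 - u ^ n) ^ (n * 2 ^ n)) \<longlonglongrightarrow> 0"
      by (rule real_tendsto_sandwich[OF always_eventually[OF allI[OF ge]] always_eventually[OF allI[OF le]] tendsto_const])
    then show ?thesis using False by simp
  qed
qed

lemma sqnorm_cong_AE: "AE x in M. f x = g x \<Longrightarrow> sqnorm M f = sqnorm M g"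
  unfolding sqnorm_def by (intro nn_integral_cong_AE) (auto elim!: eventually_mono)

lemma sqnorm_mono: "(\<And>x. x \<in> space M \<Longrightarrow> \<bar>f x\<bar> \<le> \<bar>g x\<bar>) \<Longrightarrow> sqnorm M f \<le> sqnorm M g"
  unfolding sqnorm_def by (intro nn_integral_mono ennreal_leI) (simp add: abs_le_square_iff)

lemma sqnorm_cmult:
  assumes [measurable]: "f \<in> borel_measurable M"
  shows "sqnorm M (\<lambda>x. a * f x) = ennreal (a\<^sup>2) * sqnorm M f"
  unfolding sqnorm_def by (subst nn_integral_cmult[symmetric]) (auto simp: power_mult_distrib ennreal_mult)

locale contraction_kernels = sigma_finite_measure M for M :: "'a measure" +
  fixes K :: "real \<Rightarrow> 'a \<Rightarrow> 'a \<Rightarrow> real"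
  assumes kernel: "\<And>t. 0 < t \<Longrightarrow> schur_kernel M (K t) 1"
begin

definition scont :: "('a \<Rightarrow> real) \<Rightarrow> bool" where
  "scont f \<longleftrightarrow> f \<in> Lp_space M 2 \<and> ((\<lambda>t. sqnorm M (\<lambda>x. kernel_op M (K t) f x - f x)) \<longlongrightarrow> 0) (at_right 0)"

lemma measurable_op [measurable]:
  "0 < t \<Longrightarrow> f \<in> borel_measurable M \<Longrightarrow> kernel_op M (K t) f \<in> borel_measurable M"
  by (rule schur_kernel.measurable_kernel_op[OF kernel])

lemma kernel_op_lincomb_AE:
  assumes t: "0 < t" and f: "f \<in> Lp_space M 2" and g: "g \<in> Lp_space M 2"
  shows "AE x in M. kernel_op M (K t) (\<lambda>y. a * f y + b * g y) x = a * kernel_op M (K t) f x + b * kernel_op M (K t) g x"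
proof -
  interpret schur_kernel M "K t" 1 by (rule kernel[OF t])
  have p: "(1::ennreal) \<le> 2" by simp
  show ?thesis
    using integrable_kernel_Lp_AE[OF p f] integrable_kernel_Lp_AE[OF p g]
    by eventually_elim (simp add: kernel_op_def distrib_left mult.left_commute[of _ a] mult.left_commute[of _ b])
qed

lemma Lp_space_2_lincomb:
  assumes f: "f \<in> Lp_space M 2" and g: "g \<in> Lp_space M 2"
  shows "(\<lambda>y. a * f y + b * g y) \<in> Lp_space M 2"
proof -
  have [measurable]: "f \<in> borel_measurable M" "g \<in> borel_measurable M" using f g by (auto simp: Lp_space_2_iff)
  have "sqnorm M (\<lambda>y. a * f y + b * g y) \<le> 2 * sqnorm M (\<lambda>y. a * f y) + 2 * sqnorm M (\<lambda>y. b * g y)"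
    by (rule sqnorm_add_le) measurable
  also have "\<dots> < \<infinity>" using f g by (simp add: sqnorm_cmult Lp_space_2_iff ennreal_mult_less_top)
  finally show ?thesis by (simp add: Lp_space_2_iff)
qed

lemma scont_lincomb:
  assumes f: "scont f" and g: "scont g"
  shows "scont (\<lambda>x. a * f x + b * g x)"
proof -
  let ?d = "\<lambda>t. \<lambda>x. kernel_op M (K t) (\<lambda>x. a * f x + b * g x) x - (a * f x + b * g x)"
  have fL: "f \<in> Lp_space M 2" and gL: "g \<in> Lp_space M 2" using f g by (auto simp: scont_def)
  have [measurable]: "f \<in> borel_measurable M" "g \<in> borel_measurable M" using fL gL by (auto simp: Lp_space_2_iff)
  define F where "F t = sqnorm M (\<lambda>x. kernel_op M (K t) f x - f x)" for t
  define G where "G t = sqnorm M (\<lambda>x. kernel_op M (K t) g x - g x)" for t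
  have le: "sqnorm M (?d t)
     \<le> 2 * (ennreal (a\<^sup>2) * F t) + 2 * (ennreal (b\<^sup>2) * G t)" if t: "0 < t" for t
  proof -
    note measurable_op[OF t, measurable]
    have "sqnorm M (?d t)
      = sqnorm M (\<lambda>x. a * (kernel_op M (K t) f x - f x) + b * (kernel_op M (K t) g x - g x))"
      by (rule sqnorm_cong_AE, use kernel_op_lincomb_AE[OF t fL gL, of a b] in eventually_elim) (simp add: algebra_simps)
    also have "\<dots> \<le> 2 * sqnorm M (\<lambda>x. a * (kernel_op M (K t) f x - f x)) + 2 * sqnorm M (\<lambda>x. b * (kernel_op M (K t) g x - g x))"
      by (rule sqnorm_add_le) measurable
    also have "\<dots> = 2 * (ennreal (a\<^sup>2) * F t) + 2 * (ennreal (b\<^sup>2) * G t)"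
      unfolding F_def G_def by (subst (1 2) sqnorm_cmult) auto
    finally show ?thesis .
  qed
  have "(F \<longlongrightarrow> 0) (at_right 0)" "(G \<longlongrightarrow> 0) (at_right 0)" using f g by (simp_all add: scont_def F_def[abs_def] G_def[abs_def])
  then have "((\<lambda>t. 2 * (ennreal (a\<^sup>2) * F t) + 2 * (ennreal (b\<^sup>2) * G t)) \<longlongrightarrow> 2 * (ennreal (a\<^sup>2) * 0) + 2 * (ennreal (b\<^sup>2) * 0)) (at_right 0)"
    by (intro tendsto_add ennreal_tendsto_cmult) auto
  then have lim: "((\<lambda>t. 2 * (ennreal (a\<^sup>2) * F t) + 2 * (ennreal (b\<^sup>2) * G t)) \<longlongrightarrow> 0) (at_right 0)" by simp
  have "((\<lambda>t. sqnorm M (?d t)) \<longlongrightarrow> 0) (at_right 0)"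
    by (rule tendsto_sandwich[OF _ _ tendsto_const lim])
       (auto simp: eventually_at_filter intro!: always_eventually le)
  then show ?thesis using Lp_space_2_lincomb[OF fL gL] by (simp add: scont_def)
qed

text \<open>Contractivity makes the set of vectors of strong continuity closed.\<close>

lemma scont_approx:
  assumes f: "f \<in> Lp_space M 2" and h: "\<And>n. scont (h n)"
    and lim: "(\<lambda>n. sqnorm M (\<lambda>x. f x - h n x)) \<longlonglongrightarrow> 0"
  shows "scont f"
proof -
  let ?d = "\<lambda>n t. \<lambda>x. kernel_op M (K t) (h n) x - h n x"
  have fm [measurable]: "f \<in> borel_measurable M" using f by (auto simp: Lp_space_2_iff)
  have hL: "h n \<in> Lp_space M 2" for n using h by (auto simp: scont_def)
  have hm [measurable]: "h n \<in> borel_measurable M" for n using hL by (auto simp: Lp_space_2_iff)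
  \<comment> \<open>With \<open>d = f - h n\<close> the difference splits as the image of
    \<open>d\<close>, plus the difference for \<open>h n\<close>, minus \<open>d\<close>. Two uses
    of \<open>sqnorm_add_le\<close> and contractivity on \<open>d\<close> give the coefficients 6
    and 4.\<close>
  have le: "sqnorm M (\<lambda>x. kernel_op M (K t) f x - f x) \<le> 6 * sqnorm M (\<lambda>x. f x - h n x) + 4 * sqnorm M (?d n t)" if t: "0 < t" for t n
  proof -
    note measurable_op[OF t, measurable]
    interpret schur_kernel M "K t" 1 by (rule kernel[OF t])
    define d where "d = (\<lambda>x. f x - h n x)"
    have dL: "d \<in> Lp_space M 2" using Lp_space_2_lincomb[OF f hL, of 1 "-1"] by (simp add: d_def)
    have [measurable]: "d \<in> borel_measurable M" unfolding d_def by measurable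
    have "sqnorm M (\<lambda>x. kernel_op M (K t) f x - f x) = sqnorm M (\<lambda>x. (kernel_op M (K t) d x) + ((kernel_op M (K t) (h n) x - h n x) + - d x))"
    proof (rule sqnorm_cong_AE)
      show "AE x in M. kernel_op M (K t) f x - f x = (kernel_op M (K t) d x) + ((kernel_op M (K t) (h n) x - h n x) + - d x)"
        using kernel_op_lincomb_AE[OF t f hL, of 1 "-1" n] by eventually_elim (simp add: d_def)
    qed
    also have "\<dots> \<le> 2 * sqnorm M (kernel_op M (K t) d) + 2 * sqnorm M (\<lambda>x. (kernel_op M (K t) (h n) x - h n x) + - d x)"
      by (rule sqnorm_add_le) measurable
    also have "\<dots> \<le> 2 * sqnorm M d + 2 * (2 * sqnorm M (?d n t) + 2 * sqnorm M (\<lambda>x. - d x))"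
      using dL sqnorm_kernel_op_le[of d] by (intro add_mono mult_left_mono sqnorm_add_le) (auto simp: Lp_space_2_iff)
    also have "sqnorm M (\<lambda>x. - d x) = sqnorm M d" by (simp add: sqnorm_def)
    also have "2 * sqnorm M d + 2 * (2 * sqnorm M (?d n t) + 2 * sqnorm M d)
      = 6 * sqnorm M d + 4 * sqnorm M (?d n t)"
    proof -
      have "2 * a + 2 * (2 * b + 2 * a) = 6 * a + 4 * b" for a b :: ennreal
        by (cases a; cases b) (simp_all add: ennreal_mult'[symmetric] ennreal_plus[symmetric] flip: ennreal_numeral del: ennreal_plus)
      then show ?thesis .
    qed
    finally show ?thesis by (simp add: d_def)
  qed
  have "((\<lambda>t. sqnorm M (\<lambda>x. kernel_op M (K t) f x - f x)) \<longlongrightarrow> 0) (at_right 0)"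
  proof (rule order_tendstoI)
    fix e :: ennreal assume e: "0 < e"
    have lim6: "(\<lambda>n. 6 * sqnorm M (\<lambda>x. f x - h n x)) \<longlonglongrightarrow> 6 * 0"
      using lim by (intro ennreal_tendsto_cmult) auto
    \<comment> \<open>The radius \<open>e\<close> may be infinite; a smaller positive
      \<open>e'\<close> is finite and can be halved in the reals.\<close>
    obtain e' where e': "0 < e'" "e' < e" using e dense by blast
    then have "e' \<noteq> top" by auto
    then obtain r where r: "e' = ennreal r" "0 \<le> r" by (cases e') auto
    have r0: "0 < r" using e' r by (simp add: ennreal_less_zero_iff)
    have "0 < ennreal (r / 2)" using r0 by simp
    then have "eventually (\<lambda>n. 6 * sqnorm M (\<lambda>x. f x - h n x) < ennreal (r / 2)) sequentially"
      using lim6 by (intro order_tendstoD(2)) auto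
    then obtain n where n: "6 * sqnorm M (\<lambda>x. f x - h n x) < ennreal (r / 2)" by (auto simp: eventually_sequentially)
    have "((\<lambda>t. sqnorm M (?d n t)) \<longlongrightarrow> 0) (at_right 0)" using h by (simp add: scont_def)
    then have "((\<lambda>t. 4 * sqnorm M (?d n t)) \<longlongrightarrow> 4 * 0) (at_right 0)"
      by (intro ennreal_tendsto_cmult) auto
    then have "eventually (\<lambda>t. 4 * sqnorm M (?d n t) < ennreal (r / 2)) (at_right 0)"
      using \<open>0 < ennreal (r / 2)\<close> by (intro order_tendstoD(2)) auto
    moreover have "eventually (\<lambda>t::real. 0 < t) (at_right 0)" by (simp add: eventually_at_filter)
    ultimately show "eventually (\<lambda>t. sqnorm M (\<lambda>x. kernel_op M (K t) f x - f x) < e) (at_right 0)"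
    proof eventually_elim
      case (elim t)
      have "sqnorm M (\<lambda>x. kernel_op M (K t) f x - f x) \<le> ennreal (r / 2) + ennreal (r / 2)"
        by (rule order_trans[OF le[OF elim(2), of n]]) (intro add_mono less_imp_le[OF n] less_imp_le[OF elim(1)])
      also have "\<dots> = e'" using r by (simp flip: ennreal_plus)
      finally show ?case using e' by simp
    qed
  qed simp
  then show ?thesis using f by (simp add: scont_def)
qed

text \<open>Pointwise convergence under an \<open>L2\<close> majorant is \<open>L2\<close>
  convergence, so closedness applies. This is the form in which the monotone class argument uses
  it.\<close>

lemma scont_dominated:
  assumes f: "f \<in> borel_measurable M" and h: "\<And>n. scont (h n)" and w: "w \<in> Lp_space M 2"
    and lim: "\<And>x. x \<in> space M \<Longrightarrow> (\<lambda>n. h n x) \<longlonglongrightarrow> f x"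
    and bound: "\<And>n x. x \<in> space M \<Longrightarrow> \<bar>h n x\<bar> \<le> \<bar>w x\<bar>"
  shows "scont f"
proof (rule scont_approx[OF _ h])
  note f [measurable]
  have [measurable]: "h n \<in> borel_measurable M" for n using h by (auto simp: scont_def Lp_space_2_iff)
  have [measurable]: "w \<in> borel_measurable M" using w by (auto simp: Lp_space_2_iff)
  have fb: "\<bar>f x\<bar> \<le> \<bar>w x\<bar>" if "x \<in> space M" for x
    using bound[OF that] by (intro tendsto_upperbound[OF tendsto_rabs[OF lim[OF that]]]) auto
  have "sqnorm M f \<le> sqnorm M w" by (rule sqnorm_mono) (rule fb)
  also have "\<dots> < \<infinity>" using w by (simp add: Lp_space_2_iff)
  finally show "f \<in> Lp_space M 2" by (simp add: Lp_space_2_iff)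
  have "(\<lambda>n. sqnorm M (\<lambda>x. f x - h n x)) \<longlonglongrightarrow> (\<integral>\<^sup>+x. 0 \<partial>M)"
    unfolding sqnorm_def
  proof (rule nn_integral_dominated_convergence)
    show "(\<integral>\<^sup>+x. ennreal 4 * ennreal ((w x)\<^sup>2) \<partial>M) < \<infinity>"
      using w by (subst nn_integral_cmult) (auto simp: Lp_space_2_iff sqnorm_def ennreal_mult_less_top)
    show "AE x in M. ennreal ((f x - h n x)\<^sup>2) \<le> ennreal 4 * ennreal ((w x)\<^sup>2)" for n
    proof (intro AE_I2)
      fix x assume x: "x \<in> space M"
      have "\<bar>f x - h n x\<bar> \<le> \<bar>2 * w x\<bar>" using fb[OF x] bound[OF x, of n] by linarith
      then have "(f x - h n x)\<^sup>2 \<le> (2 * w x)\<^sup>2" by (simp only: abs_le_square_iff)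
      then have "ennreal ((f x - h n x)\<^sup>2) \<le> ennreal (4 * (w x)\<^sup>2)" by (intro ennreal_leI) (simp add: power_mult_distrib)
      then show "ennreal ((f x - h n x)\<^sup>2) \<le> ennreal 4 * ennreal ((w x)\<^sup>2)" by (simp add: ennreal_mult)
    qed
    show "AE x in M. (\<lambda>n. ennreal ((f x - h n x)\<^sup>2)) \<longlonglongrightarrow> 0"
    proof (intro AE_I2)
      fix x assume x: "x \<in> space M"
      have "(\<lambda>n. (f x - h n x)\<^sup>2) \<longlonglongrightarrow> (f x - f x)\<^sup>2" by (intro tendsto_intros lim x)
      then have "(\<lambda>n. ennreal ((f x - h n x)\<^sup>2)) \<longlonglongrightarrow> ennreal ((f x - f x)\<^sup>2)" by (rule tendsto_ennrealI)
      then show "(\<lambda>n. ennreal ((f x - h n x)\<^sup>2)) \<longlonglongrightarrow> 0" by simp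
    qed
  qed measurable
  then show "(\<lambda>n. sqnorm M (\<lambda>x. f x - h n x)) \<longlonglongrightarrow> 0" by simp
qed

end

section \<open>Strong continuity of the Laguerre operators\<close>

lemma tendsto_cosh_2t: "((\<lambda>t. cosh (2 * t)) \<longlongrightarrow> 1) (at_right (0::real))"
  by (rule tendsto_eq_rhs[OF tendsto_cosh[OF tendsto_mult[OF tendsto_const tendsto_ident_at]]]) simp

lemma tendsto_sinh_2t: "((\<lambda>t. sinh (2 * t)) \<longlongrightarrow> 0) (at_right (0::real))"
  by (rule tendsto_eq_rhs[OF tendsto_sinh[OF tendsto_mult[OF tendsto_const tendsto_ident_at]]]) simp

lemma measurable_laguerre_iff_borel:
  fixes A :: "(real ^ 'n) set"
  assumes "A \<in> sets (laguerre_measure \<alpha>)"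
  shows "A \<in> sets borel" "A \<subseteq> orthant"
  using assms by (auto simp: laguerre_measure_def sets_restrict_space)

lemma (in modified_laguerre) phi_L2: "(\<And>i. 0 < q i) \<Longrightarrow> phi q \<in> Lp_space M 2"
  using phi_inner(1)[of q q] by (auto simp: Lp_space_2_iff_integrable power2_eq_square)

locale submarkovian_laguerre = modified_laguerre \<alpha> j for \<alpha> :: "real ^ 'n" and j +
  assumes alpha_j_ge: "- 1 / 2 \<le> \<alpha> $ j"
begin

definition bound :: "real \<Rightarrow> real" where
  "bound t = exp (- 2 * t) * cosh (2 * t) powr (- ((\<Sum>i\<in>UNIV. \<alpha> $ i) + real CARD('n)))"

lemma schur_kernel_bound: "0 < t \<Longrightarrow> schur_kernel M (K t) (bound t)"
  using schur_kernel_K[of t 1] lag_mass_le_1[of _ "gam j"] alpha_j_ge by (simp add: bound_def gam_j)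

text \<open>Here every \<open>\<alpha> $ i + 1\<close> is nonnegative, so the power of
  \<open>cosh\<close> is at most 1, and \<open>exp (- 2 * t)\<close> makes the inequality strict.
  Strictness is what later rules out the Markov property.\<close>

lemma bound_less_1: "0 < t \<Longrightarrow> bound t < 1"
proof -
  assume t: "0 < t"
  have "0 \<le> (\<Sum>i\<in>UNIV. \<alpha> $ i + 1)"
  proof (rule sum_nonneg)
    fix i show "0 \<le> \<alpha> $ i + 1" using alpha_i[of i] alpha_j_ge by (cases "i = j") auto
  qed
  then have "0 \<le> (\<Sum>i\<in>UNIV. \<alpha> $ i) + real CARD('n)" by (simp add: sum.distrib)
  then have "cosh (2 * t) powr (- ((\<Sum>i\<in>UNIV. \<alpha> $ i) + real CARD('n))) \<le> cosh (2 * t) powr 0"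
    by (intro powr_mono) (auto simp: cosh_real_ge_1)
  also have "\<dots> = 1" by simp
  finally have "bound t \<le> exp (- 2 * t) * 1" unfolding bound_def by (intro mult_left_mono) auto
  also have "\<dots> < 1" using t by simp
  finally show ?thesis .
qed

sublocale contraction_kernels M K
proof -
  interpret sigma_finite_measure M by (rule sigma_finite_laguerre)
  have "schur_kernel M (K t) 1" if t: "0 < t" for t
  proof -
    interpret S: schur_kernel M "K t" "bound t" by (rule schur_kernel_bound[OF t])
    show ?thesis
    proof
      fix x assume "x \<in> space M"
      then have "(\<integral>\<^sup>+y. ennreal (K t x y) \<partial>M) \<le> ennreal (bound t)" by (rule S.kernel_bound)
      also have "\<dots> \<le> ennreal 1" using bound_less_1[OF t] by (intro ennreal_leI) simp
      finally show "(\<integral>\<^sup>+y. ennreal (K t x y) \<partial>M) \<le> ennreal 1" .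
    qed (use S.measurable_kernel S.kernel_nonneg S.kernel_sym in auto)
  qed
  then show "contraction_kernels M K"
    by (intro contraction_kernels.intro contraction_kernels_axioms.intro sigma_finite_measure_axioms)
qed

section \<open>Strong continuity on Gaussians, then on all of \<open>L2\<close>\<close>

lemma sqnorm_lincomb_phi:
  assumes "\<And>i. 0 < p i" "\<And>i. 0 < q i"
  shows "sqnorm M (\<lambda>x. a * phi p x - phi q x)
    = ennreal (a\<^sup>2 * phi_inner (\<lambda>i. p i + p i) - 2 * a * phi_inner (\<lambda>i. p i + q i) + phi_inner (\<lambda>i. q i + q i))"
proof -
  note pp = phi_inner[of p p] and pq = phi_inner[of p q] and qq = phi_inner[of q q]
  have eq: "(a * phi p x - phi q x)\<^sup>2 = a\<^sup>2 * (phi p x * phi p x) - 2 * a * (phi p x * phi q x) + phi q x * phi q x" for x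
    by (simp add: power2_eq_square algebra_simps)
  have pos: "0 < p i + p i" "0 < p i + q i" "0 < q i + q i" for i using assms by (simp_all add: add_pos_pos)
  have "sqnorm M (\<lambda>x. a * phi p x - phi q x) = ennreal (\<integral>x. (a * phi p x - phi q x)\<^sup>2 \<partial>M)"
    unfolding sqnorm_def
  proof (rule nn_integral_eq_integral)
    show "integrable M (\<lambda>x. (a * phi p x - phi q x)\<^sup>2)" unfolding eq using pp(1) pq(1) qq(1) pos by simp
  qed simp
  also have "(\<integral>x. (a * phi p x - phi q x)\<^sup>2 \<partial>M) = a\<^sup>2 * phi_inner (\<lambda>i. p i + p i) - 2 * a * phi_inner (\<lambda>i. p i + q i) + phi_inner (\<lambda>i. q i + q i)"
    unfolding eq using pp pq qq pos by simp
  finally show ?thesis .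
qed

text \<open>Since the image of a Gaussian is a multiple of a Gaussian, the squared distance is an
  explicit combination of three inner products. As \<open>t\<close> tends to 0 the widths and
  amplitudes tend to \<open>q\<close> and 1, and the coefficients 1, -2, 1 cancel.\<close>

lemma scont_phi:
  assumes q: "\<And>i. 0 < q i"
  shows "scont (phi q)"
proof -
  let ?d = "\<lambda>t. \<lambda>x. kernel_op M (K t) (phi q) x - phi q x"
  define B where "B t = exp (- 2 * t) * (\<Prod>i\<in>UNIV. amp t (q i) i)" for t
  define G where "G t = (B t)\<^sup>2 * phi_inner (\<lambda>i. theta t (q i) + theta t (q i)) - 2 * B t * phi_inner (\<lambda>i. theta t (q i) + q i) + phi_inner (\<lambda>i. q i + q i)" for t
  note c = tendsto_cosh_2t and s = tendsto_sinh_2t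
  have th: "((\<lambda>t. theta t (q i)) \<longlongrightarrow> q i) (at_right 0)" for i
  proof -
    have "((\<lambda>t. theta t (q i)) \<longlongrightarrow> (0 + 2 * 1 * q i) / (2 * (1 + 2 * 0 * q i))) (at_right 0)"
      unfolding theta_def by (intro tendsto_intros c s) simp
    then show ?thesis by simp
  qed
  have am: "((\<lambda>t. amp t (q i) i) \<longlongrightarrow> 1) (at_right 0)" for i
  proof -
    have "((\<lambda>t. amp t (q i) i) \<longlongrightarrow> (1 + 2 * 0 * q i) powr (- (gam i + 1))) (at_right 0)"
      unfolding amp_def by (intro tendsto_intros c s) simp
    then show ?thesis by simp
  qed
  have B: "(B \<longlongrightarrow> 1) (at_right 0)"
    unfolding B_def by (rule tendsto_eq_rhs[OF tendsto_mult[OF tendsto_exp[OF tendsto_mult[OF tendsto_const tendsto_ident_at]] tendsto_prod[OF am]]]) simp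
  have pin: "((\<lambda>t. phi_inner (\<lambda>i. f t i)) \<longlongrightarrow> phi_inner r) (at_right 0)"
    if "\<And>i. ((\<lambda>t. f t i) \<longlongrightarrow> r i) (at_right 0)" "\<And>i. 0 < r i" for f :: "real \<Rightarrow> 'n \<Rightarrow> real" and r
    unfolding phi_inner_def using that(1) that(2)[THEN less_imp_neq, THEN not_sym] by (intro tendsto_intros) auto
  have "(G \<longlongrightarrow> 1\<^sup>2 * phi_inner (\<lambda>i. q i + q i) - 2 * 1 * phi_inner (\<lambda>i. q i + q i) + phi_inner (\<lambda>i. q i + q i)) (at_right 0)"
    unfolding G_def by (intro tendsto_intros B pin tendsto_add th) (use q in \<open>auto simp: add_pos_pos\<close>)
  then have "((\<lambda>t. ennreal (G t)) \<longlongrightarrow> ennreal 0) (at_right 0)" by (intro tendsto_ennrealI) simp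
  moreover have "eventually (\<lambda>t. sqnorm M (?d t) = ennreal (G t)) (at_right 0)"
  proof -
    have "sqnorm M (?d t) = ennreal (G t)" if t: "0 < t" for t
    proof -
      have "sqnorm M (?d t) = sqnorm M (\<lambda>x. B t * phi (\<lambda>i. theta t (q i)) x - phi q x)"
        by (intro sqnorm_cong_AE AE_I2) (use t q in \<open>auto simp: kernel_op_phi B_def less_imp_le\<close>)
      also have "\<dots> = ennreal (G t)"
        unfolding G_def
      proof (rule sqnorm_lincomb_phi)
        fix i
        show "0 < theta t (q i)" unfolding theta_def using t q[of i]
          by (intro divide_pos_pos mult_pos_pos add_pos_pos) auto
      qed (rule q)
      finally show ?thesis .
    qed
    then show ?thesis by (auto simp: eventually_at_filter)
  qed
  ultimately have "((\<lambda>t. sqnorm M (?d t)) \<longlongrightarrow> 0) (at_right 0)"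
    by (simp add: tendsto_cong)
  then show ?thesis using phi_L2[of q] q by (simp add: scont_def)
qed

text \<open>The multipliers which keep the test functions inside the set of strong continuity; a monotone class
  argument will show that all bounded Borel functions are among them.\<close>

definition good :: "(real ^ 'n \<Rightarrow> real) \<Rightarrow> bool" where
  "good h \<longleftrightarrow> h \<in> borel_measurable M \<and> (\<exists>B. \<forall>x\<in>orthant. \<bar>h x\<bar> \<le> B) \<and> (\<forall>q. (\<forall>i. 0 < q i) \<longrightarrow> scont (\<lambda>x. phi q x * h x))"

lemma good_const: "good (\<lambda>_. a)"
proof -
  have "scont (\<lambda>x. phi q x * a)" if "\<forall>i. 0 < q i" for q
    using scont_lincomb[OF scont_phi scont_phi, of q q a 0] that by (simp add: mult.commute)
  then show ?thesis by (auto simp: good_def)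
qed

lemma good_lincomb:
  assumes g: "good g" and h: "good h"
  shows "good (\<lambda>x. a * g x + b * h x)"
proof -
  have [measurable]: "g \<in> borel_measurable M" "h \<in> borel_measurable M" using g h by (auto simp: good_def)
  obtain B B' where "\<forall>x\<in>orthant. \<bar>g x\<bar> \<le> B" "\<forall>x\<in>orthant. \<bar>h x\<bar> \<le> B'" using g h by (auto simp: good_def)
  then have "\<forall>x\<in>orthant. \<bar>a * g x + b * h x\<bar> \<le> \<bar>a\<bar> * B + \<bar>b\<bar> * B'"
    by (intro ballI order_trans[OF abs_triangle_ineq]) (auto simp: abs_mult intro!: add_mono mult_left_mono)
  moreover have "scont (\<lambda>x. phi q x * (a * g x + b * h x))" if "\<forall>i. 0 < q i" for q
  proof -
    have "scont (\<lambda>x. a * (phi q x * g x) + b * (phi q x * h x))"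
      using g h that by (intro scont_lincomb) (auto simp: good_def)
    then show ?thesis by (simp add: distrib_left mult.left_commute)
  qed
  ultimately show ?thesis by (auto simp: good_def)
qed

text \<open>Multiplication by a Gaussian in \<open>x $ i\<close> only shifts \<open>q i\<close> by
  \<open>r\<close>, which stays positive. The quantification over all \<open>q\<close> in
  \<open>good\<close> is there for this step.\<close>

lemma good_gaussian:
  assumes h: "good h" and r: "0 \<le> r"
  shows "good (\<lambda>x. exp (- r * (x $ i)\<^sup>2) * h x)"
proof -
  have [measurable]: "h \<in> borel_measurable M" using h by (auto simp: good_def)
  obtain B where B: "\<forall>x\<in>orthant. \<bar>h x\<bar> \<le> B" using h by (auto simp: good_def)
  have "\<bar>exp (- r * (x $ i)\<^sup>2) * h x\<bar> \<le> B" if "x \<in> orthant" for x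
  proof -
    have "exp (- r * (x $ i)\<^sup>2) * \<bar>h x\<bar> \<le> 1 * \<bar>h x\<bar>" using r by (intro mult_right_mono) auto
    then show ?thesis using B that by (auto simp: abs_mult)
  qed
  moreover have "scont (\<lambda>x. phi q x * (exp (- r * (x $ i)\<^sup>2) * h x))" if q: "\<forall>i. 0 < q i" for q
  proof -
    have "phi (q(i := q i + r)) x = phi q x * exp (- r * (x $ i)\<^sup>2)" for x
    proof -
      have "phi (q(i := q i + r)) x = (\<Prod>k\<in>UNIV. ((if k = j then x $ k else 1) * exp (- q k * (x $ k)\<^sup>2)) * (if k = i then exp (- r * (x $ i)\<^sup>2) else 1))"
        unfolding phi_def by (intro prod.cong refl) (auto simp: exp_add[symmetric] algebra_simps)
      then show ?thesis by (simp add: prod.distrib phi_def)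
    qed
    moreover have "scont (\<lambda>x. phi (q(i := q i + r)) x * h x)"
      using h q r by (auto simp: good_def add_pos_nonneg)
    ultimately show ?thesis by (simp add: mult.assoc)
  qed
  ultimately show ?thesis by (auto simp: good_def)
qed

lemma good_limit:
  assumes h: "\<And>n. good (h n)" and B: "\<And>n x. x \<in> orthant \<Longrightarrow> \<bar>h n x\<bar> \<le> B"
    and f: "f \<in> borel_measurable M" and lim: "\<And>x. x \<in> orthant \<Longrightarrow> (\<lambda>n. h n x) \<longlonglongrightarrow> f x"
  shows "good f"
proof -
  note f[measurable]
  have "\<bar>f x\<bar> \<le> B" if "x \<in> orthant" for x
    using B[OF that] by (intro tendsto_upperbound[OF tendsto_rabs[OF lim[OF that]]]) auto
  moreover have "scont (\<lambda>x. phi q x * f x)" if q: "\<forall>i. 0 < q i" for q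
  proof (rule scont_dominated[where w="\<lambda>x. phi q x * B" and h="\<lambda>n x. phi q x * h n x"])
    show "(\<lambda>x. phi q x * B) \<in> Lp_space M 2"
      using Lp_space_2_lincomb[OF phi_L2 phi_L2, of q q B 0] q by (simp add: mult.commute)
    show "scont (\<lambda>x. phi q x * h n x)" for n using h q by (auto simp: good_def)
    fix n x assume "x \<in> space M"
    then show "\<bar>phi q x * h n x\<bar> \<le> \<bar>phi q x * B\<bar>"
      using B[of x n] by (auto simp: abs_mult intro!: mult_left_mono)
    show "(\<lambda>n. phi q x * h n x) \<longlonglongrightarrow> phi q x * f x"
      using \<open>x \<in> space M\<close> by (intro tendsto_intros lim) simp
  qed measurable
  ultimately show ?thesis using f by (auto simp: good_def)
qed

lemma good_halfspace:
  assumes h: "good h"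
  shows "good (\<lambda>x. (if x $ i \<le> c then 1 else 0) * h x)"
proof -
  have [measurable]: "h \<in> borel_measurable M" using h by (auto simp: good_def)
  obtain B where B: "\<forall>x\<in>orthant. \<bar>h x\<bar> \<le> B" using h by (auto simp: good_def)
  have meas: "(\<lambda>x. (if x $ i \<le> c then 1 else 0) * h x) \<in> borel_measurable M" by measurable
  show ?thesis
  proof (cases "0 < c")
    case False
    \<comment> \<open>For \<open>c \<le> 0\<close> the half-space misses the orthant. The multiplier
      vanishes only there and not everywhere, so it is obtained as a limit of the zero function on
      the orthant.\<close>
    have 0: "(if x $ i \<le> c then 1 else 0) * h x = 0" if "x \<in> orthant" for x
    proof -
      have "0 < x $ i" using that by (simp add: orthant_def)
      then show ?thesis using False by simp
    qed
    show ?thesis by (rule good_limit[OF good_const[of 0], of 0, OF _ meas]) (simp_all add: 0)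
  next
    case True
    \<comment> \<open>Chosen so that the Gaussian \<open>U\<close> passes the threshold
      \<open>1/2\<close> exactly at \<open>x $ i = c\<close>.\<close>
    define r where "r = ln 2 / c\<^sup>2"
    have r: "0 < r" using True by (simp add: r_def)
    define U where "U x = exp (- r * (x $ i)\<^sup>2)" for x :: "real ^ 'n"
    have U: "0 \<le> U x" "U x \<le> 1" for x using r by (auto simp: U_def)
    have pow: "good (\<lambda>x. (1 - U x ^ n) ^ N * h x)" for n N
    proof (induction N)
      case 0 then show ?case using h by simp
    next
      case (Suc N)
      \<comment> \<open>A power of the Gaussian is a Gaussian again, so each further factor
        \<open>1 - U x ^ n\<close> costs one linear combination and one use of
        \<open>good_gaussian\<close>.\<close>
      have "U x ^ n = exp (- (real n * r) * (x $ i)\<^sup>2)" for x by (simp add: U_def exp_of_nat_mult[symmetric] mult_ac)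
      then have "(1 - U x ^ n) ^ Suc N * h x = 1 * ((1 - U x ^ n) ^ N * h x) + (- 1) * (exp (- (real n * r) * (x $ i)\<^sup>2) * ((1 - U x ^ n) ^ N * h x))" for x
        by (simp add: algebra_simps)
      then show ?case
        using good_lincomb[OF Suc good_gaussian[OF Suc, of "real n * r" i], of 1 "-1"] r by simp
    qed
    show ?thesis
    proof (rule good_limit[OF _ _ meas])
      show "good (\<lambda>x. 1 * h x + (- 1) * ((1 - U x ^ n) ^ (n * 2 ^ n) * h x))" for n
        by (rule good_lincomb[OF h pow])
      have eq: "1 * h x + (- 1) * ((1 - U x ^ n) ^ (n * 2 ^ n) * h x) = (1 - (1 - U x ^ n) ^ (n * 2 ^ n)) * h x" for x n
        by (simp add: algebra_simps)
      fix x :: "real ^ 'n" assume x: "x \<in> orthant"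
      show "\<bar>1 * h x + (- 1) * ((1 - U x ^ n) ^ (n * 2 ^ n) * h x)\<bar> \<le> B" for n
      proof -
        have "0 \<le> (1 - U x ^ n) ^ (n * 2 ^ n)" "(1 - U x ^ n) ^ (n * 2 ^ n) \<le> 1"
          using U[of x] by (auto intro!: power_le_one zero_le_power simp: power_le_one)
        then have "\<bar>1 - (1 - U x ^ n) ^ (n * 2 ^ n)\<bar> \<le> 1" by linarith
        then have "\<bar>1 - (1 - U x ^ n) ^ (n * 2 ^ n)\<bar> * \<bar>h x\<bar> \<le> 1 * \<bar>h x\<bar>" by (intro mult_right_mono) auto
        then show ?thesis using B x unfolding eq abs_mult by force
      qed
      have "1 / 2 \<le> U x \<longleftrightarrow> x $ i \<le> c"
      proof -
        have "1 / 2 \<le> U x \<longleftrightarrow> exp (- ln 2) \<le> exp (- r * (x $ i)\<^sup>2)" by (simp add: U_def exp_minus)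
        also have "\<dots> \<longleftrightarrow> ln 2 * (x $ i)\<^sup>2 \<le> ln 2 * c\<^sup>2" using True by (simp add: r_def field_simps)
        also have "\<dots> \<longleftrightarrow> (x $ i)\<^sup>2 \<le> c\<^sup>2" by simp
        also have "\<dots> \<longleftrightarrow> x $ i \<le> c" using x True by (auto simp: orthant_def abs_le_square_iff[symmetric] abs_of_pos)
        finally show ?thesis .
      qed
      then show "(\<lambda>n. 1 * h x + (- 1) * ((1 - U x ^ n) ^ (n * 2 ^ n) * h x)) \<longlonglongrightarrow> (if x $ i \<le> c then 1 else 0) * h x"
        unfolding eq using threshold_power_limit[OF U, of x] by (intro tendsto_mult tendsto_const) simp
    qed
  qed
qed

lemma good_box: "finite F \<Longrightarrow> good (\<lambda>x. \<Prod>i\<in>F. if x $ i \<le> a $ i then 1 else 0)"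
proof (induction F rule: finite_induct)
  case empty then show ?case using good_const[of 1] by simp
next
  case (insert i F)
  then show ?case using good_halfspace[of "\<lambda>x. \<Prod>i\<in>F. if x $ i \<le> a $ i then 1 else 0" i "a $ i"] by simp
qed

text \<open>Dynkin's argument: the lower boxes \<open>{..a}\<close> form an intersection-stable
  generator of the Borel sets, complements are linear combinations with 1, and disjoint unions are
  bounded pointwise limits.\<close>

lemma good_indicator:
  assumes "A \<in> sets borel"
  shows "good (indicator A)"
proof -
  have A: "A \<in> sigma_sets UNIV (range (\<lambda>a. {..a :: real ^ 'n}))"
    using assms by (simp add: borel_eq_atMost)
  have stable: "Int_stable (range (\<lambda>a. {..a :: real ^ 'n}))"
  proof (rule Int_stableI_image)
    fix a b :: "real ^ 'n"
    have "{..a} \<inter> {..b} = {..\<chi> i. min (a $ i) (b $ i)}" by (auto simp: less_eq_vec_def)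
    then show "\<exists>k\<in>UNIV. {..a} \<inter> {..b} = {..k}" by blast
  qed
  have "range (\<lambda>a. {..a :: real ^ 'n}) \<subseteq> Pow UNIV" by simp
  from stable this A show ?thesis
  proof (induction rule: sigma_sets_induct_disjoint)
    case (basic A)
    then obtain a where A: "A = {..a}" by auto
    have "indicator A = (\<lambda>x. \<Prod>i\<in>UNIV. if x $ i \<le> a $ i then 1 else (0::real))"
      by (auto simp: A indicator_def less_eq_vec_def fun_eq_iff prod_zero_iff)
    then show ?case using good_box[of UNIV a] by simp
  next
    case empty then show ?case using good_const[of 0] by (simp add: indicator_def)
  next
    case (compl A)
    have "indicator (UNIV - A) = (\<lambda>x. 1 * 1 + (- 1) * indicator A x :: real)" by (auto simp: indicator_def)
    then show ?case using good_lincomb[OF good_const[of 1] compl(2), of 1 "-1"] by simp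
  next
    case (union A)
    have A: "A n \<in> sets borel" for n using union(2) by (auto simp: borel_eq_atMost)
    have s: "good (\<lambda>x. \<Sum>k<n. indicator (A k) x)" for n
    proof (induction n)
      case 0 then show ?case using good_const[of 0] by simp
    next
      case (Suc n) then show ?case using good_lincomb[OF Suc union(3)[of n], of 1 1] by simp
    qed
    have eq: "(\<Sum>k<n. indicator (A k) x) = (indicator (\<Union>k<n. A k) x :: real)" for n x
      using union(1) by (intro indicator_UN_disjoint[symmetric]) (auto simp: disjoint_family_on_def)
    show ?case
    proof (rule good_limit[OF s, where B=1])
      fix x :: "real ^ 'n"
      show "\<bar>\<Sum>k<n. indicator (A k) x\<bar> \<le> (1::real)" for n unfolding eq by (simp add: indicator_def)
      show "(\<lambda>n. \<Sum>k<n. indicator (A k) x) \<longlonglongrightarrow> (indicator (\<Union>i. A i) x :: real)"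
        unfolding eq by (rule LIMSEQ_indicator_UN)
    qed (use A in measurable)
  qed
qed

lemma good_simple:
  assumes s: "simple_function M s"
  shows "good s"
proof -
  have fin: "finite (s ` space M)" using s by (simp add: simple_function_def)
  have A: "s -` {y} \<inter> space M \<in> sets borel" if "y \<in> s ` space M" for y
    using s that by (auto simp: simple_function_def dest: measurable_laguerre_iff_borel)
  have *: "good (\<lambda>x. \<Sum>y\<in>Y. y * indicator (s -` {y} \<inter> space M) x)" if "finite Y" "Y \<subseteq> s ` space M" for Y
    using that
  proof (induction Y rule: finite_induct)
    case empty then show ?case using good_const[of 0] by simp
  next
    case (insert y Y)
    then have "good (\<lambda>x. \<Sum>y\<in>Y. y * indicator (s -` {y} \<inter> space M) x)" "y \<in> s ` space M" by auto
    from good_lincomb[OF good_indicator[OF A[OF this(2)]] this(1), of y 1] show ?case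
      by (simp only: sum.insert[OF insert(1,2)] mult_1)
  qed
  have "s x = (\<Sum>y\<in>s ` space M. y * indicator (s -` {y} \<inter> space M) x)" if "x \<in> orthant" for x
  proof -
    have "(\<Sum>y\<in>s ` space M. y * indicator (s -` {y} \<inter> space M) x) = (\<Sum>y\<in>s ` space M. if y = s x then y else 0)"
      using that by (intro sum.cong) (auto simp: indicator_def)
    then show ?thesis using fin that by simp
  qed
  note eq = this
  obtain B where B: "\<forall>x\<in>orthant. \<bar>\<Sum>y\<in>s ` space M. y * indicator (s -` {y} \<inter> space M) x\<bar> \<le> B"
    using *[OF fin order_refl] unfolding good_def by blast
  show ?thesis
  \<comment> \<open>The representation of \<open>s\<close> holds on the orthant only; the limit
    lemma with a constant sequence transfers \<open>good\<close> across functions that agree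
    there.\<close>
  proof (rule good_limit[OF *[OF fin order_refl], of B])
    show "s \<in> borel_measurable M" by (rule borel_measurable_simple_function[OF s])
    fix x :: "real ^ 'n" assume x: "x \<in> orthant"
    show "\<bar>\<Sum>y\<in>s ` space M. y * indicator (s -` {y} \<inter> space M) x\<bar> \<le> B" using B x by blast
    show "(\<lambda>n. \<Sum>y\<in>s ` space M. y * indicator (s -` {y} \<inter> space M) x) \<longlonglongrightarrow> s x"
      unfolding eq[OF x, symmetric] by (rule tendsto_const)
  qed
qed

lemma scont_L2:
  assumes f: "f \<in> Lp_space M 2"
  shows "scont f"
proof -
  have [measurable]: "f \<in> borel_measurable M" using f by (simp add: Lp_space_2_iff)
  define p where "p = phi (\<lambda>_. 1)"
  have [measurable]: "p \<in> borel_measurable borel" unfolding p_def by measurable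
  have p: "0 < p x" if "x \<in> orthant" for x using that by (simp add: p_def phi_pos)
  \<comment> \<open>The weight \<open>p\<close> is positive on the orthant, so \<open>f\<close> is
    \<open>p\<close> times \<open>f / p\<close>. Simple functions approximating \<open>f / p\<close>
    are bounded multipliers, and the bound by twice the limit makes \<open>2 * f\<close> a majorant
    after multiplication by \<open>p\<close>.\<close>
  obtain s where s: "\<And>n. simple_function M (s n)" "\<And>x. x \<in> space M \<Longrightarrow> (\<lambda>n. s n x) \<longlonglongrightarrow> f x / p x"
    "\<And>n x. x \<in> space M \<Longrightarrow> dist (s n x) 0 \<le> 2 * dist (f x / p x) 0"
  proof -
    have "(\<lambda>x. f x / p x) \<in> borel_measurable M" by measurable
    from borel_measurable_implies_sequence_metric[OF this, of 0] that show ?thesis by blast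
  qed
  show ?thesis
  proof (rule scont_dominated[where h="\<lambda>n x. p x * s n x" and w="\<lambda>x. 2 * f x"])
    show "scont (\<lambda>x. p x * s n x)" for n
      using good_simple[OF s(1)] by (simp add: good_def p_def)
    show "(\<lambda>x. 2 * f x) \<in> Lp_space M 2" using Lp_space_2_lincomb[OF f f, of 2 0] by simp
    fix x assume x: "x \<in> space M"
    then have px: "0 < p x" using p by simp
    have "(\<lambda>n. p x * s n x) \<longlonglongrightarrow> p x * (f x / p x)" by (intro tendsto_intros s(2) x)
    then show "(\<lambda>n. p x * s n x) \<longlonglongrightarrow> f x" using px by simp
    show "\<bar>p x * s n x\<bar> \<le> \<bar>2 * f x\<bar>" for n
    proof -
      have "p x * \<bar>s n x\<bar> \<le> p x * (2 * \<bar>f x / p x\<bar>)" using s(3)[OF x, of n] px by (intro mult_left_mono) auto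
      then show ?thesis using px by (simp add: abs_mult)
    qed
  qed measurable
qed

end

section \<open>Markov property and contractivity\<close>

text \<open>The density is positive on the orthant, so null sets there are Lebesgue null, which a
  nonempty open set is not.\<close>

lemma not_AE_open_orthant:
  fixes A :: "(real ^ 'n) set"
  assumes A: "open A" "A \<noteq> {}" "A \<subseteq> orthant"
  shows "\<not> (AE x in laguerre_measure \<alpha>. x \<notin> A)"
proof
  assume "AE x in laguerre_measure \<alpha>. x \<notin> A"
  then have "AE x in restrict_space lborel orthant. 0 < ennreal (\<Prod>i\<in>UNIV. (x $ i) powr (2 * \<alpha> $ i + 1)) \<longrightarrow> x \<notin> A"
    unfolding laguerre_measure_def by (subst (asm) AE_density) (auto intro!: measurable_restrict_space1)
  then have "AE x in lborel. x \<in> orthant \<longrightarrow> 0 < ennreal (\<Prod>i\<in>UNIV. (x $ i) powr (2 * \<alpha> $ i + 1)) \<longrightarrow> x \<notin> A"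
    by (subst (asm) AE_restrict_space_iff) auto
  then have "AE x in lborel. x \<notin> A"
  proof eventually_elim
    case (elim x)
    show ?case
    proof
      assume x: "x \<in> A"
      have "0 < x $ i" for i using x A(3) by (auto simp: orthant_def)
      then have "0 < (\<Prod>i\<in>UNIV. (x $ i) powr (2 * \<alpha> $ i + 1))"
        by (intro prod_pos) (metis less_irrefl powr_gt_zero)
      then show False using elim x A by auto
    qed
  qed
  then have "A \<in> null_sets lborel" using A(1) by (subst AE_iff_null_sets) auto
  then have "negligible A" by (simp add: negligible_iff_null_sets null_sets_completionI)
  then show False using A open_not_negligible by blast
qed

section \<open>Operator norms and the failure of contractivity\<close>

context modified_laguerre
begin

abbreviation "T \<equiv> modified_laguerre_semigroup \<alpha> j"

lemma opnorm_le:
  assumes t: "0 < t" and B: "0 < B" "\<And>w. 0 < w \<Longrightarrow> lag_mass (gam j) w \<le> ennreal B" and p: "1 \<le> p"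
  shows "Lp_opnorm M p (T t) \<le> ennreal (B * exp (- 2 * t) * cosh (2 * t) powr (- ((\<Sum>i\<in>UNIV. \<alpha> $ i) + real CARD('n))))"
proof -
  have "T t = kernel_op M (K t)" using t by (simp add: modified_laguerre_eq fun_eq_iff)
  then show ?thesis using schur_kernel.Lp_opnorm_kernel_op_le[OF schur_kernel_K[OF t B] p] by simp
qed

lemma Beta_gam_pos: "0 < Beta 1 (gam j + 1 / 2)"
  using gam_j_gt Gamma_real_pos[of "gam j + 1 / 2"] Gamma_real_pos[of "1 + (gam j + 1 / 2)"]
  by (simp add: Beta_def)

text \<open>Contractivity in the supremum norm applied to 1 would give this at once, but 1 is not in
  \<open>L2\<close>. It is replaced by indicators of superlevel sets of the Gaussian test function,
  which lie in \<open>L2\<close>, have supremum norm at most 1 and increase to 1 on the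
  orthant.\<close>

lemma contractive_mass_le_1:
  assumes "Lp_contractive M T" and t: "0 < t"
  shows "AE x in M. (\<integral>\<^sup>+y. ennreal (K t x y) \<partial>M) \<le> 1"
proof -
  interpret schur_kernel M "K t" "(2 + 2 * Beta 1 (gam j + 1 / 2)) * exp (- 2 * t) * cosh (2 * t) powr (- ((\<Sum>i\<in>UNIV. \<alpha> $ i) + real CARD('n)))"
    using Beta_gam_pos by (intro schur_kernel_K t lag_mass_bounded gam_j_gt) (auto simp: add_pos_pos)
  define p where "p = phi (\<lambda>_. 1)"
  have [measurable]: "p \<in> borel_measurable borel" unfolding p_def by measurable
  define h where "h n = (\<lambda>x. if 1 < real (Suc n) * p x then 1 else 0 :: real)" for n
  have [measurable]: "h n \<in> borel_measurable M" for n unfolding h_def by measurable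
  have pL: "p \<in> Lp_space M 2" unfolding p_def by (rule phi_L2) simp
  have h2: "h n \<in> Lp_space M 2" for n
  proof -
    have "sqnorm M (h n) \<le> sqnorm M (\<lambda>x. real (Suc n) * p x)"
      by (rule sqnorm_mono) (auto simp: h_def)
    also have "\<dots> < \<infinity>" using pL by (subst sqnorm_cmult) (auto simp: Lp_space_2_iff ennreal_mult_less_top)
    finally show ?thesis by (simp add: Lp_space_2_iff)
  qed
  have h1: "Lp_norm M \<infinity> (h n) \<le> ennreal 1" for n
    by (rule Lp_norm_infinity_le) (auto simp: h_def)
  have "AE x in M. \<bar>kernel_op M (K t) (h n) x\<bar> \<le> 1" for n
  proof -
    have hi: "h n \<in> Lp_space M \<infinity>"
      using order_le_less_trans[OF h1 ennreal_less_top] by (simp add: Lp_space_def)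
    have "Lp_norm M \<infinity> (T t (h n)) \<le> Lp_norm M \<infinity> (h n)"
      using assms h2 hi unfolding Lp_contractive_def by (metis IntI less_imp_le top_greatest infinity_ennreal_def)
    also note h1
    finally have "Lp_norm M \<infinity> (kernel_op M (K t) (h n)) \<le> ennreal 1" using t by (simp add: modified_laguerre_eq)
    then show ?thesis by (intro Lp_norm_infinity_AE) auto
  qed
  then have "AE x in M. \<forall>n. \<bar>kernel_op M (K t) (h n) x\<bar> \<le> 1" by (simp add: AE_all_countable)
  then show ?thesis
    using AE_space
  proof eventually_elim
    case (elim x)
    note x = \<open>x \<in> space M\<close>
    have mono: "incseq (\<lambda>n y. ennreal (K t x y * h n y))"
    proof (intro incseq_SucI le_funI)
      fix n y
      have "ennreal (K t x y * h n y) \<le> ennreal (K t x y * h (Suc n) y)"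
      \<comment> \<open>Monotonicity is claimed for every point of the type, and off the orthant the
        sign of the kernel is not controlled; where it is negative, \<open>ennreal\<close> truncates
        to 0.\<close>
      proof (cases "0 \<le> K t x y")
        case True
        have "h n y \<le> h (Suc n) y"
        proof (cases "1 < real (Suc n) * p y")
          case ny: True
          then have "0 < p y" by (smt (verit) mult_nonneg_nonpos of_nat_0_le_iff)
          then have "real (Suc n) * p y \<le> real (Suc (Suc n)) * p y" by (intro mult_right_mono) auto
          then show ?thesis using ny by (simp add: h_def)
        qed (simp add: h_def)
        then show ?thesis using True by (intro ennreal_leI mult_left_mono)
      next
        case False
        then have "K t x y * h n y \<le> 0" by (simp add: h_def)
        then show ?thesis by (simp add: ennreal_neg)
      qed
      then show "ennreal (K t x y * h n y) \<le> ennreal (K t x y * h (Suc n) y)" .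
    qed
    have sup: "ennreal (K t x y) = (SUP n. ennreal (K t x y * h n y))" if y: "y \<in> space M" for y
    proof (rule antisym)
      have py: "0 < p y" using y by (simp add: p_def phi_pos)
      obtain n where "1 / p y < real n" using reals_Archimedean2 by blast
      then have "1 < real n * p y" using py by (simp add: field_simps)
      also have "\<dots> \<le> real (Suc n) * p y" using py by (intro mult_right_mono) auto
      finally have "h n y = 1" by (simp add: h_def)
      then show "ennreal (K t x y) \<le> (SUP n. ennreal (K t x y * h n y))" by (intro SUP_upper2[of n]) auto
      show "(SUP n. ennreal (K t x y * h n y)) \<le> ennreal (K t x y)"
        using kernel_nonneg[OF x y] by (intro SUP_least) (auto simp: h_def)
    qed
    note measurable_kernel_Pair1[OF x, measurable]
    have "(\<integral>\<^sup>+y. ennreal (K t x y) \<partial>M) = (\<integral>\<^sup>+y. (SUP n. ennreal (K t x y * h n y)) \<partial>M)"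
      by (intro nn_integral_cong sup)
    also have "\<dots> = (SUP n. \<integral>\<^sup>+y. ennreal (K t x y * h n y) \<partial>M)"
      by (rule nn_integral_monotone_convergence_SUP[OF mono]) measurable
    also have "\<dots> \<le> 1"
    proof (rule SUP_least)
      fix n
      have "integrable M (\<lambda>y. K t x y * h n y)"
        by (rule kernel_op_bounded_le(1)[where B=1]) (use x in \<open>auto simp: h_def\<close>)
      then have "(\<integral>\<^sup>+y. ennreal (K t x y * h n y) \<partial>M) = ennreal (kernel_op M (K t) (h n) x)"
        unfolding kernel_op_def using kernel_nonneg[OF x] by (intro nn_integral_eq_integral AE_I2) (auto simp: h_def)
      also have "\<dots> \<le> ennreal 1" using elim(1) by (intro ennreal_leI) (meson abs_le_D1)
      finally show "(\<integral>\<^sup>+y. ennreal (K t x y * h n y) \<partial>M) \<le> 1" by simp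
    qed
    finally show ?case .
  qed
qed

lemma not_contractive:
  assumes a: "\<alpha> $ j < - 1 / 2"
  shows "\<not> Lp_contractive M T"
proof
  assume contr: "Lp_contractive M T"
  have g: "gam j < 1 / 2" using a by (simp add: gam_j)
  obtain w0 d where w0: "1 < w0" and d: "0 < d" and mass: "\<And>w. w0 \<le> w \<Longrightarrow> w \<le> w0 + 1 \<Longrightarrow> ennreal (1 + d) \<le> lag_mass (gam j) w"
    using lag_mass_greater_1[OF gam_j_gt g] by blast
  define \<sigma> where "\<sigma> = (\<Sum>i\<in>UNIV. \<alpha> $ i) + real CARD('n)"
  \<comment> \<open>A lower bound for the mass at all points of the set \<open>A\<close> below: the
    other coordinates are at most 1, \<open>w\<close> is at most \<open>w0 + 1\<close>, and
    \<open>lag_mass\<close> is at least \<open>1 + d\<close>. It tends to \<open>1 + d\<close> as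
    \<open>t\<close> tends to 0, so some \<open>t\<close> makes it exceed 1.\<close>
  define R where "R t = exp (- 2 * t) * cosh (2 * t) powr (- \<sigma>) * exp (- (sinh (2 * t) / (2 * cosh (2 * t)) * real CARD('n)) - (w0 + 1) * (sinh (2 * t))\<^sup>2) * (1 + d)" for t
  note c = tendsto_cosh_2t and s = tendsto_sinh_2t
  have "(R \<longlongrightarrow> exp (- 2 * 0) * 1 powr (- \<sigma>) * exp (- (0 / (2 * 1) * real CARD('n)) - (w0 + 1) * 0\<^sup>2) * (1 + d)) (at_right 0)"
    unfolding R_def by (intro tendsto_intros c s) simp_all
  then have "eventually (\<lambda>t. 1 < R t) (at_right 0)" using d by (intro order_tendstoD(1)) auto
  moreover have "eventually (\<lambda>t::real. 0 < t) (at_right 0)" by (simp add: eventually_at_filter)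
  ultimately have "eventually (\<lambda>t. 1 < R t \<and> 0 < t) (at_right 0)" by eventually_elim simp
  then obtain t where R: "1 < R t" and t: "0 < t"
    using eventually_happens'[OF trivial_limit_at_right_real] by blast
  define C where "C = cosh (2 * t)"
  define S where "S = sinh (2 * t)"
  have C: "0 < C" and S: "0 < S" using t by (auto simp: C_def S_def)
  \<comment> \<open>The condition on \<open>x $ j\<close> says that \<open>w\<close> lies strictly
    between \<open>w0\<close> and \<open>w0 + 1\<close>; strict inequalities make the set open, and
    the midpoint value of \<open>w\<close> shows that it is not empty.\<close>
  define A where "A = {x \<in> orthant. (\<forall>i\<in>UNIV - {j}. x $ i < 1) \<and> w0 * (2 * S * C) < (x $ j)\<^sup>2 \<and> (x $ j)\<^sup>2 < (w0 + 1) * (2 * S * C)}"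
  have "open A"
  proof -
    have "A = orthant \<inter> (\<Inter>i\<in>UNIV - {j}. {x. x $ i < 1}) \<inter> {x. w0 * (2 * S * C) < (x $ j)\<^sup>2} \<inter> {x. (x $ j)\<^sup>2 < (w0 + 1) * (2 * S * C)}"
      by (auto simp: A_def)
    then show ?thesis by (auto intro!: open_Int open_orthant open_INT open_Collect_less continuous_intros)
  qed
  moreover have "A \<noteq> {}"
  proof -
    define x :: "real ^ 'n" where "x = (\<chi> i. if i = j then sqrt ((w0 + 1 / 2) * (2 * S * C)) else 1 / 2)"
    have SC: "0 < 2 * S * C" using S C by simp
    have "0 < (w0 + 1 / 2) * (2 * S * C)" by (rule mult_pos_pos[OF _ SC]) (use w0 in simp)
    moreover from this have "(x $ j)\<^sup>2 = (w0 + 1 / 2) * (2 * S * C)" by (simp add: x_def)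
    moreover have "w0 * (2 * S * C) < (w0 + 1 / 2) * (2 * S * C)" "(w0 + 1 / 2) * (2 * S * C) < (w0 + 1) * (2 * S * C)"
      by (rule mult_strict_right_mono[OF _ SC], simp)+
    ultimately have "x \<in> A" by (auto simp: A_def orthant_def x_def)
    then show ?thesis by blast
  qed
  moreover have "A \<subseteq> orthant" by (auto simp: A_def)
  ultimately have "\<not> (AE x in M. x \<notin> A)" by (rule not_AE_open_orthant)
  moreover have "AE x in M. x \<notin> A"
    using contractive_mass_le_1[OF contr t]
  proof eventually_elim
    case (elim x)
    show ?case
    proof
      assume x: "x \<in> A"
      then have xo: "x \<in> orthant" by (simp add: A_def)
      define w where "w = (x $ j)\<^sup>2 / (2 * S * C)"
      have "w0 < w" "w < w0 + 1" using x S C by (auto simp: A_def w_def field_simps)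
      then have m: "ennreal (1 + d) \<le> lag_mass (gam j) w" by (intro mass) auto
      define E where "E = exp (- (\<Sum>i\<in>UNIV - {j}. S / (2 * C) * (x $ i)\<^sup>2) - w * S\<^sup>2)"
      have "(\<Sum>i\<in>UNIV - {j}. S / (2 * C) * (x $ i)\<^sup>2) \<le> (\<Sum>i\<in>UNIV - {j}. S / (2 * C))"
      proof (rule sum_mono)
        fix i assume "i \<in> UNIV - {j}"
        then have "0 \<le> x $ i" "x $ i \<le> 1" using x by (auto simp: A_def orthant_def less_imp_le)
        then have "(x $ i)\<^sup>2 \<le> 1" by (simp add: power_le_one)
        then show "S / (2 * C) * (x $ i)\<^sup>2 \<le> S / (2 * C)" using S C by (intro mult_left_le) auto
      qed
      also have "\<dots> \<le> (\<Sum>i\<in>(UNIV :: 'n set). S / (2 * C))" using S C by (intro sum_mono2) auto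
      finally have 1: "(\<Sum>i\<in>UNIV - {j}. S / (2 * C) * (x $ i)\<^sup>2) \<le> S / (2 * C) * real CARD('n)" by (simp add: mult.commute)
      have 2: "w * S\<^sup>2 \<le> (w0 + 1) * S\<^sup>2" using \<open>w < w0 + 1\<close> by (intro mult_right_mono) auto
      have E: "exp (- (S / (2 * C) * real CARD('n)) - (w0 + 1) * S\<^sup>2) \<le> E"
        unfolding E_def using 1 2 by simp
      define P where "P = exp (- 2 * t) * C powr (- \<sigma>)"
      have P: "0 \<le> P" by (simp add: P_def)
      have "P * exp (- (S / (2 * C) * real CARD('n)) - (w0 + 1) * S\<^sup>2) * (1 + d) \<le> P * E * (1 + d)"
        using E P d by (intro mult_right_mono mult_left_mono) auto
      moreover have "R t = P * exp (- (S / (2 * C) * real CARD('n)) - (w0 + 1) * S\<^sup>2) * (1 + d)"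
        by (simp only: R_def P_def C_def S_def)
      ultimately have "1 < P * E * (1 + d)" using R by linarith
      then have "1 < ennreal (P * E * (1 + d))" by (metis ennreal_1 ennreal_less_iff zero_le_one)
      also have "\<dots> = ennreal (P * E) * ennreal (1 + d)" using P by (intro ennreal_mult') (simp add: E_def)
      also have "\<dots> \<le> ennreal (P * E) * lag_mass (gam j) w" by (intro mult_left_mono m) simp
      also have "\<dots> = (\<integral>\<^sup>+y. ennreal (K t x y) \<partial>M)"
        using nn_integral_K[OF t xo] by (simp add: P_def E_def w_def C_def S_def \<sigma>_def)
      finally show False using elim by simp
    qed
  qed
  ultimately show False by blast
qed

end

section \<open>The submarkovian case\<close>

context submarkovian_laguerre
begin

lemma T_pos: "0 < t \<Longrightarrow> T t = kernel_op M (K t)"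
  by (simp add: modified_laguerre_eq fun_eq_iff)

lemma T_0: "T 0 f = f"
  by (simp add: modified_laguerre_eq)

text \<open>Common domain of the operators. Integrability for almost every \<open>x\<close> is
  imposed because the Bochner integral of a non-integrable function is 0, which would destroy
  linearity; by the Schur bound every \<open>L\<^sup>p\<close> is contained in it.\<close>

definition lag_domain :: "(real ^ 'n \<Rightarrow> real) set" where
  "lag_domain = {f \<in> borel_measurable M. \<forall>t>0. AE x in M. integrable M (\<lambda>y. K t x y * f y)}"

lemma operator_family: "operator_family_on M lag_domain T"
  unfolding operator_family_on_def
proof (intro conjI allI impI ballI)
  show "lag_domain \<subseteq> borel_measurable M" by (auto simp: lag_domain_def)
next
  fix p :: ennreal assume p: "1 \<le> p"
  show "Lp_space M p \<subseteq> lag_domain"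
    using schur_kernel.integrable_kernel_Lp_AE[OF kernel p] by (auto simp: lag_domain_def Lp_space_def)
next
  fix f g a b assume f: "f \<in> lag_domain" and g: "g \<in> lag_domain"
  have [measurable]: "f \<in> borel_measurable M" "g \<in> borel_measurable M" using f g by (auto simp: lag_domain_def)
  have "AE x in M. integrable M (\<lambda>y. K t x y * (a * f y + b * g y))" if t: "0 < t" for t
  proof -
    have "AE x in M. integrable M (\<lambda>y. K t x y * f y)" "AE x in M. integrable M (\<lambda>y. K t x y * g y)"
      using f g t by (auto simp: lag_domain_def)
    then show ?thesis
    proof eventually_elim
      case (elim x)
      then have "integrable M (\<lambda>y. a * (K t x y * f y) + b * (K t x y * g y))" by simp
      then show ?case by (simp add: distrib_left mult.left_commute)
    qed
  qed
  then show "(\<lambda>x. a * f x + b * g x) \<in> lag_domain" by (auto simp: lag_domain_def)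
next
  fix t :: real and f assume "0 \<le> t" "f \<in> lag_domain"
  then show "T t f \<in> borel_measurable M"
    by (cases "t = 0") (auto simp: T_0 T_pos lag_domain_def)
next
  fix t :: real and f g assume t: "0 \<le> t" and f: "f \<in> lag_domain" and g: "g \<in> lag_domain" and eq: "AE x in M. f x = g x"
  have [measurable]: "f \<in> borel_measurable M" "g \<in> borel_measurable M" using f g by (auto simp: lag_domain_def)
  show "AE x in M. T t f x = T t g x"
  proof (cases "t = 0")
    case False
    then have t0: "0 < t" using t by simp
    interpret S: schur_kernel M "K t" 1 by (rule kernel[OF t0])
    show ?thesis
    proof (intro AE_I2)
      fix x assume x: "x \<in> space M"
      note S.measurable_kernel_Pair1[OF x, measurable]
      show "T t f x = T t g x"
        unfolding T_pos[OF t0] kernel_op_def using eq by (intro integral_cong_AE) (auto elim!: eventually_mono)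
    qed
  qed (use eq in \<open>simp add: T_0\<close>)
next
  fix t :: real and f g a b assume t: "0 \<le> t" and f: "f \<in> lag_domain" and g: "g \<in> lag_domain"
  show "AE x in M. T t (\<lambda>y. a * f y + b * g y) x = a * T t f x + b * T t g x"
  proof (cases "t = 0")
    case False
    then have t0: "0 < t" using t by simp
    have "AE x in M. integrable M (\<lambda>y. K t x y * f y)" "AE x in M. integrable M (\<lambda>y. K t x y * g y)"
      using f g t0 by (auto simp: lag_domain_def)
    then show ?thesis
      by eventually_elim (simp add: T_pos[OF t0] kernel_op_def distrib_left mult.left_commute[of _ a] mult.left_commute[of _ b])
  qed (simp add: T_0)
qed (simp add: T_0)

lemma Lp_norm_T_le:
  assumes p: "1 \<le> p" and f: "f \<in> Lp_space M p" and t: "0 \<le> t"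
  shows "Lp_norm M p (T t f) \<le> Lp_norm M p f"
  using schur_kernel.Lp_norm_kernel_op_le[OF kernel p f, of t] t by (cases "t = 0") (auto simp: T_0 T_pos)

lemma T_semigroup:
  assumes p: "1 \<le> p" and f: "f \<in> Lp_space M p" and s: "0 \<le> s" and t: "0 \<le> t"
  shows "AE x in M. T (s + t) f x = T s (T t f) x"
proof (cases "s = 0 \<or> t = 0")
  case False
  then have st: "0 < s" "0 < t" using s t by auto
  then have "AE x in M. kernel_op M (K (s + t)) f x = kernel_op M (K s) (kernel_op M (K t) f) x"
    by (intro kernel_op_compose[OF kernel kernel kernel _ p f] K_Chapman_Kolmogorov) auto
  then show ?thesis using st by (simp add: T_pos)
qed (auto simp: T_0)

lemma symmetric_diffusion: "symmetric_diffusion_semigroup_on M lag_domain T"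
  unfolding symmetric_diffusion_semigroup_on_def
proof (intro conjI allI impI ballI)
  fix t :: real and f g assume "0 \<le> t" and fg: "f \<in> Lp_space M 2" "g \<in> Lp_space M 2"
  then show "(\<integral>x. T t f x * g x \<partial>M) = (\<integral>x. f x * T t g x \<partial>M)"
    using schur_kernel.kernel_op_symmetric[OF kernel fg, of t] by (cases "t = 0") (auto simp: T_0 T_pos)
next
  fix f assume f: "f \<in> Lp_space M 2"
  then have fm: "f \<in> borel_measurable M" by (simp add: Lp_space_2_iff)
  have lim: "((\<lambda>t. sqnorm M (\<lambda>x. kernel_op M (K t) f x - f x)) \<longlongrightarrow> 0) (at_right 0)"
    using scont_L2[OF f] by (simp add: scont_def)
  show "((\<lambda>t. Lp_norm M 2 (\<lambda>x. T t f x - f x)) \<longlongrightarrow> 0) (at_right 0)"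
  proof (rule order_tendstoI)
    fix e :: ennreal assume e: "0 < e"
    obtain e' where e': "0 < e'" "e' < e" using e dense by blast
    then have "e' \<noteq> top" by auto
    then obtain r where r: "e' = ennreal r" "0 \<le> r" by (cases e') auto
    have r0: "0 < r" using e' r by (simp add: ennreal_less_zero_iff)
    have "eventually (\<lambda>t. sqnorm M (\<lambda>x. kernel_op M (K t) f x - f x) < ennreal (r\<^sup>2)) (at_right 0)"
      using r0 by (intro order_tendstoD(2)[OF lim]) simp
    moreover have "eventually (\<lambda>t::real. 0 < t) (at_right 0)" by (simp add: eventually_at_filter)
    ultimately show "eventually (\<lambda>t. Lp_norm M 2 (\<lambda>x. T t f x - f x) < e) (at_right 0)"
    proof eventually_elim
      case (elim t)
      note measurable_op[OF elim(2) fm, measurable] fm[measurable]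
      have "Lp_norm M 2 (\<lambda>x. kernel_op M (K t) f x - f x) < ennreal r"
        by (rule Lp_norm_2_less[OF _ r0 elim(1)]) measurable
      then show ?case using e' r elim(2) by (simp add: T_pos)
    qed
  qed simp
qed (use operator_family sigma_finite_laguerre Lp_norm_T_le T_semigroup in auto)

lemma T_1_le: "0 < t \<Longrightarrow> x \<in> space M \<Longrightarrow> T t (\<lambda>_. 1) x \<le> bound t"
  using schur_kernel.integral_kernel_le[OF schur_kernel_bound, of t x] by (simp add: T_pos kernel_op_def)

lemma submarkovian: "submarkovian_semigroup M T"
  unfolding submarkovian_semigroup_def
proof (intro exI conjI allI impI)
  show "symmetric_diffusion_semigroup_on M lag_domain T" by (rule symmetric_diffusion)
  show "positivity_preserving_on M lag_domain T"
    unfolding positivity_preserving_on_def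
  proof (intro allI impI ballI)
    fix t :: real and f assume t: "0 \<le> t" and f: "f \<in> lag_domain" and f0: "AE x in M. 0 \<le> f x"
    show "AE x in M. 0 \<le> T t f x"
    proof (cases "t = 0")
      case False
      then have t0: "0 < t" using t by simp
      show ?thesis
      proof (intro AE_I2)
        fix x assume x: "x \<in> space M"
        have "AE y in M. 0 \<le> K t x y * f y"
          using f0 AE_space by eventually_elim (use x t0 K_nonneg in auto)
        then show "0 \<le> T t f x" unfolding T_pos[OF t0] kernel_op_def by (rule integral_nonneg_AE)
      qed
    qed (use f0 in \<open>simp add: T_0\<close>)
  qed
  fix t :: real assume t: "0 \<le> t"
  show "AE x in M. T t (\<lambda>_. 1) x \<le> 1"
  proof (cases "t = 0")
    case False
    then have t0: "0 < t" using t by simp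
    show ?thesis using T_1_le[OF t0] bound_less_1[OF t0] by (intro AE_I2) (meson less_imp_le order_trans)
  qed (simp add: T_0)
qed

text \<open>Already at \<open>t = 1\<close> the image of 1 is at most \<open>bound 1 < 1\<close> at
  every point, and the orthant is not a null set.\<close>

lemma not_markovian: "\<not> markovian_semigroup M T"
proof
  assume "markovian_semigroup M T"
  then have "AE x in M. T 1 (\<lambda>_. 1) x = 1" by (auto simp: markovian_semigroup_def)
  then have "AE x in M. x \<notin> orthant"
    using AE_space by eventually_elim (use T_1_le[of 1] bound_less_1[of 1] in force)
  moreover have "(\<chi> i. 1 :: real ^ 'n) \<in> orthant" by (simp add: orthant_def)
  then have "orthant \<noteq> ({} :: (real ^ 'n) set)" by blast
  ultimately show False using not_AE_open_orthant[OF open_orthant] by blast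
qed

end

theorem proposition5p2:
  fixes \<alpha> :: "real ^ 'n" and j :: 'n
  assumes "\<alpha> $ j > - 3 / 2"
    and "\<And>i. i \<noteq> j \<Longrightarrow> \<alpha> $ i > - 1"
  shows "(\<alpha> $ j \<ge> - 1 / 2 \<longrightarrow>
            submarkovian_semigroup (laguerre_measure \<alpha>) (modified_laguerre_semigroup \<alpha> j) \<and>
            \<not> markovian_semigroup (laguerre_measure \<alpha>) (modified_laguerre_semigroup \<alpha> j) \<and>
            (\<forall>p\<ge>1. \<forall>t>0.
               Lp_opnorm (laguerre_measure \<alpha>) p (modified_laguerre_semigroup \<alpha> j t)
                 \<le> ennreal (exp (- 2 * t)
                     * cosh (2 * t) powr (- ((\<Sum>i\<in>UNIV. \<alpha> $ i) + real CARD('n))))))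
       \<and> (\<alpha> $ j < - 1 / 2 \<longrightarrow>
            \<not> Lp_contractive (laguerre_measure \<alpha>) (modified_laguerre_semigroup \<alpha> j) \<and>
            (\<exists>c>1. \<forall>p\<ge>1. \<forall>t>0.
               Lp_opnorm (laguerre_measure \<alpha>) p (modified_laguerre_semigroup \<alpha> j t)
                 \<le> ennreal (c * exp (- 2 * t)
                     * cosh (2 * t) powr (- ((\<Sum>i\<in>UNIV. \<alpha> $ i) + real CARD('n))))))"
proof -
  interpret modified_laguerre \<alpha> j using assms by unfold_locales auto
  show ?thesis
  proof (intro conjI impI)
    assume a: "- 1 / 2 \<le> \<alpha> $ j"
    interpret submarkovian_laguerre \<alpha> j using a by unfold_locales
    show "submarkovian_semigroup (laguerre_measure \<alpha>) (modified_laguerre_semigroup \<alpha> j)" by (rule submarkovian)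
    show "\<not> markovian_semigroup (laguerre_measure \<alpha>) (modified_laguerre_semigroup \<alpha> j)" by (rule not_markovian)
    have "1 / 2 \<le> gam j" using a by (simp add: gam_j)
    then show "\<forall>p\<ge>1. \<forall>t>0. Lp_opnorm (laguerre_measure \<alpha>) p (modified_laguerre_semigroup \<alpha> j t)
      \<le> ennreal (exp (- 2 * t) * cosh (2 * t) powr (- ((\<Sum>i\<in>UNIV. \<alpha> $ i) + real CARD('n))))"
      using opnorm_le[where B=1] lag_mass_le_1 by simp
  next
    assume a: "\<alpha> $ j < - 1 / 2"
    show "\<not> Lp_contractive (laguerre_measure \<alpha>) (modified_laguerre_semigroup \<alpha> j)" by (rule not_contractive[OF a])
    define c where "c = 2 + 2 * Beta 1 (gam j + 1 / 2)"
    have "1 < c" using Beta_gam_pos by (simp add: c_def)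
    moreover have "Lp_opnorm (laguerre_measure \<alpha>) p (modified_laguerre_semigroup \<alpha> j t)
       \<le> ennreal (c * exp (- 2 * t) * cosh (2 * t) powr (- ((\<Sum>i\<in>UNIV. \<alpha> $ i) + real CARD('n))))" if "1 \<le> p" "0 < t" for p t
      using \<open>1 < c\<close> that gam_j_gt by (intro opnorm_le) (auto simp: c_def intro!: lag_mass_bounded)
    ultimately show "\<exists>c>1. \<forall>p\<ge>1. \<forall>t>0. Lp_opnorm (laguerre_measure \<alpha>) p (modified_laguerre_semigroup \<alpha> j t)
      \<le> ennreal (c * exp (- 2 * t) * cosh (2 * t) powr (- ((\<Sum>i\<in>UNIV. \<alpha> $ i) + real CARD('n))))"
      by blast
  qed
qed

end
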